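(* Let $n\ge 2$, let $\Omega\subset\mathbf{R}^n$ be a bounded simple domain, and let $\varphi:\Omega\to\Omega'$ be a quasiconformal homeomorphism of $\Omega$ onto a bounded domain $\Omega'\subset\mathbf{R}^n$. If $\{E_i\}$ is a Whitney family of $\Omega$, then the image family $\{\varphi(E_i)\}$ is a rough Whitney family of $\Omega'$.
   Context: Simple domain: a domain $\Omega\subset\mathbf{R}^n$ is simple if $\mathbf{R}^n\setminus\Omega$ is unbounded and connected. Dilatation of a set: for a bounded set $A\subset\mathbf{R}^n$ with nonempty interior, the interior radius $r_A$ is the greatest radius of a ball contained in $A$, the exterior radius $R_A$ is the smallest radius of a ball containing $A$, and the (interior) dilatation is $K_A=R_A/r_A$. The diameter of $E$ is denoted $\delta(E)$. Whitney family of a bounded domain $\Omega$: put $\Lambda=\mathbf{R}^n\setminus\Omega$. A family $\{E_i\}$ of convex closed $n$-dimensional polyhedra in $\mathbf{R}^n$, disjoint from $\Lambda$, covering $\Omega$, with pairwise disjoint interiors, with uniformly bounded dilatation ($\sup_i K_{E_i}<\infty$), whose edges have lengths uniformly comparable to the diameter of the polyhedron, and such that for some constant $C>0$ and all $i$: $\delta(E_i)\ge C\,\mathrm{dist}(E_i,\Lambda)$ and $\delta(E_i)\le C^{-1}\,\mathrm{dist}(E_i,\Lambda)$. Rough Whitney family of a bounded set $\Omega$: put $\Lambda=\mathbf{R}^n\setminus\Omega$. A family $\{E_i\}$ of closed sets in $\mathbf{R}^n$ with nonempty interiors $V_i=\mathrm{Int}(E_i)$ such that the closure of $V_i$ is $E_i$,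 the $E_i$ are disjoint from $\Lambda$ and cover $\Omega$, the $V_i$ are pairwise disjoint, $\sup_i K_{E_i}<\infty$, and for some constant $C>0$ and all $i$: $\delta(E_i)\ge C\,\mathrm{dist}(E_i,\Lambda)$ and $\delta(E_i)\le C^{-1}\,\mathrm{dist}(E_i,\Lambda)$. Conformal capacity: a condenser is a triple $(F_0,F_1;\Omega)$ of nonempty sets with $\Omega\subset\mathbf{R}^n$ open and $F_0,F_1$ closed subsets of $\overline\Omega$. Its conformal capacity is $\mathrm{Cap}(F_0,F_1;\Omega)=\inf\int_\Omega|\nabla v|^n\,dx$, the infimum over all Lipschitz non-negative functions $v:\overline\Omega\to\mathbf{R}$ with $v=0$ on $F_0$ and $v=1$ on $F_1$ (equal to $\infty$ if there are no such functions). Quasiconformality: for $Q\ge1$, a homeomorphism $\varphi:\Omega\to\Omega'$ between domains in $\mathbf{R}^n$, $n\ge2$, is $Q$-quasiconformal if $Q^{-1}\mathrm{Cap}(F_0,F_1;\Omega)\le\mathrm{Cap}(\varphi(F_0),\varphi(F_1);\Omega')\le Q\,\mathrm{Cap}(F_0,F_1;\Omega)$ for every condenser $(F_0,F_1;\Omega)$ (with $F_0,F_1\subset\Omega$ and such that $(\varphi(F_0),\varphi(F_1);\Omega')$ is again a condenser, so that the expressions make sense). It is quasiconformal if it is $Q$-quasiconformal for some $Q\ge1$. *)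

theory Defs
  imports "HOL-Analysis.Analysis"
begin

definition is_domain :: "'a::topological_space set \<Rightarrow> bool" where
  "is_domain \<Omega> \<longleftrightarrow> open \<Omega> \<and> connected \<Omega> \<and> \<Omega> \<noteq> {}"

definition simple_domain :: "(real ^ 'n) set \<Rightarrow> bool" where
  "simple_domain \<Omega> \<longleftrightarrow> is_domain \<Omega> \<and> \<not> bounded (- \<Omega>) \<and> connected (- \<Omega>)"

section \<open>Dilatation of a set\<close>

text \<open>
  The radii are only meaningful for bounded sets with nonempty interior. Closed balls are used; for
  such sets open balls give the same supremum and infimum. The exterior radius is always attained,
  the interior radius whenever the set is closed.
\<close>

definition interior_radius :: "(real ^ 'n) set \<Rightarrow> real" where
  "interior_radius A = Sup {r. 0 < r \<and> (\<exists>x. cball x r \<subseteq> A)}"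

definition exterior_radius :: "(real ^ 'n) set \<Rightarrow> real" where
  "exterior_radius A = Inf {r. 0 < r \<and> (\<exists>x. A \<subseteq> cball x r)}"

definition dilatation :: "(real ^ 'n) set \<Rightarrow> real" where
  "dilatation A = exterior_radius A / interior_radius A"

section \<open>Whitney families\<close>

definition diameter_comparable_to_dist ::
    "(real ^ 'n) set \<Rightarrow> 'i set \<Rightarrow> ('i \<Rightarrow> (real ^ 'n) set) \<Rightarrow> bool" where
  "diameter_comparable_to_dist \<Omega> I E \<longleftrightarrow>
     (\<exists>C>0. \<forall>i\<in>I. diameter (E i) \<ge> C * setdist (E i) (- \<Omega>)
                \<and> diameter (E i) \<le> inverse C * setdist (E i) (- \<Omega>))"

text \<open>
  The members of either kind of family are bounded, being contained in \<open>\<Omega>\<close>. A polyhedron in the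
  library sense is a finite intersection of closed half-spaces, hence closed and convex.
\<close>

definition whitney_family ::
    "(real ^ 'n) set \<Rightarrow> 'i set \<Rightarrow> ('i \<Rightarrow> (real ^ 'n) set) \<Rightarrow> bool" where
  "whitney_family \<Omega> I E \<longleftrightarrow>
     is_domain \<Omega> \<and> bounded \<Omega>
   \<and> (\<forall>i\<in>I. polyhedron (E i) \<and> aff_dim (E i) = int CARD('n))
   \<and> (\<forall>i\<in>I. E i \<inter> - \<Omega> = {})
   \<and> \<Omega> \<subseteq> (\<Union>i\<in>I. E i)
   \<and> disjoint_family_on (\<lambda>i. interior (E i)) I
   \<and> bdd_above ((\<lambda>i. dilatation (E i)) ` I)
   \<and> (\<exists>c>0. \<forall>i\<in>I. \<forall>e. e edge_of E i \<longrightarrow>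
        diameter e \<ge> c * diameter (E i) \<and> diameter e \<le> inverse c * diameter (E i))
   \<and> diameter_comparable_to_dist \<Omega> I E"

definition rough_whitney_family ::
    "(real ^ 'n) set \<Rightarrow> 'i set \<Rightarrow> ('i \<Rightarrow> (real ^ 'n) set) \<Rightarrow> bool" where
  "rough_whitney_family \<Omega> I E \<longleftrightarrow>
     bounded \<Omega>
   \<and> (\<forall>i\<in>I. closed (E i) \<and> interior (E i) \<noteq> {} \<and> closure (interior (E i)) = E i)
   \<and> (\<forall>i\<in>I. E i \<inter> - \<Omega> = {})
   \<and> \<Omega> \<subseteq> (\<Union>i\<in>I. E i)
   \<and> disjoint_family_on (\<lambda>i. interior (E i)) I
   \<and> bdd_above ((\<lambda>i. dilatation (E i)) ` I)
   \<and> diameter_comparable_to_dist \<Omega> I E"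

section \<open>Conformal capacity and quasiconformality\<close>

text \<open>
  A Lipschitz function is differentiable almost everywhere on an open set, so the value chosen at
  points of non-differentiability does not affect the capacity.
\<close>

definition gradient :: "(real ^ 'n \<Rightarrow> real) \<Rightarrow> real ^ 'n \<Rightarrow> real ^ 'n" where
  "gradient v x = (if \<exists>D. GDERIV v x :> D then THE D. GDERIV v x :> D else 0)"

definition condenser ::
    "(real ^ 'n) set \<Rightarrow> (real ^ 'n) set \<Rightarrow> (real ^ 'n) set \<Rightarrow> bool" where
  "condenser F\<^sub>0 F\<^sub>1 \<Omega> \<longleftrightarrow>
     F\<^sub>0 \<noteq> {} \<and> F\<^sub>1 \<noteq> {} \<and> \<Omega> \<noteq> {} \<and> open \<Omega>
   \<and> closed F\<^sub>0 \<and> closed F\<^sub>1 \<and> F\<^sub>0 \<subseteq> closure \<Omega> \<and> F\<^sub>1 \<subseteq> closure \<Omega>"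

text \<open>
  Functions on \<open>closure \<Omega>\<close> are represented by total functions of which only the values on
  \<open>closure \<Omega>\<close> matter. The infimum of the empty set in \<^typ>\<open>ennreal\<close> is \<open>\<infinity>\<close>.
\<close>

definition capacity_admissible ::
    "(real ^ 'n) set \<Rightarrow> (real ^ 'n) set \<Rightarrow> (real ^ 'n) set \<Rightarrow> (real ^ 'n \<Rightarrow> real) set" where
  "capacity_admissible F\<^sub>0 F\<^sub>1 \<Omega> =
     {v. (\<exists>L. L-lipschitz_on (closure \<Omega>) v) \<and> (\<forall>x\<in>closure \<Omega>. 0 \<le> v x)
       \<and> (\<forall>x\<in>F\<^sub>0. v x = 0) \<and> (\<forall>x\<in>F\<^sub>1. v x = 1)}"

definition conformal_capacity ::
    "(real ^ 'n) set \<Rightarrow> (real ^ 'n) set \<Rightarrow> (real ^ 'n) set \<Rightarrow> ennreal" where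
  "conformal_capacity F\<^sub>0 F\<^sub>1 \<Omega> =
     (INF v \<in> capacity_admissible F\<^sub>0 F\<^sub>1 \<Omega>.
        \<integral>\<^sup>+x\<in>\<Omega>. ennreal (norm (gradient v x) ^ CARD('n)) \<partial>lebesgue)"

definition Q_quasiconformal ::
    "real \<Rightarrow> (real ^ 'n \<Rightarrow> real ^ 'n) \<Rightarrow> (real ^ 'n) set \<Rightarrow> (real ^ 'n) set \<Rightarrow> bool" where
  "Q_quasiconformal Q \<phi> \<Omega> \<Omega>' \<longleftrightarrow>
     1 \<le> Q \<and> is_domain \<Omega> \<and> is_domain \<Omega>' \<and> (\<exists>\<psi>. homeomorphism \<Omega> \<Omega>' \<phi> \<psi>)
   \<and> (\<forall>F\<^sub>0 F\<^sub>1. condenser F\<^sub>0 F\<^sub>1 \<Omega> \<and> F\<^sub>0 \<subseteq> \<Omega> \<and> F\<^sub>1 \<subseteq> \<Omega> \<and> condenser (\<phi> ` F\<^sub>0) (\<phi> ` F\<^sub>1) \<Omega>' \<longrightarrow>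
        ennreal (inverse Q) * conformal_capacity F\<^sub>0 F\<^sub>1 \<Omega>
          \<le> conformal_capacity (\<phi> ` F\<^sub>0) (\<phi> ` F\<^sub>1) \<Omega>'
      \<and> conformal_capacity (\<phi> ` F\<^sub>0) (\<phi> ` F\<^sub>1) \<Omega>'
          \<le> ennreal Q * conformal_capacity F\<^sub>0 F\<^sub>1 \<Omega>)"

definition quasiconformal ::
    "(real ^ 'n \<Rightarrow> real ^ 'n) \<Rightarrow> (real ^ 'n) set \<Rightarrow> (real ^ 'n) set \<Rightarrow> bool" where
  "quasiconformal \<phi> \<Omega> \<Omega>' \<longleftrightarrow> (\<exists>Q\<ge>1. Q_quasiconformal Q \<phi> \<Omega> \<Omega>')"

end

theory Submission
  imports Defs
begin

text \<open>
  Everything follows from one distortion estimate: for every \<open>\<kappa> > 0\<close> there is \<open>\<epsilon> > 0\<close> such that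
  \<open>\<bar>z - y\<bar> \<le> \<epsilon> d(y)\<close> implies \<open>\<bar>\<phi> z - \<phi> y\<bar> \<le> \<kappa> d'(\<phi> y)\<close>, where \<open>d\<close>, \<open>d'\<close> are the distances to the
  complements of the two domains. The ring between a tiny ball around \<open>y\<close> and a sphere of radius
  \<open>d(y) / 2\<close> has small capacity. If the image of the tiny ball were large compared with \<open>d'(\<phi> y)\<close>, the
  image ring would separate two large continua at bounded relative distance (the outer one is the
  complement of the image of a closed ball, which is connected and contains the complement of the
  image domain), so its capacity would be bounded below by the Loewner property of Euclidean space.

  Since the inverse map satisfies the same hypotheses, the estimate holds in both directions.
  Applied to the inverse, it puts a ball of radius comparable to \<open>d'\<close> into the image of a Whitney
  polyhedron; applied to \<open>\<phi>\<close> along a chain of boundedly many points of a segment (polyhedra are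
  convex), it bounds the diameter of the image by a multiple of \<open>d'\<close>.

  The gradient in the capacity is the pointwise one, so the Loewner bound needs Rademacher's
  theorem. Poincare-type inequalities then come from \<open>\<integral>\<^sub>B \<bar>w(x + v) - w(x)\<bar> \<le> \<bar>v\<bar> \<integral>\<^sub>B\<^sub>' \<bar>\<nabla>w\<bar>\<close>.
\<close>

section \<open>Almost everywhere differentiability of Lipschitz functions\<close>

text \<open>A test function for the image ring lives only on the closure of the image domain, whose
  boundary may be irregular, so the Loewner bound cannot be used inside that domain. Both plates
  therefore lie compactly inside it: the function vanishes on the image of the sphere, which
  contains the frontier of the image of the open ball, and extends by zero to all of space without
  new energy. Boundedness of the image domain supplies points of its complement arbitrarily far
  away, so the outer continuum is as large as required.

  The infimum in the capacity runs over functions without a common Lipschitz constant. Every bound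
  must depend on the energy alone; the Lipschitz constant may serve only for qualitative facts
  (differentiability, dominated convergence, convergence of averages). The exponent equal to the
  dimension makes the bounds invariant under scaling, which is why they can be expressed through
  distances to the two complements.\<close>

lemma vitali_cover_by_intervals:
  fixes S U :: "real set" and P :: "real \<Rightarrow> real \<Rightarrow> bool"
  assumes U: "open U" "S \<subseteq> U"
    and fine: "\<And>x d. x \<in> S \<Longrightarrow> 0 < d \<Longrightarrow>
      \<exists>h. h \<noteq> 0 \<and> \<bar>h\<bar> < d \<and> P (min x (x + h)) (max x (x + h))"
  obtains C where "countable C" "\<And>u v. (u, v) \<in> C \<Longrightarrow> u < v \<and> {u..v} \<subseteq> U \<and> P u v"
    "disjoint_family_on (\<lambda>(u, v). {u..v}) C" "negligible (S - (\<Union>(u, v)\<in>C. {u..v}))"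
proof -
  define K where "K = {(u, v). u < v \<and> {u..v} \<subseteq> U \<and> P u v}"
  define m where "m = (\<lambda>(u::real, v). (u + v) / 2)"
  define r where "r = (\<lambda>(u::real, v). (v - u) / 2)"
  \<comment> \<open>The covering theorem speaks of balls, and an interval is the closed ball about
    its midpoint. A difference quotient at \<open>x\<close> yields an interval with endpoint
    \<open>x\<close>; this suffices because \<open>x\<close> need only lie in the ball.\<close>
  have cb: "cball (m i) (r i) = (case i of (u, v) \<Rightarrow> {u..v})" for i
    by (auto simp: m_def r_def cball_eq_atLeastAtMost split: prod.split) (simp_all add: field_simps)
  have r_pos: "0 < r i" if "i \<in> K" for i
    using that by (auto simp: K_def r_def)
  have ex: "\<exists>i. i \<in> K \<and> x \<in> cball (m i) (r i) \<and> r i < d" if x: "x \<in> S" and d: "0 < d" for x d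
  proof -
    obtain e where e: "e > 0" "cball x e \<subseteq> U"
      using U x open_contains_cball by blast
    obtain h where h: "h \<noteq> 0" "\<bar>h\<bar> < min d e" "P (min x (x + h)) (max x (x + h))"
      using fine[OF x, of "min d e"] d e by auto
    have "{min x (x + h)..max x (x + h)} \<subseteq> cball x e"
      using h by (auto simp: cball_eq_atLeastAtMost)
    then have "(min x (x + h), max x (x + h)) \<in> K"
      using e h unfolding K_def by auto
    moreover have "x \<in> cball (m (min x (x + h), max x (x + h))) (r (min x (x + h), max x (x + h)))"
      unfolding cb by auto
    moreover have "r (min x (x + h), max x (x + h)) < d"
      using h d by (auto simp: r_def)
    ultimately show ?thesis by blast
  qed
  obtain C where C: "countable C" "C \<subseteq> K"
     "pairwise (\<lambda>i j. disjnt (cball (m i) (r i)) (cball (m j) (r j))) C"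
     "negligible (S - (\<Union>i \<in> C. cball (m i) (r i)))"
    by (rule Vitali_covering_theorem_cballs[of K r S m, OF r_pos ex]) auto
  show thesis
  proof
    show "countable C" by fact
    show "u < v \<and> {u..v} \<subseteq> U \<and> P u v" if "(u, v) \<in> C" for u v
      using that C(2) by (auto simp: K_def)
    show "disjoint_family_on (\<lambda>(u, v). {u..v}) C"
      using C(3) unfolding cb pairwise_def disjnt_def disjoint_family_on_def by blast
    show "negligible (S - (\<Union>(u, v)\<in>C. {u..v}))"
      using C(4) unfolding cb .
  qed
qed

text \<open>On disjoint intervals covering almost all of \<open>S\<close> the increment of
  \<open>f\<close> is at least \<open>b\<close> times the length. Monotonicity lets the Stieltjes
  measure \<open>interval_measure f\<close> add up these countably many increments.\<close>

lemma emeasure_le_increment_of_steep: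
  fixes f :: "real \<Rightarrow> real"
  assumes mono: "mono f" and cont: "continuous_on UNIV f" and pq: "p \<le> q" and b: "0 < b"
    and S: "S \<in> sets borel" "S \<subseteq> {p<..<q}"
    and steep: "\<And>x d. x \<in> S \<Longrightarrow> 0 < d \<Longrightarrow> \<exists>h. h \<noteq> 0 \<and> \<bar>h\<bar> < d \<and> b < (f (x + h) - f x) / h"
  shows "ennreal b * emeasure lborel S \<le> ennreal (f q - f p)"
proof -
  define P where "P = (\<lambda>u v. b * (v - u) \<le> f v - f u)"
  have "\<exists>h. h \<noteq> 0 \<and> \<bar>h\<bar> < d \<and> P (min x (x + h)) (max x (x + h))"
    if xd: "x \<in> S" "0 < d" for x d
  proof -
    obtain h where h: "h \<noteq> 0" "\<bar>h\<bar> < d" "b < (f (x + h) - f x) / h"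
      using steep[OF xd] by blast
    have "P (min x (x + h)) (max x (x + h))"
    proof (cases "h > 0")
      case True
      then show ?thesis using h by (simp add: P_def pos_less_divide_eq)
    next
      case False
      then have "h < 0" using h by simp
      then show ?thesis using h by (simp add: P_def neg_less_divide_eq)
    qed
    then show ?thesis using h by blast
  qed
  then obtain C where C: "countable C" "\<And>u v. (u, v) \<in> C \<Longrightarrow> u < v \<and> {u..v} \<subseteq> {p<..<q} \<and> P u v"
    "disjoint_family_on (\<lambda>(u, v). {u..v}) C" "negligible (S - (\<Union>(u, v)\<in>C. {u..v}))"
    by (rule vitali_cover_by_intervals[of "{p<..<q}" S P, OF open_greaterThanLessThan S(2)]) blast+
  let ?I = "\<lambda>i. case i of (u, v) \<Rightarrow> {u..v::real}"
  let ?J = "\<lambda>i. case i of (u, v) \<Rightarrow> {u<..v::real}"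
  have mf: "\<And>x y. x \<le> y \<Longrightarrow> f x \<le> f y" using mono by (auto dest: monoD)
  have rc: "\<And>a. continuous (at_right a) f"
    using cont by (simp add: continuous_on_eq_continuous_at continuous_at_imp_continuous_at_within)
  have uI: "(\<Union>i\<in>C. ?I i) \<in> sets borel"
    using C(1) by (intro sets.countable_UN'') (auto split: prod.split)
  have "emeasure lborel S \<le> emeasure lborel (\<Union>i\<in>C. ?I i)"
  proof (rule emeasure_mono_AE)
    have n: "S - (\<Union>i\<in>C. ?I i) \<in> null_sets lborel"
      using C(4) S uI unfolding negligible_iff_null_sets
      by (auto simp: null_sets_def split: prod.splits)
    show "AE x in lborel. x \<in> S \<longrightarrow> x \<in> (\<Union>i\<in>C. ?I i)"
      using AE_not_in[OF n] by eventually_elim auto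
    show "(\<Union>i\<in>C. ?I i) \<in> sets lborel" using uI by simp
  qed
  also have "\<dots> = (\<integral>\<^sup>+i. emeasure lborel (?I i) \<partial>count_space C)"
    using C by (intro emeasure_UN_countable) (auto split: prod.split)
  finally have "ennreal b * emeasure lborel S \<le> ennreal b * (\<integral>\<^sup>+i. emeasure lborel (?I i) \<partial>count_space C)"
    by (rule mult_left_mono) simp
  also have "\<dots> = (\<integral>\<^sup>+i. ennreal b * emeasure lborel (?I i) \<partial>count_space C)"
    by (simp add: nn_integral_cmult)
  also have "\<dots> \<le> (\<integral>\<^sup>+i. emeasure (interval_measure f) (?J i) \<partial>count_space C)"
  proof (rule nn_integral_mono)
    fix i assume "i \<in> space (count_space C)"
    then obtain u v where i: "i = (u, v)" "(u, v) \<in> C" by (cases i) auto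
    have *: "u < v" "P u v" using C(2)[OF i(2)] by auto
    show "ennreal b * emeasure lborel (?I i) \<le> emeasure (interval_measure f) (?J i)"
      using * b unfolding i P_def
      by (simp add: emeasure_interval_measure_Ioc[OF _ mf rc] ennreal_mult'[symmetric] ennreal_leI)
  qed
  also have "\<dots> = emeasure (interval_measure f) (\<Union>i\<in>C. ?J i)"
  proof (rule emeasure_UN_countable[symmetric])
    show "disjoint_family_on ?J C"
    proof (rule disjoint_family_on_bisimulation[OF C(3)])
    qed (fastforce split: prod.splits)
  qed (use C in \<open>auto split: prod.split\<close>)
  also have "\<dots> \<le> emeasure (interval_measure f) {p<..q}"
  proof (rule emeasure_mono)
    show "(\<Union>i\<in>C. ?J i) \<subseteq> {p<..q}"
    proof clarify
      fix u v x assume "(u, v) \<in> C" "x \<in> {u<..v}"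
      then have "x \<in> {u..v}" "{u..v} \<subseteq> {p<..<q}" using C(2) by auto
      then have "x \<in> {p<..<q}" by blast
      then show "x \<in> {p<..q}" by auto
    qed
  qed simp
  also have "\<dots> = ennreal (f q - f p)"
    by (rule emeasure_interval_measure_Ioc[OF pq mf rc])
  finally show ?thesis .
qed

text \<open>Flat intervals cover almost all of \<open>S\<close> inside an open \<open>U\<close>
  barely larger than \<open>S\<close>. The steep bound within each of them gives
  \<open>b |S| \<le> a |U|\<close>, incompatible with \<open>a < b\<close> unless \<open>S\<close>
  is null.\<close>

lemma null_set_of_oscillating_slopes:
  fixes f :: "real \<Rightarrow> real"
  assumes mono: "mono f" and cont: "continuous_on UNIV f" and ab: "0 < a" "a < b"
    and S: "S \<in> sets borel" "bounded S"
    and steep: "\<And>x d. x \<in> S \<Longrightarrow> 0 < d \<Longrightarrow> \<exists>h. h \<noteq> 0 \<and> \<bar>h\<bar> < d \<and> b < (f (x + h) - f x) / h"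
    and flat: "\<And>x d. x \<in> S \<Longrightarrow> 0 < d \<Longrightarrow> \<exists>h. h \<noteq> 0 \<and> \<bar>h\<bar> < d \<and> (f (x + h) - f x) / h < a"
  shows "S \<in> null_sets lborel"
proof -
  define P where "P = (\<lambda>u v. f v - f u \<le> a * (v - u))"
  have fine: "\<exists>h. h \<noteq> 0 \<and> \<bar>h\<bar> < d \<and> P (min x (x + h)) (max x (x + h))"
    if xd: "x \<in> S" "0 < d" for x d
  proof -
    obtain h where h: "h \<noteq> 0" "\<bar>h\<bar> < d" "(f (x + h) - f x) / h < a"
      using flat[OF xd] by blast
    have "P (min x (x + h)) (max x (x + h))"
    proof (cases "h > 0")
      case True
      then show ?thesis using h by (simp add: P_def pos_divide_less_eq)
    next
      case False
      then have "h < 0" using h by simp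
      then show ?thesis using h by (simp add: P_def neg_divide_less_eq)
    qed
    then show ?thesis using h by blast
  qed
  have finS: "emeasure lborel S < \<infinity>"
    using emeasure_bounded_finite[OF S(2)] by simp
  then obtain s where s: "emeasure lborel S = ennreal s" "0 \<le> s"
    by (cases "emeasure lborel S") auto
  have key: "b * s \<le> a * (s + e)" if e: "e > 0" for e
  proof -
    obtain U where U: "open U" "S \<subseteq> U" "(U - S) \<in> lmeasurable" "emeasure lebesgue (U - S) < ennreal e"
      using sets_lebesgue_outer_open[of S e] S e by auto
    obtain C where C: "countable C" "\<And>u v. (u, v) \<in> C \<Longrightarrow> u < v \<and> {u..v} \<subseteq> U \<and> P u v"
      "disjoint_family_on (\<lambda>(u, v). {u..v}) C" "negligible (S - (\<Union>(u, v)\<in>C. {u..v}))"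
      by (rule vitali_cover_by_intervals[of U S P, OF U(1,2) fine]) blast+
    let ?I = "\<lambda>i. case i of (u, v) \<Rightarrow> {u..v::real}"
    have uI: "(\<Union>i\<in>C. ?I i) \<in> sets borel"
      using C(1) by (intro sets.countable_UN'') (auto split: prod.split)
    have dS: "disjoint_family_on (\<lambda>i. S \<inter> ?I i) C"
      by (rule disjoint_family_on_bisimulation[OF C(3)]) (fastforce split: prod.splits)
    have "emeasure lborel S \<le> emeasure lborel (\<Union>i\<in>C. S \<inter> ?I i)"
    proof (rule emeasure_mono_AE)
      have n: "S - (\<Union>i\<in>C. ?I i) \<in> null_sets lborel"
        using C(4) S uI unfolding negligible_iff_null_sets
        by (auto simp: null_sets_def split: prod.splits)
      show "AE x in lborel. x \<in> S \<longrightarrow> x \<in> (\<Union>i\<in>C. S \<inter> ?I i)"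
        using AE_not_in[OF n] by eventually_elim auto
      show "(\<Union>i\<in>C. S \<inter> ?I i) \<in> sets lborel" using C(1) S
        by (auto intro!: sets.countable_UN'' sets.Int split: prod.split)
    qed
    also have "\<dots> = (\<integral>\<^sup>+i. emeasure lborel (S \<inter> ?I i) \<partial>count_space C)"
      using C dS S by (intro emeasure_UN_countable) (auto split: prod.split)
    finally have "ennreal b * emeasure lborel S \<le> ennreal b * (\<integral>\<^sup>+i. emeasure lborel (S \<inter> ?I i) \<partial>count_space C)"
      by (rule mult_left_mono) simp
    also have "\<dots> = (\<integral>\<^sup>+i. ennreal b * emeasure lborel (S \<inter> ?I i) \<partial>count_space C)"
      by (simp add: nn_integral_cmult)
    also have "\<dots> \<le> (\<integral>\<^sup>+i. ennreal a * emeasure lborel (?I i) \<partial>count_space C)"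
    proof (rule nn_integral_mono)
      fix i assume "i \<in> space (count_space C)"
      then obtain u v where i: "i = (u, v)" "(u, v) \<in> C" by (cases i) auto
      have *: "u < v" "P u v" using C(2)[OF i(2)] by auto
      \<comment> \<open>The steep bound wants its set inside an open interval, where the covering
        intervals can stay; the endpoints given up are null.\<close>
      have n2: "S \<inter> {u..v} - {u<..<v} \<in> null_sets lborel"
      proof (rule null_sets_subset)
        show "{u, v} \<in> null_sets lborel" by (simp add: finite_imp_null_set_lborel)
      qed (use S in auto)
      have "emeasure lborel (S \<inter> {u..v}) \<le> emeasure lborel (S \<inter> {u<..<v})"
      proof (rule emeasure_mono_AE)
        show "AE x in lborel. x \<in> S \<inter> {u..v} \<longrightarrow> x \<in> S \<inter> {u<..<v}"
          using AE_not_in[OF n2] by eventually_elim auto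
      qed (use S in auto)
      then have "ennreal b * emeasure lborel (S \<inter> {u..v}) \<le> ennreal b * emeasure lborel (S \<inter> {u<..<v})"
        by (rule mult_left_mono) simp
      also have "\<dots> \<le> ennreal (f v - f u)"
        using ab * S steep
        by (intro emeasure_le_increment_of_steep[OF mono cont]) auto
      also have "\<dots> \<le> ennreal (a * (v - u))"
        using * by (intro ennreal_leI) (simp add: P_def)
      also have "\<dots> = ennreal a * emeasure lborel {u..v}"
        using * ab by (simp add: ennreal_mult')
      finally show "ennreal b * emeasure lborel (S \<inter> ?I i) \<le> ennreal a * emeasure lborel (?I i)"
        unfolding i by simp
    qed
    also have "\<dots> = ennreal a * emeasure lborel (\<Union>i\<in>C. ?I i)"
      using C by (subst emeasure_UN_countable) (auto simp: nn_integral_cmult split: prod.split)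
    also have "\<dots> \<le> ennreal a * emeasure lborel U"
      using C(2) U(1) by (intro mult_left_mono emeasure_mono) auto
    also have "emeasure lborel U = emeasure lborel S + emeasure lborel (U - S)"
      using U S by (subst plus_emeasure) (auto simp: Un_absorb1)
    also have "\<dots> \<le> ennreal s + ennreal e"
      using U S s by (intro add_mono) (auto simp: less_imp_le)
    finally have "ennreal b * ennreal s \<le> ennreal a * (ennreal s + ennreal e)"
      using s mult_left_mono by force
    then show ?thesis
      using ab s e
      by (simp add: ennreal_mult'[symmetric] ennreal_plus[symmetric] del: ennreal_plus)
  qed
  have "s = 0"
  proof (rule ccontr)
    assume "s \<noteq> 0"
    then have s0: "s > 0" using s by simp
    \<comment> \<open>This choice of \<open>e\<close> turns the right-hand side into the midpoint of
      \<open>a * s\<close> and \<open>b * s\<close>.\<close>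
    have "b * s \<le> a * (s + (b - a) * s / (2 * a))"
      using key[of "(b - a) * s / (2 * a)"] s0 ab by simp
    also have "\<dots> = a * s + (b - a) * s / 2" using ab by (simp add: field_simps)
    finally have "b * s \<le> a * s + (b - a) * s / 2" .
    moreover have "(b - a) * s = b * s - a * s" by (simp add: algebra_simps)
    moreover have "a * s < b * s" using s0 ab by simp
    ultimately show False by linarith
  qed
  then show ?thesis using s S by (auto simp: null_sets_def)
qed

text \<open>Steps are restricted to rationals so that the set is Borel.\<close>

definition oscillating :: "real \<Rightarrow> real \<Rightarrow> ('a::real_vector \<Rightarrow> real) \<Rightarrow> 'a \<Rightarrow> 'a set" where
  "oscillating a b w e = {x. \<forall>k::nat.
     (\<exists>q\<in>\<rat>. q \<noteq> 0 \<and> \<bar>q\<bar> < 1 / real (Suc k) \<and> (w (x + q *\<^sub>R e) - w x) / q < a) \<and>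
     (\<exists>q\<in>\<rat>. q \<noteq> 0 \<and> \<bar>q\<bar> < 1 / real (Suc k) \<and> b < (w (x + q *\<^sub>R e) - w x) / q)}"

lemma oscillating_borel:
  fixes w :: "'a::euclidean_space \<Rightarrow> real"
  assumes "continuous_on UNIV w"
  shows "oscillating a b w e \<in> sets borel"
proof -
  define Q where "Q = (\<lambda>k::nat. {q\<in>\<rat>. q \<noteq> 0 \<and> \<bar>q\<bar> < 1 / real (Suc k)})"
  have eq: "oscillating a b w e = (\<Inter>k. (\<Union>q\<in>Q k. {x. (w (x + q *\<^sub>R e) - w x) / q < a}) \<inter>
      (\<Union>q\<in>Q k. {x. b < (w (x + q *\<^sub>R e) - w x) / q}))"
    unfolding oscillating_def Q_def by auto
  have cQ: "countable (Q k)" for k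
    unfolding Q_def by (rule countable_subset[OF _ countable_rat]) auto
  have c: "continuous_on UNIV (\<lambda>x. (w (x + q *\<^sub>R e) - w x) / q)" if "q \<in> Q k" for q k
    using that unfolding Q_def
    by (intro continuous_intros continuous_on_compose2[OF assms] assms) auto
  have o1: "{x. (w (x + q *\<^sub>R e) - w x) / q < a} \<in> sets borel" if "q \<in> Q k" for q k
    using open_Collect_less[OF c[OF that] continuous_on_const] by simp
  have o2: "{x. b < (w (x + q *\<^sub>R e) - w x) / q} \<in> sets borel" if "q \<in> Q k" for q k
    using open_Collect_less[OF continuous_on_const c[OF that]] by simp
  show ?thesis
    unfolding eq by (intro sets.countable_INT'' sets.Int sets.countable_UN' cQ) (auto intro: o1 o2)
qed

lemma oscillating_real_null:
  fixes u :: "real \<Rightarrow> real"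
  assumes L: "L-lipschitz_on UNIV u" and ab: "a < b"
  shows "oscillating a b u 1 \<in> null_sets lborel"
proof -
  have cu: "continuous_on UNIV u" using lipschitz_on_continuous_on[OF L] .
  \<comment> \<open>Adding \<open>c * t\<close> shifts all slopes by \<open>c\<close>: the summand
    \<open>L\<close> makes \<open>f\<close> monotone, the rest makes the lower slope
    \<open>a + c\<close> positive.\<close>
  define c where "c = L + \<bar>a\<bar> + 1"
  define f where "f = (\<lambda>t. u t + c * t)"
  have "mono f"
  proof (rule monoI)
    fix x y :: real assume "x \<le> y"
    have "\<bar>u x - u y\<bar> \<le> L * (y - x)"
      using lipschitz_onD[OF L, of x y] \<open>x \<le> y\<close> by (simp add: dist_real_def)
    then have "u x - u y \<le> L * (y - x)" by linarith
    also have "\<dots> \<le> c * (y - x)"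
      using \<open>x \<le> y\<close> unfolding c_def by (intro mult_right_mono) auto
    finally show "f x \<le> f y" by (simp add: f_def algebra_simps)
  qed
  have cf: "continuous_on UNIV f" unfolding f_def by (intro continuous_intros cu)
  have q: "(f (x + h) - f x) / h = (u (x + h) - u x) / h + c" if "h \<noteq> 0" for x h
    using that unfolding f_def by (simp add: field_simps)
  have L0: "L \<ge> 0" using lipschitz_on_nonneg[OF L] .
  have n: "oscillating a b u 1 \<inter> {- real m..real m} \<in> null_sets lborel" for m
  proof (rule null_set_of_oscillating_slopes[OF \<open>mono f\<close> cf, of "a + c" "b + c"])
    show "0 < a + c" using L0 by (simp add: c_def abs_if)
    show "a + c < b + c" using ab by simp
    show "oscillating a b u 1 \<inter> {- real m..real m} \<in> sets borel"
      using oscillating_borel[OF cu] by auto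
    show "bounded (oscillating a b u 1 \<inter> {- real m..real m})"
      by (rule bounded_subset[OF bounded_closed_interval]) auto
  next
    fix x d :: real assume x: "x \<in> oscillating a b u 1 \<inter> {- real m..real m}" and "0 < d"
    obtain k where "1 / real (Suc k) < d" using nat_approx_posE[OF \<open>0 < d\<close>] by blast
    moreover obtain q1 where "q1 \<noteq> 0" "\<bar>q1\<bar> < 1 / real (Suc k)" "b < (u (x + q1) - u x) / q1"
      using x unfolding oscillating_def by auto
    moreover obtain q2 where "q2 \<noteq> 0" "\<bar>q2\<bar> < 1 / real (Suc k)" "(u (x + q2) - u x) / q2 < a"
      using x unfolding oscillating_def by auto
    ultimately show "\<exists>h. h \<noteq> 0 \<and> \<bar>h\<bar> < d \<and> b + c < (f (x + h) - f x) / h"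
      and "\<exists>h. h \<noteq> 0 \<and> \<bar>h\<bar> < d \<and> (f (x + h) - f x) / h < a + c"
      using q by (metis add_less_cancel_right less_trans)+
  qed
  have "oscillating a b u 1 = (\<Union>m. oscillating a b u 1 \<inter> {- real m..real m})"
  proof
    show "oscillating a b u 1 \<subseteq> (\<Union>m. oscillating a b u 1 \<inter> {- real m..real m})"
    proof
      fix x assume x: "x \<in> oscillating a b u 1"
      obtain m where "\<bar>x\<bar> \<le> real m" using real_arch_simple by blast
      then have "x \<in> oscillating a b u 1 \<inter> {- real m..real m}" using x by auto
      then show "x \<in> (\<Union>m. oscillating a b u 1 \<inter> {- real m..real m})" by blast
    qed
  qed blast
  then show ?thesis using null_sets_UN[of "\<lambda>m. oscillating a b u 1 \<inter> {- real m..real m}", OF n]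
    by (simp only:)
qed

text \<open>Averaging over translates by \<open>t *\<^sub>R e\<close>, \<open>t \<in> [0, 1]\<close>, replaces Fubini in coordinates adapted to \<open>e\<close>.\<close>

lemma null_set_of_null_lines:
  fixes T :: "'a::euclidean_space set"
  assumes T: "T \<in> sets borel" and null: "\<And>x. {t. x + t *\<^sub>R e \<in> T} \<in> null_sets lborel"
  shows "T \<in> null_sets lborel"
proof -
  have [measurable]: "T \<in> sets borel" by fact
  have m: "(\<lambda>(x, t). indicator T (x + t *\<^sub>R e) * indicator {0..1::real} t :: ennreal)
      \<in> borel_measurable (lborel \<Otimes>\<^sub>M lborel)"
    by measurable
  have tr: "(\<integral>\<^sup>+x. indicator T (x + t *\<^sub>R e) \<partial>lborel) = emeasure lborel T" for t
  proof -
    have "(\<integral>\<^sup>+x. indicator T (x + t *\<^sub>R e) \<partial>lborel) = (\<integral>\<^sup>+x. indicator T x \<partial>distr lborel borel ((+) (t *\<^sub>R e)))"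
      by (subst nn_integral_distr) (auto simp: add.commute)
    then show ?thesis unfolding lborel_distr_plus using T by simp
  qed
  have "emeasure lborel T = (\<integral>\<^sup>+t. emeasure lborel T * indicator {0..1::real} t \<partial>lborel)"
    by (subst nn_integral_cmult) auto
  also have "\<dots> = (\<integral>\<^sup>+t. (\<integral>\<^sup>+x. indicator T (x + t *\<^sub>R e) * indicator {0..1::real} t \<partial>lborel) \<partial>lborel)"
    by (intro nn_integral_cong) (simp add: nn_integral_multc tr)
  also have "\<dots> = (\<integral>\<^sup>+x. (\<integral>\<^sup>+t. indicator T (x + t *\<^sub>R e) * indicator {0..1::real} t \<partial>lborel) \<partial>lborel)"
    using lborel_pair.Fubini'[OF m] by simp
  also have "\<dots> = (\<integral>\<^sup>+x. 0 \<partial>(lborel :: 'a measure))"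
  proof (intro nn_integral_cong)
    fix x :: 'a
    have "AE t in lborel. indicator T (x + t *\<^sub>R e) * indicator {0..1::real} t = (0::ennreal)"
      using AE_not_in[OF null[of x]] by eventually_elim (auto simp: indicator_def)
    then show "(\<integral>\<^sup>+t. indicator T (x + t *\<^sub>R e) * indicator {0..1::real} t \<partial>lborel) = (0::ennreal)"
      by (subst nn_integral_0_iff_AE) auto
  qed
  finally show ?thesis using T by (auto simp: null_sets_def)
qed

lemma oscillating_null:
  fixes w :: "'a::euclidean_space \<Rightarrow> real"
  assumes L: "L-lipschitz_on UNIV w" and ab: "a < b"
  shows "oscillating a b w e \<in> null_sets lborel"
proof (rule null_set_of_null_lines[where e = e])
  show "oscillating a b w e \<in> sets borel"
    using oscillating_borel lipschitz_on_continuous_on[OF L] by blast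
  fix x
  have "(L * norm e)-lipschitz_on UNIV (\<lambda>t. w (x + t *\<^sub>R e))"
  proof (rule lipschitz_onI)
    fix s t :: real
    have "dist (w (x + s *\<^sub>R e)) (w (x + t *\<^sub>R e)) \<le> L * dist (x + s *\<^sub>R e) (x + t *\<^sub>R e)"
      by (rule lipschitz_onD[OF L]) auto
    also have "dist (x + s *\<^sub>R e) (x + t *\<^sub>R e) = dist s t * norm e"
      by (simp add: dist_norm scaleR_left_diff_distrib[symmetric])
    finally show "dist (w (x + s *\<^sub>R e)) (w (x + t *\<^sub>R e)) \<le> L * norm e * dist s t"
      by (simp add: ac_simps)
  qed (use lipschitz_on_nonneg[OF L] in simp)
  from oscillating_real_null[OF this ab]
  have "oscillating a b (\<lambda>t. w (x + t *\<^sub>R e)) 1 \<in> null_sets lborel" .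
  also have "oscillating a b (\<lambda>t. w (x + t *\<^sub>R e)) 1 = {t. x + t *\<^sub>R e \<in> oscillating a b w e}"
    unfolding oscillating_def by (simp add: scaleR_left_distrib add.assoc)
  finally show "{t. x + t *\<^sub>R e \<in> oscillating a b w e} \<in> null_sets lborel" .
qed

text \<open>If the lower and upper limits of the quotient differed, two rationals strictly between
  them would put \<open>x\<close> into an excluded set. The Lipschitz bound then makes the common
  extended real limit finite.\<close>

lemma difference_quotient_tendsto:
  fixes w :: "'a::euclidean_space \<Rightarrow> real"
  assumes L: "L-lipschitz_on UNIV w"
    and x: "\<And>a b. a \<in> \<rat> \<Longrightarrow> b \<in> \<rat> \<Longrightarrow> a < b \<Longrightarrow> x \<notin> oscillating a b w e"
  shows "\<exists>l. ((\<lambda>t. (w (x + t *\<^sub>R e) - w x) / t) \<longlongrightarrow> l) (at 0)"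
proof -
  define Q where "Q = (\<lambda>t. (w (x + t *\<^sub>R e) - w x) / t)"
  have cw: "continuous_on UNIV w" using lipschitz_on_continuous_on[OF L] .
  have bdd: "\<bar>Q t\<bar> \<le> L * norm e" for t
  proof (cases "t = 0")
    case True
    then show ?thesis using lipschitz_on_nonneg[OF L] by (simp add: Q_def)
  next
    case False
    have "\<bar>w (x + t *\<^sub>R e) - w x\<bar> \<le> L * (\<bar>t\<bar> * norm e)"
      using lipschitz_onD[OF L, of "x + t *\<^sub>R e" x] by (simp add: dist_norm)
    then show ?thesis using False unfolding Q_def by (simp add: field_simps)
  qed
  have cQ: "isCont Q t" if "t \<noteq> 0" for t
    unfolding Q_def using that
    by (intro continuous_intros continuous_within_compose3[OF continuous_on_interior[OF cw]]) auto
  \<comment> \<open>The quotient is continuous in \<open>t\<close> away from 0, so a real step with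
    value in the open set \<open>G\<close> can be replaced by a nearby rational one.\<close>
  have approx: "\<forall>k::nat. \<exists>q\<in>\<rat>. q \<noteq> 0 \<and> \<bar>q\<bar> < 1 / real (Suc k) \<and> Q q \<in> G"
    if f: "\<exists>\<^sub>F t in at 0. Q t \<in> G" and G: "open G" for G
  proof
    fix k :: nat
    obtain t where t: "t \<noteq> 0" "\<bar>t\<bar> < 1 / real (Suc k)" "Q t \<in> G"
      using f[unfolded frequently_at, rule_format, of "1 / real (Suc k)"] by (auto simp: dist_real_def)
    have "\<forall>\<^sub>F s in nhds t. Q s \<in> G \<and> s \<noteq> 0 \<and> \<bar>s\<bar> < 1 / real (Suc k)"
    proof (intro eventually_conj)
      show "\<forall>\<^sub>F s in nhds t. Q s \<in> G"
        using topological_tendstoD[OF cQ[OF t(1), unfolded isCont_def] G t(3)] t(3)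
        by (auto simp: eventually_nhds_conv_at)
      show "\<forall>\<^sub>F s in nhds t. s \<noteq> 0" using t(1) by (rule t1_space_nhds)
      show "\<forall>\<^sub>F s in nhds t. \<bar>s\<bar> < 1 / real (Suc k)"
        by (rule order_tendstoD(2)[OF tendsto_rabs[OF filterlim_ident] t(2)])
    qed
    then obtain d where d: "d > 0" "\<And>s. dist s t < d \<Longrightarrow> Q s \<in> G \<and> s \<noteq> 0 \<and> \<bar>s\<bar> < 1 / real (Suc k)"
      unfolding eventually_nhds_metric by blast
    obtain q where q: "q \<in> \<rat>" "t < q" "q < t + d"
      using Rats_dense_in_real[of t "t + d"] d(1) by auto
    show "\<exists>q\<in>\<rat>. q \<noteq> 0 \<and> \<bar>q\<bar> < 1 / real (Suc k) \<and> Q q \<in> G"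
      using d(2)[of q] q by (auto simp: dist_real_def)
  qed
  define l where "l = Liminf (at 0) (\<lambda>t. ereal (Q t))"
  define u where "u = Limsup (at 0) (\<lambda>t. ereal (Q t))"
  have lu: "l \<le> u" unfolding l_def u_def by (rule Liminf_le_Limsup) simp
  have "\<not> l < u"
  proof
    assume "l < u"
    then obtain a where a: "l < ereal (real_of_rat a)" "ereal (real_of_rat a) < u"
      using ereal_dense3 by blast
    then obtain b where b: "ereal (real_of_rat a) < ereal (real_of_rat b)" "ereal (real_of_rat b) < u"
      using ereal_dense3 by blast
    have "\<exists>\<^sub>F t in at 0. Q t \<in> {..<real_of_rat a}"
    proof (rule ccontr)
      assume "\<not> ?thesis"
      then have "\<forall>\<^sub>F t in at 0. ereal (real_of_rat a) \<le> ereal (Q t)"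
        by (simp add: not_frequently not_less)
      from Liminf_bounded[OF this] show False using a unfolding l_def by simp
    qed
    from approx[OF this] have 1: "\<forall>k::nat. \<exists>q\<in>\<rat>. q \<noteq> 0 \<and> \<bar>q\<bar> < 1 / real (Suc k) \<and> Q q < real_of_rat a"
      by simp
    have "\<exists>\<^sub>F t in at 0. Q t \<in> {real_of_rat b<..}"
    proof (rule ccontr)
      assume "\<not> ?thesis"
      then have "\<forall>\<^sub>F t in at 0. ereal (Q t) \<le> ereal (real_of_rat b)"
        by (simp add: not_frequently not_less)
      from Limsup_bounded[OF this] show False using b unfolding u_def by simp
    qed
    from approx[OF this] have 2: "\<forall>k::nat. \<exists>q\<in>\<rat>. q \<noteq> 0 \<and> \<bar>q\<bar> < 1 / real (Suc k) \<and> real_of_rat b < Q q"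
      by simp
    have "x \<in> oscillating (real_of_rat a) (real_of_rat b) w e"
      using 1 2 unfolding oscillating_def Q_def by auto
    then show False using x[of "real_of_rat a" "real_of_rat b"] b by simp
  qed
  then have "l = u" using lu by simp
  then have lim: "((\<lambda>t. ereal (Q t)) \<longlongrightarrow> l) (at 0)"
    unfolding l_def u_def by (subst tendsto_iff_Liminf_eq_Limsup) auto
  have "l \<le> ereal (L * norm e)" "ereal (- (L * norm e)) \<le> l"
    using bdd tendsto_upperbound[OF lim, of "ereal (L * norm e)"]
      tendsto_lowerbound[OF lim, of "ereal (- (L * norm e))"]
    by (auto simp: abs_le_iff minus_le_iff)
  then obtain l' where "l = ereal l'" by (cases l) auto
  with lim show ?thesis unfolding Q_def[symmetric] by auto
qed

lemma AE_difference_quotient_tendsto: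
  fixes w :: "'a::euclidean_space \<Rightarrow> real"
  assumes L: "L-lipschitz_on UNIV w"
  shows "AE x in lborel. \<exists>l. ((\<lambda>t. (w (x + t *\<^sub>R e) - w x) / t) \<longlongrightarrow> l) (at 0)"
proof -
  define P where "P = {(a, b). a \<in> \<rat> \<and> b \<in> \<rat> \<and> a < (b::real)}"
  have "countable P"
    by (rule countable_subset[OF _ countable_SIGMA[OF countable_rat countable_rat]]) (auto simp: P_def)
  then have "AE x in lborel. \<forall>i\<in>P. x \<notin> oscillating (fst i) (snd i) w e"
    by (subst AE_ball_countable) (auto simp: P_def intro!: AE_not_in oscillating_null[OF L])
  then show ?thesis
    by eventually_elim (rule difference_quotient_tendsto[OF L], auto simp: P_def)
qed

text \<open>After shifting and scaling, \<open>(H + c) / c\<close> is a nonnegative density. Its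
  measure agrees with Lebesgue measure on boxes, hence everywhere, and uniqueness of densities
  forces it to be 1 almost everywhere.\<close>

lemma AE_zero_if_box_integrals_zero:
  fixes H :: "'a::euclidean_space \<Rightarrow> real"
  assumes [measurable]: "H \<in> borel_measurable borel" and bound: "\<And>x. \<bar>H x\<bar> \<le> K"
    and zero: "\<And>l u. (\<integral>x. indicator (box l u) x * H x \<partial>lborel) = 0"
  shows "AE x in lborel. H x = 0"
proof -
  define c where "c = K + 1"
  have c: "c > 0" "\<And>x. \<bar>H x\<bar> \<le> c"
    using bound by (auto simp: c_def intro: order_trans[OF abs_ge_zero bound, THEN order.strict_trans1])
      (metis add_increasing2 zero_le_one)
  define F where "F = (\<lambda>x. (H x + c) / c)"
  have F0: "F x \<ge> 0" for x using c(2)[of x] c(1) unfolding F_def by (simp add: abs_le_iff)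
  have Fm[measurable]: "F \<in> borel_measurable borel" unfolding F_def by measurable
  have "lborel = density lborel (\<lambda>x. ennreal (F x))"
  proof (rule lborel_eqI)
    fix l u :: 'a assume lu: "\<And>b. b \<in> Basis \<Longrightarrow> l \<bullet> b \<le> u \<bullet> b"
    have iB: "integrable lborel (\<lambda>x. indicator (box l u) x :: real)"
      by (rule integrable_real_indicator[OF _ emeasure_lborel_box_finite]) simp
    have iH: "integrable lborel (\<lambda>x. indicator (box l u) x * H x)"
      by (rule Bochner_Integration.integrable_bound[OF integrable_mult_right[OF iB, of K]])
        (auto simp: indicator_def intro!: AE_I2 order_trans[OF bound])
    have iF: "(\<lambda>x. indicator (box l u) x * F x) = (\<lambda>x. (1 / c) * (indicator (box l u) x * H x) + indicator (box l u) x)"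
      using c(1) by (auto simp: F_def field_simps)
    have "emeasure (density lborel (\<lambda>x. ennreal (F x))) (box l u) = (\<integral>\<^sup>+x. ennreal (indicator (box l u) x * F x) \<partial>lborel)"
      by (subst emeasure_density) (auto intro!: nn_integral_cong simp: indicator_def)
    also have "\<dots> = ennreal (\<integral>x. indicator (box l u) x * F x \<partial>lborel)"
    proof (rule nn_integral_eq_integral)
      show "integrable lborel (\<lambda>x. indicator (box l u) x * F x)"
        unfolding iF by (intro Bochner_Integration.integrable_add integrable_mult_right iB iH)
    qed (auto intro!: AE_I2 mult_nonneg_nonneg F0)
    also have "(\<integral>x. indicator (box l u) x * F x \<partial>lborel) = measure lborel (box l u)"
      unfolding iF using iB iH zero by simp
    also have "ennreal \<dots> = (\<Prod>b\<in>Basis. (u - l) \<bullet> b)"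
      using lu by (simp add: measure_lborel_box)
    finally show "emeasure (density lborel (\<lambda>x. ennreal (F x))) (box l u) = (\<Prod>b\<in>Basis. (u - l) \<bullet> b)" .
  qed simp
  then have "density lborel (\<lambda>x. ennreal (F x)) = density lborel (\<lambda>x. 1)"
    by (simp add: density_1)
  then have "AE x in lborel. ennreal (F x) = 1"
    by (subst (asm) sigma_finite_measure.density_unique_iff[OF lborel.sigma_finite_measure_axioms]) auto
  then show ?thesis
    using c(1) by (auto simp: F_def elim!: eventually_mono)
qed

section \<open>Directional derivatives and their linearity\<close>

definition directional :: "('a::euclidean_space \<Rightarrow> real) \<Rightarrow> 'a \<Rightarrow> 'a \<Rightarrow> real" where
  "directional w e x = lim (\<lambda>k. real (Suc k) * (w (x + (1 / real (Suc k)) *\<^sub>R e) - w x))"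

definition has_directional :: "('a::euclidean_space \<Rightarrow> real) \<Rightarrow> 'a \<Rightarrow> 'a \<Rightarrow> real \<Rightarrow> bool" where
  "has_directional w e x l \<longleftrightarrow> ((\<lambda>t. (w (x + t *\<^sub>R e) - w x) / t) \<longlongrightarrow> l) (at 0)"

lemma inverse_Suc_at_0: "filterlim (\<lambda>k. 1 / real (Suc k)) (at 0) sequentially"
  unfolding filterlim_at using LIMSEQ_inverse_real_of_nat by (auto simp: inverse_eq_divide)

lemma has_directional_sequence:
  assumes "has_directional w e x l"
  shows "(\<lambda>k. real (Suc k) * (w (x + (1 / real (Suc k)) *\<^sub>R e) - w x)) \<longlonglongrightarrow> l"
  using filterlim_compose[OF assms[unfolded has_directional_def] inverse_Suc_at_0] by (simp add: mult.commute)

lemma has_directional_directional: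
  assumes "has_directional w e x l"
  shows "directional w e x = l"
  unfolding directional_def by (rule limI[OF has_directional_sequence[OF assms]])

lemma has_directional_scale:
  assumes "has_directional w e x l"
  shows "has_directional w (c *\<^sub>R e) x (c * l)"
proof (cases "c = 0")
  case True then show ?thesis by (simp add: has_directional_def)
next
  case False
  have "filterlim (\<lambda>t. t * c) (at 0) (at (0::real))"
    unfolding filterlim_at using False
    by (auto simp: eventually_at_filter intro!: tendsto_eq_intros)
  from filterlim_compose[OF assms[unfolded has_directional_def] this]
  have "((\<lambda>t. c * ((w (x + (t * c) *\<^sub>R e) - w x) / (t * c))) \<longlongrightarrow> c * l) (at 0)"
    by (rule tendsto_mult_left)
  then show ?thesis using False by (simp add: has_directional_def mult.commute[of c])
qed

lemma AE_has_directional: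
  assumes "L-lipschitz_on UNIV w"
  shows "AE x in lborel. has_directional w e x (directional w e x)"
  using AE_difference_quotient_tendsto[OF assms, of e]
proof eventually_elim
  case (elim x)
  then obtain l where "has_directional w e x l" by (auto simp: has_directional_def)
  then show ?case using has_directional_directional by metis
qed

text \<open>The limit in \<open>directional\<close> runs along the fixed steps
  \<open>1 / Suc k\<close> for this purpose: the function is Borel on the whole space, whatever
  happens where the derivative fails to exist.\<close>

lemma directional_borel:
  assumes "continuous_on UNIV w"
  shows "directional w e \<in> borel_measurable borel"
proof -
  have [measurable]: "w \<in> borel_measurable borel"
    using assms by (rule borel_measurable_continuous_onI)
  show ?thesis unfolding directional_def[abs_def] by (intro borel_measurable_lim_metric) measurable
qed

lemma integral_translate:
  fixes f :: "'a::euclidean_space \<Rightarrow> real"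
  assumes [measurable]: "f \<in> borel_measurable borel"
  shows "(\<integral>x. f (x + v) \<partial>lborel) = (\<integral>x. f x \<partial>lborel)"
proof -
  have "(\<integral>x. f x \<partial>lborel) = (\<integral>x. f x \<partial>distr lborel borel ((+) v))"
    unfolding lborel_distr_plus ..
  also have "\<dots> = (\<integral>x. f (x + v) \<partial>lborel)"
    by (subst integral_distr) (auto simp: add.commute)
  finally show ?thesis ..
qed

text \<open>Off the frontier of the box, a null set, the indicator is locally constant, so the
  integrand is eventually 0; a ball containing all the translates dominates.\<close>

lemma indicator_translate_tendsto:
  fixes l u :: "'a::euclidean_space"
  assumes v: "v \<longlonglongrightarrow> 0"
  shows "(\<lambda>k. \<integral>x. \<bar>indicator (box l u) (x - v k) - indicator (box l u) x :: real\<bar> \<partial>lborel) \<longlonglongrightarrow> 0"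
proof -
  obtain K where K: "\<And>k. norm (v k) \<le> K" "K > 0"
    using Bseq_def convergent_imp_Bseq[OF convergentI[OF v]] by metis
  obtain R where R: "\<And>x. x \<in> box l u \<Longrightarrow> norm x \<le> R"
    using bounded_box bounded_iff by metis
  let ?g = "\<lambda>x::'a. indicator (cball 0 (R + K)) x :: real"
  have "(\<lambda>k. \<integral>x. \<bar>indicator (box l u) (x - v k) - indicator (box l u) x :: real\<bar> \<partial>lborel) \<longlonglongrightarrow> (\<integral>x. (0::real) \<partial>(lborel :: 'a measure))"
  proof (rule integral_dominated_convergence)
    show "integrable lborel ?g" by (intro integrable_real_indicator emeasure_bounded_finite) auto
    show "AE x in lborel. norm \<bar>indicator (box l u) (x - v k) - indicator (box l u) x :: real\<bar> \<le> ?g x" for k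
    proof (rule AE_I2)
      fix x
      have "norm x \<le> R + K" if "x - v k \<in> box l u"
        using R[OF that] K(1)[of k] norm_triangle_sub[of x "v k"] by linarith
      moreover have "norm x \<le> R + K" if "x \<in> box l u" using R[OF that] K(2) by linarith
      ultimately show "norm \<bar>indicator (box l u) (x - v k) - indicator (box l u) x :: real\<bar> \<le> ?g x"
        by (auto simp: indicator_def)
    qed
    have "frontier (box l u) \<in> null_sets lborel"
      using negligible_convex_frontier[OF convex_box(2), of l u]
      by (simp add: negligible_iff_null_sets null_sets_def)
    from AE_not_in[OF this]
    show "AE x in lborel. (\<lambda>k. \<bar>indicator (box l u) (x - v k) - indicator (box l u) x :: real\<bar>) \<longlonglongrightarrow> 0"
    proof eventually_elim
      case (elim x)
      have lim: "(\<lambda>k. x - v k) \<longlonglongrightarrow> x" using tendsto_diff[OF tendsto_const v, of x] by simp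
      have "\<forall>\<^sub>F k in sequentially. (x - v k \<in> box l u) = (x \<in> box l u)"
      proof (cases "x \<in> box l u")
        case True
        then show ?thesis using topological_tendstoD[OF lim open_box True] by simp
      next
        case False
        then have "x \<in> - closure (box l u)" using elim unfolding frontier_def
          by (simp add: interior_open open_box)
        from topological_tendstoD[OF lim _ this]
        have "\<forall>\<^sub>F k in sequentially. x - v k \<in> - closure (box l u)" by blast
        then show ?thesis
          by eventually_elim (use False closure_subset[of "box l u"] in auto)
      qed
      then show ?case
        by (intro tendsto_eventually) (auto elim!: eventually_mono simp: indicator_def)
    qed
  qed measurable
  then show ?thesis by simp
qed

text \<open>
  The difference quotients in direction \<open>e + e'\<close> minus those in the directions \<open>e\<close> and \<open>e'\<close> are a quotient
  in direction \<open>e'\<close> taken at \<open>x + s e\<close> minus the same quotient at \<open>x\<close>, so their integrals over a box tend to 0.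
\<close>

lemma AE_directional_add:
  fixes w :: "'a::euclidean_space \<Rightarrow> real"
  assumes L: "L-lipschitz_on UNIV w"
  shows "AE x in lborel. directional w (e + e') x = directional w e x + directional w e' x"
proof -
  have cw: "continuous_on UNIV w" using lipschitz_on_continuous_on[OF L] .
  have wm[measurable]: "w \<in> borel_measurable borel"
    using cw by (rule borel_measurable_continuous_onI)
  have L0: "L \<ge> 0" using lipschitz_on_nonneg[OF L] .
  have lip: "\<bar>w (x + v) - w x\<bar> \<le> L * norm v" for x v
    using lipschitz_onD[OF L, of "x + v" x] by (simp add: dist_norm)
  define s where "s = (\<lambda>k::nat. 1 / real (Suc k))"
  have s0: "s k > 0" "real (Suc k) = 1 / s k" for k by (simp_all add: s_def)
  define q where "q = (\<lambda>k v x. real (Suc k) * (w (x + s k *\<^sub>R v) - w x))"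
  have qb: "\<bar>q k v x\<bar> \<le> L * norm v" for k v x
  proof -
    have "\<bar>q k v x\<bar> = \<bar>w (x + s k *\<^sub>R v) - w x\<bar> / s k"
      unfolding q_def abs_mult s0(2) using s0(1)[of k] by simp
    also have "\<dots> \<le> L * norm (s k *\<^sub>R v) / s k"
      using s0(1)[of k] by (intro divide_right_mono lip) simp
    finally show ?thesis using s0(1)[of k] by simp
  qed
  have qm[measurable]: "q k v \<in> borel_measurable borel" for k v unfolding q_def by measurable
  define Hk where "Hk = (\<lambda>k x. q k (e + e') x - q k e x - q k e' x)"
  \<comment> \<open>Directional derivatives carry uncontrolled values on a null set. Cutting off at
    the bound makes it valid at every point, as the box criterion demands.\<close>
  define H where "H = (\<lambda>x. if \<bar>directional w (e + e') x - directional w e x - directional w e' x\<bar> \<le> L * (norm (e + e') + norm e + norm e')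
    then directional w (e + e') x - directional w e x - directional w e' x else 0)"
  have dm[measurable]: "directional w v \<in> borel_measurable borel" for v by (rule directional_borel[OF cw])
  have Hkb: "\<bar>Hk k x\<bar> \<le> L * (norm (e + e') + norm e + norm e')" for k x
    using qb[of k "e + e'" x] qb[of k e x] qb[of k e' x] unfolding Hk_def by (simp add: distrib_left)
  have lim: "AE x in lborel. (\<lambda>k. Hk k x) \<longlonglongrightarrow> H x \<and> H x = directional w (e + e') x - directional w e x - directional w e' x"
    using AE_has_directional[OF L, of "e + e'"] AE_has_directional[OF L, of e] AE_has_directional[OF L, of e']
  proof eventually_elim
    case (elim x)
    have *: "(\<lambda>k. Hk k x) \<longlonglongrightarrow> directional w (e + e') x - directional w e x - directional w e' x"
      unfolding Hk_def q_def s_def by (intro tendsto_diff has_directional_sequence elim)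
    have "\<bar>directional w (e + e') x - directional w e x - directional w e' x\<bar> \<le> L * (norm (e + e') + norm e + norm e')"
      by (rule tendsto_upperbound[OF tendsto_rabs[OF *]]) (use Hkb in auto)
    then show ?case using * unfolding H_def by simp
  qed
  have "AE x in lborel. H x = 0"
  proof (rule AE_zero_if_box_integrals_zero)
    show "H \<in> borel_measurable borel" unfolding H_def by measurable
    show "\<bar>H x\<bar> \<le> L * (norm (e + e') + norm e + norm e')" for x
      unfolding H_def using L0 by auto
  next
    fix l u :: 'a
    let ?B = "\<lambda>x. indicator (box l u) x :: real"
    let ?T = "\<lambda>k. \<integral>x. \<bar>?B (x - s k *\<^sub>R e) - ?B x\<bar> \<partial>lborel"
    have lim1: "(\<lambda>k. \<integral>x. ?B x * Hk k x \<partial>lborel) \<longlonglongrightarrow> (\<integral>x. ?B x * H x \<partial>lborel)"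
    proof (rule integral_dominated_convergence[where w = "\<lambda>x. ?B x * (L * (norm (e + e') + norm e + norm e'))"])
      show "(\<lambda>x. ?B x * H x) \<in> borel_measurable lborel" unfolding H_def by measurable
      show "(\<lambda>x. ?B x * Hk k x) \<in> borel_measurable lborel" for k unfolding Hk_def by measurable
      show "integrable lborel (\<lambda>x. ?B x * (L * (norm (e + e') + norm e + norm e')))"
        by (intro integrable_mult_left integrable_real_indicator emeasure_lborel_box_finite) simp
      show "AE x in lborel. (\<lambda>k. ?B x * Hk k x) \<longlonglongrightarrow> ?B x * H x"
        using lim by eventually_elim (auto intro: tendsto_mult_left)
      show "AE x in lborel. norm (?B x * Hk k x) \<le> ?B x * (L * (norm (e + e') + norm e + norm e'))" for k
        using Hkb[of k] by (auto intro!: AE_I2 simp: indicator_def)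
    qed
    have bound: "\<bar>\<integral>x. ?B x * Hk k x \<partial>lborel\<bar> \<le> L * norm e' * ?T k" for k
    proof -
      let ?v = "s k *\<^sub>R e"
      have iB: "integrable lborel ?B" by (rule integrable_real_indicator[OF _ emeasure_lborel_box_finite]) simp
      have iB': "integrable lborel (\<lambda>x. ?B (x - ?v))"
      proof -
        have "(\<lambda>x. ?B (x - ?v)) = (\<lambda>x. indicator ((+) ?v ` box l u) x :: real)"
          by (auto simp: indicator_def image_iff algebra_simps fun_eq_iff)
        moreover have "emeasure lborel ((+) ?v ` box l u) < \<infinity>"
          by (intro emeasure_bounded_finite bounded_translation bounded_box)
        moreover have "(+) ?v ` box l u \<in> sets borel"
          using open_translation[OF open_box, of ?v l u] by (rule borel_open)
        ultimately show ?thesis by simp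
      qed
      have i1: "integrable lborel (\<lambda>x. ?B x * q k e' (x + ?v))"
        by (rule Bochner_Integration.integrable_bound[OF integrable_mult_left[OF iB, of "L * norm e'"]])
          (use qb[of k e'] L0 in \<open>auto simp: indicator_def\<close>)
      have i2: "integrable lborel (\<lambda>x. ?B x * q k e' x)"
        by (rule Bochner_Integration.integrable_bound[OF integrable_mult_left[OF iB, of "L * norm e'"]])
          (use qb[of k e'] L0 in \<open>auto simp: indicator_def\<close>)
      have i3: "integrable lborel (\<lambda>x. ?B (x - ?v) * q k e' x)"
        by (rule Bochner_Integration.integrable_bound[OF integrable_mult_left[OF iB', of "L * norm e'"]])
          (use qb[of k e'] L0 in \<open>auto simp: indicator_def\<close>)
      have "Hk k x = q k e' (x + ?v) - q k e' x" for x
        unfolding Hk_def q_def by (simp add: algebra_simps)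
      then have "(\<integral>x. ?B x * Hk k x \<partial>lborel) = (\<integral>x. ?B x * q k e' (x + ?v) \<partial>lborel) - (\<integral>x. ?B x * q k e' x \<partial>lborel)"
        using i1 i2 by (simp add: right_diff_distrib)
      \<comment> \<open>Translation moves the shift from the quotient, of which only a bound is
        known, to the indicator of the box.\<close>
      also have "(\<integral>x. ?B x * q k e' (x + ?v) \<partial>lborel) = (\<integral>x. ?B (x - ?v) * q k e' x \<partial>lborel)"
        using integral_translate[of "\<lambda>x. ?B (x - ?v) * q k e' x" ?v] by simp
      also have "\<dots> - (\<integral>x. ?B x * q k e' x \<partial>lborel) = (\<integral>x. (?B (x - ?v) - ?B x) * q k e' x \<partial>lborel)"
        using i2 i3 by (simp add: left_diff_distrib)
      also have "\<bar>\<dots>\<bar> \<le> (\<integral>x. \<bar>?B (x - ?v) - ?B x\<bar> * (L * norm e') \<partial>lborel)"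
      proof (rule order_trans[OF integral_abs_bound integral_mono])
        show "integrable lborel (\<lambda>x. \<bar>(?B (x - ?v) - ?B x) * q k e' x\<bar>)"
          using i2 i3 by (intro integrable_abs) (simp add: left_diff_distrib)
        show "integrable lborel (\<lambda>x. \<bar>?B (x - ?v) - ?B x\<bar> * (L * norm e'))"
          using iB iB' by (intro integrable_mult_left integrable_abs Bochner_Integration.integrable_diff)
        show "\<bar>(?B (x - ?v) - ?B x) * q k e' x\<bar> \<le> \<bar>?B (x - ?v) - ?B x\<bar> * (L * norm e')" for x
          unfolding abs_mult by (intro mult_left_mono qb) auto
      qed
      finally show ?thesis by (simp add: mult.commute)
    qed
    have "(\<lambda>k. s k *\<^sub>R e) \<longlonglongrightarrow> 0"
      using tendsto_scaleR[OF LIMSEQ_inverse_real_of_nat tendsto_const[of e]]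
      by (simp add: s_def inverse_eq_divide)
    from tendsto_mult_left[OF indicator_translate_tendsto[OF this, of l u], of "L * norm e'"]
    have "(\<lambda>k. L * norm e' * ?T k) \<longlonglongrightarrow> 0" by simp
    then have "(\<lambda>k. \<integral>x. ?B x * Hk k x \<partial>lborel) \<longlonglongrightarrow> 0"
      by (rule Lim_null_comparison[rotated]) (use bound in auto)
    then show "(\<integral>x. ?B x * H x \<partial>lborel) = 0"
      using LIMSEQ_unique lim1 by blast
  qed
  then show ?thesis using lim by eventually_elim auto
qed

text \<open>Scaling and additivity expand \<open>e\<close> in the basis. The exceptional null set
  depends on \<open>e\<close>, so this is not yet differentiability at almost every point.\<close>

lemma AE_has_directional_inner:
  fixes w :: "'a::euclidean_space \<Rightarrow> real"
  assumes L: "L-lipschitz_on UNIV w"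
  shows "AE x in lborel. has_directional w e x ((\<Sum>b\<in>Basis. directional w b x *\<^sub>R b) \<bullet> e)"
proof -
  have sum: "finite S \<Longrightarrow> AE x in lborel. directional w (\<Sum>b\<in>S. (e \<bullet> b) *\<^sub>R b) x = (\<Sum>b\<in>S. (e \<bullet> b) * directional w b x)" for S
  proof (induction S rule: finite_induct)
    case empty
    then show ?case by (simp add: directional_def lim_const)
  next
    case (insert b S)
    show ?case
      using insert.IH AE_directional_add[OF L, of "(e \<bullet> b) *\<^sub>R b" "\<Sum>b\<in>S. (e \<bullet> b) *\<^sub>R b"] AE_has_directional[OF L, of b]
    proof eventually_elim
      case (elim x)
      then show ?case
        using insert.hyps has_directional_directional[OF has_directional_scale[OF elim(3)]] by simp
    qed
  qed
  show ?thesis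
    using sum[OF finite_Basis] AE_has_directional[OF L, of e]
  proof eventually_elim
    case (elim x)
    have "directional w e x = (\<Sum>b\<in>Basis. (e \<bullet> b) * directional w b x)"
      using elim(1) by (simp add: euclidean_representation)
    also have "\<dots> = (\<Sum>b\<in>Basis. directional w b x *\<^sub>R b) \<bullet> e"
      by (simp add: inner_sum_left inner_commute[of e] mult.commute)
    finally show ?case using elim(2) by simp
  qed
qed

text \<open>By compactness finitely many directions from the dense set \<open>D\<close> approximate
  all unit vectors, so the limits along them are uniform; the Lipschitz condition carries the
  estimate over to the neighbouring directions.\<close>

lemma GDERIV_if_directional:
  fixes w :: "'a::euclidean_space \<Rightarrow> real"
  assumes L: "L-lipschitz_on UNIV w"
    and D: "\<And>X. open X \<Longrightarrow> X \<noteq> {} \<Longrightarrow> \<exists>e\<in>D. e \<in> X"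
    and dir: "\<And>e. e \<in> D \<Longrightarrow> has_directional w e x (g \<bullet> e)"
  shows "GDERIV w x :> g"
proof -
  have L0: "L \<ge> 0" using lipschitz_on_nonneg[OF L] .
  have lip: "\<bar>w y - w z\<bar> \<le> L * norm (y - z)" for y z
    using lipschitz_onD[OF L, of y z] by (simp add: dist_norm)
  show ?thesis
    unfolding gderiv_def has_derivative_at_alt
  proof (intro conjI allI impI)
    show "bounded_linear (\<lambda>h. h \<bullet> g)" by (rule bounded_linear_inner_left)
    fix \<epsilon> :: real assume eps: "0 < \<epsilon>"
    \<comment> \<open>Half of \<open>\<epsilon>\<close> pays for the finitely many limits. The other
      half pays for moving a unit vector by less than \<open>\<eta>\<close>, which costs
      \<open>L * \<eta>\<close> in \<open>w\<close> and \<open>norm g * \<eta>\<close> in the linear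
      part.\<close>
    define \<eta> where "\<eta> = \<epsilon> / (2 * (L + norm g + 1))"
    have pos: "L + norm g + 1 > 0" using L0 norm_ge_zero[of g] by linarith
    have eta: "\<eta> > 0" "(L + norm g) * \<eta> \<le> \<epsilon> / 2"
    proof -
      show "\<eta> > 0" unfolding \<eta>_def using eps pos by simp
      then have "(L + norm g) * \<eta> \<le> (L + norm g + 1) * \<eta>" by (intro mult_right_mono) auto
      also have "\<dots> = \<epsilon> / 2" unfolding \<eta>_def using pos by (simp add: field_simps)
      finally show "(L + norm g) * \<eta> \<le> \<epsilon> / 2" .
    qed
    have cover: "sphere 0 1 \<subseteq> (\<Union>e\<in>D. ball e \<eta>)"
    proof
      fix u :: 'a
      obtain e where "e \<in> D" "e \<in> ball u \<eta>" using D[of "ball u \<eta>"] eta by auto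
      then show "u \<in> (\<Union>e\<in>D. ball e \<eta>)" by (auto simp: dist_commute)
    qed
    obtain F where F: "F \<subseteq> D" "finite F" "sphere 0 1 \<subseteq> (\<Union>e\<in>F. ball e \<eta>)"
      using compactE_image[OF compact_sphere _ cover] by (metis open_ball)
    have "\<forall>\<^sub>F t in at 0. \<forall>e\<in>F. dist ((w (x + t *\<^sub>R e) - w x) / t) (g \<bullet> e) < \<epsilon> / 2"
      using F(2)
    proof (rule eventually_ball_finite, intro ballI)
      fix e assume "e \<in> F"
      then show "\<forall>\<^sub>F t in at 0. dist ((w (x + t *\<^sub>R e) - w x) / t) (g \<bullet> e) < \<epsilon> / 2"
        using dir[of e] F(1) eps unfolding has_directional_def by (intro tendstoD) auto
    qed
    then obtain d where d: "d > 0" "\<And>t e. t \<noteq> 0 \<Longrightarrow> \<bar>t\<bar> < d \<Longrightarrow> e \<in> F \<Longrightarrow> \<bar>(w (x + t *\<^sub>R e) - w x) / t - g \<bullet> e\<bar> < \<epsilon> / 2"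
      unfolding eventually_at by (auto simp: dist_real_def)
    show "\<exists>d>0. \<forall>y. norm (y - x) < d \<longrightarrow> norm (w y - w x - (y - x) \<bullet> g) \<le> \<epsilon> * norm (y - x)"
    proof (intro exI conjI allI impI)
      fix y assume y: "norm (y - x) < d"
      show "norm (w y - w x - (y - x) \<bullet> g) \<le> \<epsilon> * norm (y - x)"
      proof (cases "y = x")
        case False
        define t where "t = norm (y - x)"
        define u where "u = (1 / t) *\<^sub>R (y - x)"
        have t: "t > 0" using False by (simp add: t_def)
        have "norm u = 1" unfolding u_def using t by (simp add: t_def)
        then obtain e where e: "e \<in> F" "norm (u - e) < \<eta>"
          using F(3) by (auto simp: subset_iff dist_norm norm_minus_commute)
        have yx: "y = x + t *\<^sub>R u" using t by (simp add: u_def)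
        have 1: "\<bar>w (x + t *\<^sub>R e) - w x - t * (g \<bullet> e)\<bar> \<le> t * (\<epsilon> / 2)"
        proof -
          have "w (x + t *\<^sub>R e) - w x - t * (g \<bullet> e) = t * ((w (x + t *\<^sub>R e) - w x) / t - g \<bullet> e)"
            using t by (simp add: field_simps)
          then show ?thesis
            using d(2)[of t e] e(1) t y by (simp add: abs_mult t_def[symmetric])
        qed
        have "\<bar>w y - w (x + t *\<^sub>R e)\<bar> \<le> L * norm (y - (x + t *\<^sub>R e))" by (rule lip)
        also have "y - (x + t *\<^sub>R e) = t *\<^sub>R (u - e)" by (simp add: yx algebra_simps)
        also have "L * norm \<dots> = t * (L * norm (u - e))" using t by simp
        also have "\<dots> \<le> t * (L * \<eta>)" using t L0 e by (intro mult_left_mono) auto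
        finally have 2: "\<bar>w y - w (x + t *\<^sub>R e)\<bar> \<le> t * (L * \<eta>)" .
        have "\<bar>g \<bullet> (e - u)\<bar> \<le> norm g * norm (e - u)" by (rule Cauchy_Schwarz_ineq2)
        also have "\<dots> \<le> norm g * \<eta>" using e by (intro mult_left_mono) (auto simp: norm_minus_commute)
        finally have 3: "\<bar>t * (g \<bullet> (e - u))\<bar> \<le> t * (norm g * \<eta>)"
          using t by (simp add: abs_mult)
        have "(y - x) \<bullet> g = t * (g \<bullet> u)" by (simp add: yx inner_commute)
        then have "w y - w x - (y - x) \<bullet> g = (w (x + t *\<^sub>R e) - w x - t * (g \<bullet> e)) + (w y - w (x + t *\<^sub>R e)) + t * (g \<bullet> (e - u))"
          by (simp add: inner_diff_right algebra_simps)
        then have "\<bar>w y - w x - (y - x) \<bullet> g\<bar> \<le> t * (\<epsilon> / 2) + t * (L * \<eta>) + t * (norm g * \<eta>)"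
          using 1 2 3 by linarith
        also have "\<dots> = t * (\<epsilon> / 2 + (L + norm g) * \<eta>)" by (simp add: algebra_simps)
        also have "\<dots> \<le> t * \<epsilon>" using eta(2) t by (intro mult_left_mono) auto
        finally show ?thesis by (simp add: t_def mult.commute)
      qed simp
    qed (use d in simp)
  qed
qed

theorem rademacher:
  fixes w :: "'a::euclidean_space \<Rightarrow> real"
  assumes L: "L-lipschitz_on UNIV w"
  shows "AE x in lborel. GDERIV w x :> (\<Sum>b\<in>Basis. directional w b x *\<^sub>R b)"
proof -
  obtain D :: "'a set" where D: "countable D" "\<And>X. open X \<Longrightarrow> X \<noteq> {} \<Longrightarrow> \<exists>e\<in>D. e \<in> X"
    using countable_dense_setE by metis
  have "AE x in lborel. \<forall>e\<in>D. has_directional w e x ((\<Sum>b\<in>Basis. directional w b x *\<^sub>R b) \<bullet> e)"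
    using D(1) AE_has_directional_inner[OF L] by (simp add: AE_ball_countable)
  then show ?thesis
    by eventually_elim (use GDERIV_if_directional[OF L D(2)] in blast)
qed

section \<open>Averages and the energy of a Lipschitz function\<close>

text \<open>Assembled from coordinate derivatives so as to be Borel; by Rademacher's theorem it is
  the gradient of a Lipschitz function almost everywhere.\<close>

definition weak_gradient :: "('a::euclidean_space \<Rightarrow> real) \<Rightarrow> 'a \<Rightarrow> 'a" where
  "weak_gradient w x = (\<Sum>b\<in>Basis. directional w b x *\<^sub>R b)"

lemma weak_gradient_borel[measurable]:
  assumes "continuous_on UNIV w"
  shows "weak_gradient w \<in> borel_measurable borel"
  unfolding weak_gradient_def[abs_def] using directional_borel[OF assms] by measurable

lemma nn_integral_translate:
  fixes f :: "'a::euclidean_space \<Rightarrow> ennreal"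
  assumes [measurable]: "f \<in> borel_measurable borel"
  shows "(\<integral>\<^sup>+x. f (x + v) \<partial>lborel) = (\<integral>\<^sup>+x. f x \<partial>lborel)"
proof -
  have "(\<integral>\<^sup>+x. f x \<partial>lborel) = (\<integral>\<^sup>+x. f x \<partial>distr lborel borel ((+) v))"
    unfolding lborel_distr_plus ..
  also have "\<dots> = (\<integral>\<^sup>+x. f (x + v) \<partial>lborel)"
    by (subst nn_integral_distr) (auto simp: add.commute)
  finally show ?thesis ..
qed

text \<open>The segment from \<open>x\<close> to \<open>x + v\<close> is cut into \<open>k\<close> equal steps, and \<open>k\<close> tends to infinity.\<close>

lemma translation_estimate:
  fixes w :: "'a::euclidean_space \<Rightarrow> real"
  assumes L: "L-lipschitz_on UNIV w"
    and A[measurable]: "A \<in> sets borel" and A'[measurable]: "A' \<in> sets borel" and bdd: "bounded A'"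
    and sub: "\<And>x t. x \<in> A \<Longrightarrow> 0 \<le> t \<Longrightarrow> t \<le> 1 \<Longrightarrow> x + t *\<^sub>R v \<in> A'"
  shows "(\<integral>\<^sup>+x\<in>A. ennreal \<bar>w (x + v) - w x\<bar> \<partial>lborel)
    \<le> ennreal (norm v) * (\<integral>\<^sup>+x\<in>A'. ennreal (norm (weak_gradient w x)) \<partial>lborel)"
proof -
  have cw: "continuous_on UNIV w" using lipschitz_on_continuous_on[OF L] .
  have wm[measurable]: "w \<in> borel_measurable borel"
    using cw by (rule borel_measurable_continuous_onI)
  have gm[measurable]: "weak_gradient w \<in> borel_measurable borel" by (rule weak_gradient_borel[OF cw])
  define s where "s = (\<lambda>k::nat. 1 / real (Suc k))"
  have s0: "s k > 0" "real (Suc k) = 1 / s k" "real (Suc k) * s k = 1" for k by (simp_all add: s_def)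
  define d where "d = (\<lambda>k x. \<bar>w (x + s k *\<^sub>R v) - w x\<bar>)"
  have dm[measurable]: "d k \<in> borel_measurable borel" for k unfolding d_def by measurable
  have step: "(\<integral>\<^sup>+x\<in>A. ennreal \<bar>w (x + v) - w x\<bar> \<partial>lborel) \<le> (\<integral>\<^sup>+x. ennreal (indicator A' x * (real (Suc k) * d k x)) \<partial>lborel)" for k
  proof -
    have tel: "\<bar>w (x + v) - w x\<bar> \<le> (\<Sum>j<Suc k. d k (x + (real j * s k) *\<^sub>R v))" for x
    proof -
      have "w (x + v) - w x = w (x + (real (Suc k) * s k) *\<^sub>R v) - w (x + (real 0 * s k) *\<^sub>R v)"
        by (simp add: s0(3) del: of_nat_Suc)
      also have "\<dots> = (\<Sum>j<Suc k. w (x + (real (Suc j) * s k) *\<^sub>R v) - w (x + (real j * s k) *\<^sub>R v))"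
        by (rule sum_lessThan_telescope[symmetric])
      also have "\<bar>\<dots>\<bar> \<le> (\<Sum>j<Suc k. \<bar>w (x + (real (Suc j) * s k) *\<^sub>R v) - w (x + (real j * s k) *\<^sub>R v)\<bar>)"
        by (rule sum_abs)
      also have "\<dots> = (\<Sum>j<Suc k. d k (x + (real j * s k) *\<^sub>R v))"
        unfolding d_def by (intro sum.cong refl) (simp add: algebra_simps)
      finally show ?thesis .
    qed
    have "(\<integral>\<^sup>+x\<in>A. ennreal \<bar>w (x + v) - w x\<bar> \<partial>lborel) \<le>
      (\<integral>\<^sup>+x. (\<Sum>j<Suc k. ennreal (indicator A' (x + (real j * s k) *\<^sub>R v) * d k (x + (real j * s k) *\<^sub>R v))) \<partial>lborel)"
    proof (rule nn_integral_mono)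
      fix x
      have "\<bar>w (x + v) - w x\<bar> \<le> (\<Sum>j<Suc k. indicator A' (x + (real j * s k) *\<^sub>R v) * d k (x + (real j * s k) *\<^sub>R v))"
        if x: "x \<in> A"
      proof -
        have "x + (real j * s k) *\<^sub>R v \<in> A'" if j: "j < Suc k" for j
        proof (rule sub[OF x])
          show "0 \<le> real j * s k" using s0(1)[of k] by simp
          have "real j * s k \<le> real (Suc k) * s k" using j s0(1)[of k] by (intro mult_right_mono) auto
          then show "real j * s k \<le> 1" by (simp add: s0(3) del: of_nat_Suc)
        qed
        then show ?thesis using tel[of x] by simp
      qed
      then show "ennreal \<bar>w (x + v) - w x\<bar> * indicator A x \<le>
        (\<Sum>j<Suc k. ennreal (indicator A' (x + (real j * s k) *\<^sub>R v) * d k (x + (real j * s k) *\<^sub>R v)))"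
        by (subst sum_ennreal) (cases "x \<in> A"; simp add: d_def ennreal_leI del: sum.lessThan_Suc)+
    qed
    also have "\<dots> = (\<Sum>j<Suc k. \<integral>\<^sup>+x. ennreal (indicator A' (x + (real j * s k) *\<^sub>R v) * d k (x + (real j * s k) *\<^sub>R v)) \<partial>lborel)"
      by (rule nn_integral_sum) measurable
    \<comment> \<open>All pieces have the same integral by translation invariance, so the sum
      collapses to one difference quotient integrated over \<open>A'\<close>.\<close>
    also have "\<dots> = (\<Sum>j<Suc k. \<integral>\<^sup>+x. ennreal (indicator A' x * d k x) \<partial>lborel)"
      by (intro sum.cong refl nn_integral_translate[of "\<lambda>x. ennreal (indicator A' x * d k x)"]) measurable
    also have "\<dots> = ennreal (real (Suc k)) * (\<integral>\<^sup>+x. ennreal (indicator A' x * d k x) \<partial>lborel)"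
      by (simp add: ennreal_of_nat_eq_real_of_nat[symmetric])
    also have "\<dots> = (\<integral>\<^sup>+x. ennreal (indicator A' x * (real (Suc k) * d k x)) \<partial>lborel)"
      by (subst nn_integral_cmult[symmetric])
        (auto intro!: nn_integral_cong simp: ennreal_mult'[symmetric] ac_simps simp del: of_nat_Suc)
    finally show ?thesis .
  qed
  \<comment> \<open>The Lipschitz constant serves only to dominate; it does not survive in the
    limit.\<close>
  have lim: "(\<lambda>k. \<integral>\<^sup>+x. ennreal (indicator A' x * (real (Suc k) * d k x)) \<partial>lborel) \<longlonglongrightarrow>
     (\<integral>\<^sup>+x. ennreal (indicator A' x * \<bar>weak_gradient w x \<bullet> v\<bar>) \<partial>lborel)"
  proof (rule nn_integral_dominated_convergence[where w = "\<lambda>x. ennreal (L * norm v) * indicator A' x"])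
    show "(\<integral>\<^sup>+x. ennreal (L * norm v) * indicator A' x \<partial>lborel) < \<infinity>"
      using emeasure_bounded_finite[OF bdd] by (simp add: nn_integral_cmult ennreal_mult_less_top)
    show "AE x in lborel. ennreal (indicator A' x * (real (Suc k) * d k x)) \<le> ennreal (L * norm v) * indicator A' x" for k
    proof (rule AE_I2)
      fix x
      have "d k x \<le> L * norm (s k *\<^sub>R v)"
        using lipschitz_onD[OF L, of "x + s k *\<^sub>R v" x] by (simp add: dist_norm d_def)
      then have "real (Suc k) * d k x \<le> L * norm v"
        unfolding s0(2) using s0(1)[of k] by (simp add: field_simps)
      then show "ennreal (indicator A' x * (real (Suc k) * d k x)) \<le> ennreal (L * norm v) * indicator A' x"
        by (auto simp: indicator_def intro!: ennreal_leI)
    qed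
    have "AE x in lborel. has_directional w v x (weak_gradient w x \<bullet> v)"
      unfolding weak_gradient_def by (rule AE_has_directional_inner[OF L])
    then show "AE x in lborel. (\<lambda>k. ennreal (indicator A' x * (real (Suc k) * d k x))) \<longlonglongrightarrow> ennreal (indicator A' x * \<bar>weak_gradient w x \<bullet> v\<bar>)"
    proof eventually_elim
      case (elim x)
      have "(\<lambda>k. \<bar>real (Suc k) * (w (x + (1 / real (Suc k)) *\<^sub>R v) - w x)\<bar>) \<longlonglongrightarrow> \<bar>weak_gradient w x \<bullet> v\<bar>"
        by (rule tendsto_rabs[OF has_directional_sequence[OF elim]])
      then have "(\<lambda>k. real (Suc k) * d k x) \<longlonglongrightarrow> \<bar>weak_gradient w x \<bullet> v\<bar>"
        unfolding d_def s_def abs_mult by simp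
      then show ?case by (intro tendsto_ennrealI tendsto_mult_left)
    qed
  qed measurable
  have "(\<integral>\<^sup>+x\<in>A. ennreal \<bar>w (x + v) - w x\<bar> \<partial>lborel) \<le> (\<integral>\<^sup>+x. ennreal (indicator A' x * \<bar>weak_gradient w x \<bullet> v\<bar>) \<partial>lborel)"
    by (rule LIMSEQ_le_const[OF lim]) (use step in blast)
  also have "\<dots> \<le> (\<integral>\<^sup>+x. ennreal (norm v) * (ennreal (norm (weak_gradient w x)) * indicator A' x) \<partial>lborel)"
  proof (rule nn_integral_mono)
    fix x
    have "\<bar>weak_gradient w x \<bullet> v\<bar> \<le> norm v * norm (weak_gradient w x)"
      using Cauchy_Schwarz_ineq2[of "weak_gradient w x" v] by (simp add: mult.commute)
    then show "ennreal (indicator A' x * \<bar>weak_gradient w x \<bullet> v\<bar>) \<le> ennreal (norm v) * (ennreal (norm (weak_gradient w x)) * indicator A' x)"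
      by (auto simp: indicator_def ennreal_mult'[symmetric] intro!: ennreal_leI)
  qed
  also have "\<dots> = ennreal (norm v) * (\<integral>\<^sup>+x\<in>A'. ennreal (norm (weak_gradient w x)) \<partial>lborel)"
    by (rule nn_integral_cmult) measurable
  finally show ?thesis .
qed

section \<open>Averages over balls and Poincare-type estimates\<close>

definition mean_value :: "('a::euclidean_space \<Rightarrow> real) \<Rightarrow> 'a set \<Rightarrow> real" where
  "mean_value w A = (\<integral>x. indicator A x * w x \<partial>lborel) / measure lborel A"

text \<open>Jensen's inequality for the absolute value, multiplied by the volume to avoid division
  in \<open>ennreal\<close>.\<close>

lemma mean_value_diff_le:
  fixes w :: "'a::euclidean_space \<Rightarrow> real"
  assumes cw: "continuous_on UNIV w" and r: "r > 0"
  shows "ennreal \<bar>mean_value w (ball c r) - y\<bar> * emeasure lborel (ball c r)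
    \<le> (\<integral>\<^sup>+x\<in>ball c r. ennreal \<bar>w x - y\<bar> \<partial>lborel)"
proof -
  have wm[measurable]: "w \<in> borel_measurable borel"
    using cw by (rule borel_measurable_continuous_onI)
  have bm[measurable]: "ball c r \<in> sets borel" by simp
  let ?m = "measure lborel (ball c r)"
  have em: "emeasure lborel (ball c r) = ennreal ?m"
    using emeasure_lborel_ball_finite[of c r] by (simp add: emeasure_eq_ennreal_measure top.not_eq_extremum)
  have m: "?m > 0" using r by (simp add: content_ball_pos)
  have ii: "integrable lborel (\<lambda>x. indicator (ball c r) x * f x)"
    if "continuous_on UNIV f" for f :: "'a \<Rightarrow> real"
  proof -
    have "integrable lborel (\<lambda>x. indicator (cball c r) x *\<^sub>R f x)"
      using borel_integrable_compact[OF compact_cball continuous_on_subset[OF that]] by blast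
    then have "integrable lborel (\<lambda>x. indicator (cball c r) x * f x)" by simp
    then show ?thesis
    proof (rule Bochner_Integration.integrable_bound)
      show "(\<lambda>x. indicator (ball c r) x * f x) \<in> borel_measurable lborel"
        using borel_measurable_continuous_onI[OF that] bm by simp
    qed (auto simp: indicator_def)
  qed
  have i1: "integrable lborel (\<lambda>x. indicator (ball c r) x * w x)" by (rule ii[OF cw])
  have i2: "integrable lborel (\<lambda>x. indicator (ball c r) x * y)" by (rule ii) simp
  have i3: "integrable lborel (\<lambda>x. indicator (ball c r) x * \<bar>w x - y\<bar>)"
    by (rule ii) (intro continuous_intros cw)
  have "(mean_value w (ball c r) - y) * ?m = (\<integral>x. indicator (ball c r) x * w x \<partial>lborel) - (\<integral>x. indicator (ball c r) x * y \<partial>lborel)"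
    using m by (simp add: mean_value_def field_simps)
  also have "\<dots> = (\<integral>x. indicator (ball c r) x * (w x - y) \<partial>lborel)"
    using i1 i2 by (simp add: right_diff_distrib)
  also have "\<bar>\<dots>\<bar> \<le> (\<integral>x. \<bar>indicator (ball c r) x * (w x - y)\<bar> \<partial>lborel)"
    by (rule integral_abs_bound)
  also have "\<dots> = (\<integral>x. indicator (ball c r) x * \<bar>w x - y\<bar> \<partial>lborel)"
    by (simp add: abs_mult)
  finally have "\<bar>mean_value w (ball c r) - y\<bar> * ?m \<le> (\<integral>x. indicator (ball c r) x * \<bar>w x - y\<bar> \<partial>lborel)"
    using m by (simp add: abs_mult)
  then have "ennreal (\<bar>mean_value w (ball c r) - y\<bar> * ?m) \<le> ennreal (\<integral>x. indicator (ball c r) x * \<bar>w x - y\<bar> \<partial>lborel)"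
    by (rule ennreal_leI)
  also have "\<dots> = (\<integral>\<^sup>+x. ennreal (indicator (ball c r) x * \<bar>w x - y\<bar>) \<partial>lborel)"
    by (rule nn_integral_eq_integral[symmetric, OF i3]) simp
  also have "\<dots> = (\<integral>\<^sup>+x\<in>ball c r. ennreal \<bar>w x - y\<bar> \<partial>lborel)"
    by (intro nn_integral_cong) (auto simp: indicator_def)
  finally show ?thesis by (simp add: em ennreal_mult')
qed

text \<open>The means are compared through the double integral of \<open>|w x - w y|\<close> over
  the two balls. With \<open>x = y + v\<close> the displacement has norm below
  \<open>2 * \<rho>\<close>; after exchanging integrals the translation estimate applies for each
  fixed \<open>v\<close>, along segments that start in \<open>ball p \<rho>\<close> and stay in
  \<open>ball p (3 * \<rho>)\<close>.\<close>

lemma mean_value_compare: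
  fixes w :: "'a::euclidean_space \<Rightarrow> real"
  assumes L: "L-lipschitz_on UNIV w" and r: "0 < r1" "0 < r2" "0 < \<rho>"
    and sub: "ball c1 r1 \<subseteq> ball p \<rho>" "ball c2 r2 \<subseteq> ball p \<rho>"
  shows "ennreal \<bar>mean_value w (ball c1 r1) - mean_value w (ball c2 r2)\<bar> * emeasure lborel (ball c1 r1) * emeasure lborel (ball c2 r2)
    \<le> ennreal (2 * \<rho>) * emeasure lborel (ball (0::'a) (2 * \<rho>)) * (\<integral>\<^sup>+x\<in>ball p (3 * \<rho>). ennreal (norm (weak_gradient w x)) \<partial>lborel)"
proof -
  have cw: "continuous_on UNIV w" using lipschitz_on_continuous_on[OF L] .
  have wm[measurable]: "w \<in> borel_measurable borel"
    using cw by (rule borel_measurable_continuous_onI)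
  have [measurable]: "ball c r \<in> sets borel" for c :: 'a and r by simp
  let ?U = "ball c1 r1" and ?V = "ball c2 r2" and ?B = "ball p \<rho>"
  let ?G = "\<integral>\<^sup>+x\<in>ball p (3 * \<rho>). ennreal (norm (weak_gradient w x)) \<partial>lborel"
  have "ennreal \<bar>mean_value w ?U - mean_value w ?V\<bar> * emeasure lborel ?U * emeasure lborel ?V
    = (ennreal \<bar>mean_value w ?V - mean_value w ?U\<bar> * emeasure lborel ?V) * emeasure lborel ?U"
    by (simp add: abs_minus_commute ac_simps)
  also have "\<dots> \<le> (\<integral>\<^sup>+y\<in>?V. ennreal \<bar>w y - mean_value w ?U\<bar> \<partial>lborel) * emeasure lborel ?U"
    by (intro mult_right_mono mean_value_diff_le[OF cw r(2)]) simp
  also have "\<dots> = (\<integral>\<^sup>+y. ennreal \<bar>mean_value w ?U - w y\<bar> * emeasure lborel ?U * indicator ?V y \<partial>lborel)"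
    by (subst nn_integral_multc[symmetric]) (auto simp: abs_minus_commute ac_simps)
  also have "\<dots> \<le> (\<integral>\<^sup>+y. (\<integral>\<^sup>+x\<in>?U. ennreal \<bar>w x - w y\<bar> \<partial>lborel) * indicator ?V y \<partial>lborel)"
    by (intro nn_integral_mono mult_right_mono mean_value_diff_le[OF cw r(1)]) simp
  also have "\<dots> \<le> (\<integral>\<^sup>+y. (\<integral>\<^sup>+v. indicator (ball 0 (2 * \<rho>)) v * (ennreal \<bar>w (y + v) - w y\<bar> * indicator ?B y) \<partial>lborel) \<partial>lborel)"
  proof (rule nn_integral_mono)
    fix y
    show "(\<integral>\<^sup>+x\<in>?U. ennreal \<bar>w x - w y\<bar> \<partial>lborel) * indicator ?V y
      \<le> (\<integral>\<^sup>+v. indicator (ball 0 (2 * \<rho>)) v * (ennreal \<bar>w (y + v) - w y\<bar> * indicator ?B y) \<partial>lborel)"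
    proof (cases "y \<in> ?V")
      case True
      then have y: "dist p y < \<rho>" using sub by auto
      have "(\<integral>\<^sup>+x\<in>?U. ennreal \<bar>w x - w y\<bar> \<partial>lborel) = (\<integral>\<^sup>+v. ennreal \<bar>w (v + y) - w y\<bar> * indicator ?U (v + y) \<partial>lborel)"
        by (rule nn_integral_translate[symmetric]) measurable
      also have "\<dots> \<le> (\<integral>\<^sup>+v. indicator (ball 0 (2 * \<rho>)) v * (ennreal \<bar>w (y + v) - w y\<bar> * indicator ?B y) \<partial>lborel)"
      proof (rule nn_integral_mono)
        fix v
        have "norm v < 2 * \<rho>" if "v + y \<in> ?U"
        proof -
          have "dist p (v + y) < \<rho>" using that sub by auto
          then have "dist (v + y) y < 2 * \<rho>" using y dist_triangle3[of "v + y" y p] by linarith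
          then show ?thesis by (simp add: dist_norm)
        qed
        then show "ennreal \<bar>w (v + y) - w y\<bar> * indicator ?U (v + y) \<le> indicator (ball 0 (2 * \<rho>)) v * (ennreal \<bar>w (y + v) - w y\<bar> * indicator ?B y)"
          using y by (auto simp: indicator_def add.commute)
      qed
      finally show ?thesis using True by simp
    qed simp
  qed
  also have "\<dots> = (\<integral>\<^sup>+v. (\<integral>\<^sup>+y. indicator (ball 0 (2 * \<rho>)) v * (ennreal \<bar>w (y + v) - w y\<bar> * indicator ?B y) \<partial>lborel) \<partial>lborel)"
    by (rule lborel_pair.Fubini'[symmetric]) measurable
  also have "\<dots> = (\<integral>\<^sup>+v. indicator (ball 0 (2 * \<rho>)) v * (\<integral>\<^sup>+y\<in>?B. ennreal \<bar>w (y + v) - w y\<bar> \<partial>lborel) \<partial>lborel)"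
    by (intro nn_integral_cong nn_integral_cmult) measurable
  also have "\<dots> \<le> (\<integral>\<^sup>+v. (ennreal (2 * \<rho>) * ?G) * indicator (ball (0::'a) (2 * \<rho>)) v \<partial>lborel)"
  proof (rule nn_integral_mono)
    fix v :: 'a
    show "indicator (ball 0 (2 * \<rho>)) v * (\<integral>\<^sup>+y\<in>?B. ennreal \<bar>w (y + v) - w y\<bar> \<partial>lborel)
      \<le> (ennreal (2 * \<rho>) * ?G) * indicator (ball 0 (2 * \<rho>)) v"
    proof (cases "v \<in> ball 0 (2 * \<rho>)")
      case True
      have "(\<integral>\<^sup>+y\<in>?B. ennreal \<bar>w (y + v) - w y\<bar> \<partial>lborel) \<le> ennreal (norm v) * ?G"
      proof (rule translation_estimate[OF L])
        fix x and t :: real assume x: "x \<in> ?B" and t: "0 \<le> t" "t \<le> 1"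
        have "dist p (x + t *\<^sub>R v) \<le> dist p x + norm (t *\<^sub>R v)"
          using dist_triangle[of p "x + t *\<^sub>R v" x] by (simp add: dist_norm)
        also have "norm (t *\<^sub>R v) \<le> norm v" using t by (simp add: mult_left_le_one_le)
        finally show "x + t *\<^sub>R v \<in> ball p (3 * \<rho>)" using x True by auto
      qed auto
      also have "\<dots> \<le> ennreal (2 * \<rho>) * ?G" using True by (intro mult_right_mono ennreal_leI) auto
      finally show ?thesis using True by simp
    qed simp
  qed
  also have "\<dots> = ennreal (2 * \<rho>) * ?G * emeasure lborel (ball (0::'a) (2 * \<rho>))"
    by (subst nn_integral_cmult) auto
  finally show ?thesis by (simp add: ac_simps)
qed

section \<open>The Loewner lower bound\<close>

text \<open>What remains of the mean comparison once the powers of \<open>\<rho>\<close> cancel: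
  \<open>4 ^ n\<close> from two balls of radius at least \<open>\<rho> / 2\<close>,
  \<open>2 ^ (n + 1)\<close> from displacements below \<open>2 * \<rho>\<close>,
  \<open>3 ^ n\<close> from the volume of the ball of radius \<open>3 * \<rho>\<close>, and the
  reciprocal unit volume from the energy term.\<close>

definition chain_const :: "nat \<Rightarrow> real" where
  "chain_const n = 2 ^ (n + 1) * 4 ^ n * (3 ^ n + 1 / unit_ball_vol (real n))"

lemma chain_const_pos: "chain_const n > 0"
  unfolding chain_const_def using unit_ball_vol_pos[of "real n"]
  by (intro mult_pos_pos add_pos_pos) auto

text \<open>A Young-type inequality takes the place of Hoelder's. Its free parameter
  \<open>\<eta>\<close> can be matched to the energy afterwards, and neither \<open>L\<close> nor
  \<open>\<rho>\<close> enters the bound.\<close>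

lemma mean_value_compare_energy:
  fixes w :: "'a::euclidean_space \<Rightarrow> real"
  defines "n \<equiv> DIM('a)"
  assumes L: "L-lipschitz_on UNIV w" and \<rho>: "0 < \<rho>" and r: "\<rho> / 2 \<le> r1" "\<rho> / 2 \<le> r2"
    and sub: "ball c1 r1 \<subseteq> ball p \<rho>" "ball c2 r2 \<subseteq> ball p \<rho>"
    and \<eta>: "0 < \<eta>" and j: "0 \<le> j"
    and energy: "(\<integral>\<^sup>+x\<in>ball p (3 * \<rho>). ennreal (norm (weak_gradient w x) ^ n) \<partial>lborel) \<le> ennreal j"
  shows "\<bar>mean_value w (ball c1 r1) - mean_value w (ball c2 r2)\<bar> \<le> chain_const n * (\<eta> + j / \<eta> ^ (n - 1))"
proof -
  have cw: "continuous_on UNIV w" using lipschitz_on_continuous_on[OF L] .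
  have gm[measurable]: "weak_gradient w \<in> borel_measurable borel" by (rule weak_gradient_borel[OF cw])
  have [measurable]: "ball c r \<in> sets borel" for c :: 'a and r by simp
  define \<omega> where "\<omega> = unit_ball_vol (real n)"
  have om: "\<omega> > 0" unfolding \<omega>_def by simp
  have vol: "emeasure lborel (ball c r) = ennreal (\<omega> * r ^ n)" if "r \<ge> 0" for c :: 'a and r
    using emeasure_ball[OF that, of c] unfolding \<omega>_def n_def .
  have n1: "n \<ge> 1" unfolding n_def by (simp add: Suc_leI)
  then have nS: "x ^ n = x * x ^ (n - 1)" for x :: real by (cases n) auto
  \<comment> \<open>A threshold for gradients scales like the reciprocal of a length; dividing by
    \<open>\<rho>\<close> makes all powers of \<open>\<rho>\<close> cancel.\<close>
  define \<tau> where "\<tau> = \<eta> / \<rho>"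
  have lam: "\<tau> > 0" using \<eta> \<rho> by (simp add: \<tau>_def)
  let ?g = "\<lambda>x. norm (weak_gradient w x)" and ?B = "ball p (3 * \<rho>)"
  define d where "d = \<bar>mean_value w (ball c1 r1) - mean_value w (ball c2 r2)\<bar>"
  have young: "t \<le> \<tau> + t ^ n / \<tau> ^ (n - 1)" if "t \<ge> 0" for t
  proof (cases "t \<le> \<tau>")
    case True
    then show ?thesis using that lam by (simp add: add_increasing2)
  next
    case False
    then have "t * \<tau> ^ (n - 1) \<le> t * t ^ (n - 1)"
      using that lam by (intro mult_left_mono power_mono) auto
    then have "t \<le> t ^ n / \<tau> ^ (n - 1)" unfolding nS[of t] using lam by (simp add: pos_le_divide_eq)
    then show ?thesis using lam by simp
  qed
  have "(\<integral>\<^sup>+x\<in>?B. ennreal (?g x) \<partial>lborel) \<le>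
    (\<integral>\<^sup>+x. ennreal \<tau> * indicator ?B x + ennreal (1 / \<tau> ^ (n - 1)) * (ennreal (?g x ^ n) * indicator ?B x) \<partial>lborel)"
  proof (rule nn_integral_mono)
    fix x
    have "ennreal (?g x) \<le> ennreal \<tau> + ennreal (1 / \<tau> ^ (n - 1)) * ennreal (?g x ^ n)"
      using young[of "?g x"] lam
      by (simp add: ennreal_plus[symmetric] ennreal_mult'[symmetric] ennreal_leI del: ennreal_plus)
    then show "ennreal (?g x) * indicator ?B x \<le> ennreal \<tau> * indicator ?B x + ennreal (1 / \<tau> ^ (n - 1)) * (ennreal (?g x ^ n) * indicator ?B x)"
      by (auto simp: indicator_def)
  qed
  also have "\<dots> = ennreal \<tau> * emeasure lborel ?B + ennreal (1 / \<tau> ^ (n - 1)) * (\<integral>\<^sup>+x\<in>?B. ennreal (?g x ^ n) \<partial>lborel)"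
    by (subst nn_integral_add) (auto simp: nn_integral_cmult)
  also have "\<dots> \<le> ennreal \<tau> * ennreal (\<omega> * (3 * \<rho>) ^ n) + ennreal (1 / \<tau> ^ (n - 1)) * ennreal j"
    using \<rho> by (intro add_mono mult_left_mono energy) (auto simp: vol)
  also have "\<dots> = ennreal (\<tau> * (\<omega> * (3 * \<rho>) ^ n) + 1 / \<tau> ^ (n - 1) * j)"
    using lam om \<rho> j by (simp add: ennreal_mult'[symmetric] ennreal_plus[symmetric] del: ennreal_plus)
  finally have G: "(\<integral>\<^sup>+x\<in>?B. ennreal (?g x) \<partial>lborel) \<le> ennreal (\<tau> * (\<omega> * (3 * \<rho>) ^ n) + 1 / \<tau> ^ (n - 1) * j)" .
  have "ennreal (d * (\<omega> * (\<rho> / 2) ^ n) * (\<omega> * (\<rho> / 2) ^ n))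
      = ennreal d * ennreal (\<omega> * (\<rho> / 2) ^ n) * ennreal (\<omega> * (\<rho> / 2) ^ n)"
    using om \<rho> by (simp add: ennreal_mult'[symmetric] d_def)
  also have "\<dots> \<le> ennreal d * emeasure lborel (ball c1 r1) * emeasure lborel (ball c2 r2)"
    using r \<rho> om by (intro mult_mono) (auto simp: vol intro!: ennreal_leI mult_left_mono power_mono)
  also have "\<dots> \<le> ennreal (2 * \<rho>) * emeasure lborel (ball (0::'a) (2 * \<rho>)) * (\<integral>\<^sup>+x\<in>?B. ennreal (?g x) \<partial>lborel)"
    unfolding d_def using r \<rho> by (intro mean_value_compare[OF L] sub) auto
  also have "\<dots> \<le> ennreal (2 * \<rho>) * ennreal (\<omega> * (2 * \<rho>) ^ n) * ennreal (\<tau> * (\<omega> * (3 * \<rho>) ^ n) + 1 / \<tau> ^ (n - 1) * j)"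
    using \<rho> by (intro mult_mono G) (auto simp: vol)
  also have "\<dots> = ennreal (2 * \<rho> * (\<omega> * (2 * \<rho>) ^ n) * (\<tau> * (\<omega> * (3 * \<rho>) ^ n) + 1 / \<tau> ^ (n - 1) * j))"
    using \<rho> om lam j by (simp add: ennreal_mult'[symmetric] del: ennreal_plus)
  finally have A1: "d * (\<omega> * (\<rho> / 2) ^ n) * (\<omega> * (\<rho> / 2) ^ n) \<le> 2 * \<rho> * (\<omega> * (2 * \<rho>) ^ n) * (\<tau> * (\<omega> * (3 * \<rho>) ^ n) + 1 / \<tau> ^ (n - 1) * j)"
    using \<rho> om lam j by (subst (asm) ennreal_le_iff) auto
  have A2: "d * (\<omega> * (\<rho> / 2) ^ n) * (\<omega> * (\<rho> / 2) ^ n) = d * (\<omega> * \<omega> * (\<rho> ^ n * \<rho> ^ n) / 4 ^ n)"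
  proof -
    have "(2::real) ^ n * 2 ^ n = 4 ^ n" by (simp flip: power_mult_distrib)
    then show ?thesis by (simp add: power_divide)
  qed
  have A3: "2 * \<rho> * (\<omega> * (2 * \<rho>) ^ n) * (\<tau> * (\<omega> * (3 * \<rho>) ^ n) + 1 / \<tau> ^ (n - 1) * j)
      = 2 ^ (n + 1) * (3 ^ n * \<eta> + (1 / \<omega>) * (j / \<eta> ^ (n - 1))) * (\<omega> * \<omega> * (\<rho> ^ n * \<rho> ^ n))"
  proof -
    have a: "\<rho> * (1 / \<tau> ^ (n - 1)) = \<rho> ^ n / \<eta> ^ (n - 1)"
      unfolding \<tau>_def nS[of \<rho>] using \<rho> \<eta> by (simp add: power_divide)
    have b: "\<rho> * \<tau> = \<eta>" unfolding \<tau>_def using \<rho> by simp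
    have "2 * \<rho> * (\<omega> * (2 * \<rho>) ^ n) * (\<tau> * (\<omega> * (3 * \<rho>) ^ n) + 1 / \<tau> ^ (n - 1) * j)
       = 2 * 2 ^ n * \<omega> * \<rho> ^ n * ((\<rho> * \<tau>) * \<omega> * 3 ^ n * \<rho> ^ n + (\<rho> * (1 / \<tau> ^ (n - 1))) * j)"
      by (simp add: power_mult_distrib algebra_simps)
    also have "\<dots> = 2 ^ (n + 1) * (3 ^ n * \<eta> + (1 / \<omega>) * (j / \<eta> ^ (n - 1))) * (\<omega> * \<omega> * (\<rho> ^ n * \<rho> ^ n))"
      unfolding a b using om by (simp add: field_simps)
    finally show ?thesis .
  qed
  have "(d / 4 ^ n) * (\<omega> * \<omega> * (\<rho> ^ n * \<rho> ^ n)) \<le> 2 ^ (n + 1) * (3 ^ n * \<eta> + (1 / \<omega>) * (j / \<eta> ^ (n - 1))) * (\<omega> * \<omega> * (\<rho> ^ n * \<rho> ^ n))"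
    using A1[unfolded A2 A3] by (simp only: times_divide_eq_left times_divide_eq_right)
  then have "d / 4 ^ n \<le> 2 ^ (n + 1) * (3 ^ n * \<eta> + (1 / \<omega>) * (j / \<eta> ^ (n - 1)))"
    by (rule mult_right_le_imp_le) (use om \<rho> in simp)
  then have "d \<le> 2 ^ (n + 1) * 4 ^ n * (3 ^ n * \<eta> + (1 / \<omega>) * (j / \<eta> ^ (n - 1)))"
    by (simp add: field_simps)
  also have "\<dots> \<le> 2 ^ (n + 1) * 4 ^ n * ((3 ^ n + 1 / \<omega>) * (\<eta> + j / \<eta> ^ (n - 1)))"
  proof (rule mult_left_mono)
    have "0 \<le> 3 ^ n * (j / \<eta> ^ (n - 1)) + (1 / \<omega>) * \<eta>" using \<eta> j om by simp
    then show "3 ^ n * \<eta> + (1 / \<omega>) * (j / \<eta> ^ (n - 1)) \<le> (3 ^ n + 1 / \<omega>) * (\<eta> + j / \<eta> ^ (n - 1))"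
      by (simp add: algebra_simps)
  qed simp
  finally show ?thesis unfolding d_def chain_const_def \<omega>_def by (simp add: mult.assoc)
qed

text \<open>
  Averages over balls shrinking dyadically to \<open>p\<close>: the \<open>k\<close>-th step costs at most a multiple of \<open>\<theta> q\<^sup>k\<close>,
  by \<open>mean_value_compare_energy\<close> with \<open>\<eta> = \<theta> q\<^sup>k\<close>.
\<close>

lemma point_value_close_to_mean:
  fixes w :: "'a::euclidean_space \<Rightarrow> real"
  defines "n \<equiv> DIM('a)"
  defines "q \<equiv> root n (1 / 2)"
  assumes L: "L-lipschitz_on UNIV w" and R: "0 < R" and ap: "dist a p \<le> R" and \<theta>: "0 < \<theta>"
    and energy: "\<And>k. (\<integral>\<^sup>+x\<in>ball p (6 * R / 2 ^ k). ennreal (norm (weak_gradient w x) ^ n) \<partial>lborel) \<le> ennreal (\<theta> ^ n / 2 ^ k)"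
  shows "\<bar>w p - mean_value w (ball a R)\<bar> \<le> 2 * chain_const n * \<theta> / (1 - q)"
proof -
  have cw: "continuous_on UNIV w" using lipschitz_on_continuous_on[OF L] .
  have n1: "n > 0" unfolding n_def by simp
  have q: "0 < q" "q < 1" "q ^ n = 1 / 2"
    unfolding q_def using n1 by (auto simp: real_root_pow_pos2)
  \<comment> \<open>With \<open>q ^ n = 1 / 2\<close> the energy bound at scale \<open>k\<close> is
    the \<open>n\<close>-th power of \<open>\<theta> * q ^ k\<close>. Both terms of the comparison
    then coincide, and the errors form a geometric series.\<close>
  have qk: "(1 / 2) ^ k = (q ^ k) ^ n" for k
    by (simp only: q(3)[symmetric] power_mult[symmetric] mult.commute)
  define \<rho> where "\<rho> = (\<lambda>k::nat. 2 * R / 2 ^ k)"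
  \<comment> \<open>Only the initial ball is centred at \<open>a\<close>, so that all points
    \<open>p\<close> share the same first mean. It fits into \<open>ball p (2 * R)\<close>, whence
    the factor 2 in \<open>\<rho>\<close> and the radii \<open>6 * R / 2 ^ k\<close>, that is
    \<open>3 * \<rho> k\<close>, in the energy hypothesis.\<close>
  define W where "W = (\<lambda>k. if k = 0 then ball a R else ball p (\<rho> k))"
  define m where "m = (\<lambda>k. mean_value w (W k))"
  have rho: "\<rho> k > 0" "\<rho> (Suc k) = \<rho> k / 2" for k using R by (auto simp: \<rho>_def)
  have step: "\<bar>m k - m (Suc k)\<bar> \<le> 2 * chain_const n * \<theta> * q ^ k" for k
  proof -
    have e: "(\<integral>\<^sup>+x\<in>ball p (3 * \<rho> k). ennreal (norm (weak_gradient w x) ^ n) \<partial>lborel) \<le> ennreal (\<theta> ^ n / 2 ^ k)"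
      using energy[of k] by (simp add: \<rho>_def)
    obtain c r where cr: "W k = ball c r" "\<rho> k / 2 \<le> r" "ball c r \<subseteq> ball p (\<rho> k)"
    proof (cases "k = 0")
      case True
      have "ball a R \<subseteq> ball p (\<rho> 0)"
      proof
        fix x assume "x \<in> ball a R"
        then show "x \<in> ball p (\<rho> 0)" using ap dist_triangle[of p x a] by (auto simp: \<rho>_def dist_commute)
      qed
      then show ?thesis using True that[of a R] by (simp add: W_def \<rho>_def)
    next
      case False
      then show ?thesis using that[of p "\<rho> k"] rho(1)[of k] by (simp add: W_def)
    qed
    have "\<bar>m k - m (Suc k)\<bar> \<le> chain_const n * (\<theta> * q ^ k + (\<theta> ^ n / 2 ^ k) / (\<theta> * q ^ k) ^ (n - 1))"
      unfolding m_def cr(1) n_def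
    proof (simp only: W_def nat.distinct if_False, rule mean_value_compare_energy[OF L rho(1)[of k] cr(2) _ cr(3)])
      show "\<rho> k / 2 \<le> \<rho> (Suc k)" using rho[of k] by simp
      show "ball p (\<rho> (Suc k)) \<subseteq> ball p (\<rho> k)" using rho[of k] by (intro subset_ball) simp
      show "0 < \<theta> * q ^ k" "0 \<le> \<theta> ^ DIM('a) / 2 ^ k" using \<theta> q by auto
      show "(\<integral>\<^sup>+x\<in>ball p (3 * \<rho> k). ennreal (norm (weak_gradient w x) ^ DIM('a)) \<partial>lborel) \<le> ennreal (\<theta> ^ DIM('a) / 2 ^ k)"
        using e unfolding n_def .
    qed
    also have "(\<theta> ^ n / 2 ^ k) / (\<theta> * q ^ k) ^ (n - 1) = \<theta> * q ^ k"
    proof -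
      have "\<theta> ^ n / 2 ^ k = \<theta> ^ n * (1 / 2) ^ k" by (simp add: power_one_over field_simps)
      also have "\<dots> = (\<theta> * q ^ k) ^ n" unfolding qk by (simp add: power_mult_distrib)
      also have "\<dots> = (\<theta> * q ^ k) * (\<theta> * q ^ k) ^ (n - 1)" using n1 by (cases n) auto
      finally show ?thesis using \<theta> q by simp
    qed
    finally show ?thesis by (simp add: algebra_simps)
  qed
  have dist: "\<bar>m 0 - m k\<bar> \<le> 2 * chain_const n * \<theta> / (1 - q)" for k
  proof -
    have "m 0 - m k = (\<Sum>i<k. m i - m (Suc i))" by (rule sum_lessThan_telescope'[symmetric])
    also have "\<bar>\<dots>\<bar> \<le> (\<Sum>i<k. \<bar>m i - m (Suc i)\<bar>)" by (rule sum_abs)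
    also have "\<dots> \<le> (\<Sum>i<k. 2 * chain_const n * \<theta> * q ^ i)" by (intro sum_mono step)
    also have "\<dots> = 2 * chain_const n * \<theta> * (\<Sum>i<k. q ^ i)" by (simp add: sum_distrib_left)
    also have "(\<Sum>i<k. q ^ i) \<le> (\<Sum>i. q ^ i)"
      using q by (intro sum_le_suminf summable_geometric) auto
    also have "(\<Sum>i. q ^ i) = 1 / (1 - q)" using q by (intro suminf_geometric) auto
    finally show ?thesis using chain_const_pos[of n] \<theta> by simp
  qed
  \<comment> \<open>The Lipschitz constant ensures that the means converge to \<open>w p\<close>,
    without affecting the final bound.\<close>
  have conv: "\<bar>m (Suc k) - w p\<bar> \<le> L * \<rho> (Suc k)" for k
  proof -
    let ?B = "ball p (\<rho> (Suc k))"
    have em: "emeasure lborel ?B = ennreal (measure lborel ?B)"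
      using emeasure_lborel_ball_finite[of p "\<rho> (Suc k)"] by (simp add: emeasure_eq_ennreal_measure top.not_eq_extremum)
    have pos: "measure lborel ?B > 0" using rho(1) by (simp add: content_ball_pos)
    have Lr: "0 \<le> L * \<rho> (Suc k)" using lipschitz_on_nonneg[OF L] rho(1)[of "Suc k"] by simp
    have "ennreal \<bar>m (Suc k) - w p\<bar> * emeasure lborel ?B \<le> (\<integral>\<^sup>+x\<in>?B. ennreal \<bar>w x - w p\<bar> \<partial>lborel)"
      unfolding m_def W_def using mean_value_diff_le[OF cw rho(1)] by simp
    also have "\<dots> \<le> (\<integral>\<^sup>+x. ennreal (L * \<rho> (Suc k)) * indicator ?B x \<partial>lborel)"
    proof (rule nn_integral_mono)
      fix x
      have "\<bar>w x - w p\<bar> \<le> L * \<rho> (Suc k)" if "x \<in> ?B"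
      proof -
        have "\<bar>w x - w p\<bar> \<le> L * dist x p"
          using lipschitz_onD[OF L, of x p] by (simp add: dist_real_def)
        also have "\<dots> \<le> L * \<rho> (Suc k)"
          using that lipschitz_on_nonneg[OF L] by (intro mult_left_mono) (auto simp: dist_commute)
        finally show ?thesis .
      qed
      then show "ennreal \<bar>w x - w p\<bar> * indicator ?B x \<le> ennreal (L * \<rho> (Suc k)) * indicator ?B x"
        by (auto simp: indicator_def intro!: ennreal_leI)
    qed
    also have "\<dots> = ennreal (L * \<rho> (Suc k)) * emeasure lborel ?B"
      by (rule nn_integral_cmult_indicator) simp
    finally have "\<bar>m (Suc k) - w p\<bar> * measure lborel ?B \<le> L * \<rho> (Suc k) * measure lborel ?B"
      unfolding em using Lr pos by (simp add: ennreal_mult'[symmetric])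
    then show ?thesis using pos by simp
  qed
  have "(\<lambda>k. 1 / 2 ^ Suc k :: real) \<longlonglongrightarrow> 0"
    using LIMSEQ_Suc[OF LIMSEQ_realpow_zero[of "1 / 2"]] by (simp add: power_one_over)
  from tendsto_mult_left[OF this, of "L * (2 * R)"]
  have "(\<lambda>k. L * \<rho> (Suc k)) \<longlonglongrightarrow> 0" by (simp add: \<rho>_def)
  then have "(\<lambda>k. m (Suc k) - w p) \<longlonglongrightarrow> 0"
    by (rule Lim_null_comparison[rotated]) (use conv in auto)
  then have "(\<lambda>k. m (Suc k)) \<longlonglongrightarrow> w p" by (rule LIM_zero_cancel)
  then have "(\<lambda>k. \<bar>m 0 - m (Suc k)\<bar>) \<longlonglongrightarrow> \<bar>m 0 - w p\<bar>" by (intro tendsto_intros)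
  then have "\<bar>m 0 - w p\<bar> \<le> 2 * chain_const n * \<theta> / (1 - q)"
    by (rule tendsto_upperbound) (use dist in auto)
  then show ?thesis unfolding m_def W_def by (simp add: abs_minus_commute)
qed

section \<open>Energy carried by a continuum\<close>

lemma connected_dist_image:
  assumes S: "connected S" "a \<in> S" "b \<in> S" and t: "0 \<le> t" "t \<le> dist a b"
  shows "\<exists>x\<in>S. dist a x = t"
proof -
  have "connected (dist a ` S)"
    by (intro connected_continuous_image S continuous_intros)
  moreover have "0 \<in> dist a ` S" "dist a b \<in> dist a ` S" using S by force+
  ultimately have "t \<in> dist a ` S" using t connectedD_interval by blast
  then show ?thesis by auto
qed

text \<open>The distance from \<open>a\<close> maps \<open>S\<close> onto a set containing
  \<open>[0, s]\<close>. Vitali's covering lemma picks disjoint balls whose fivefold enlargements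
  cover \<open>P\<close>; their shadows \<open>J p\<close>, of length \<open>10 * r p\<close>, cover
  \<open>[0, s / 2]\<close>, so the radii sum to at least \<open>s / 20\<close>. Disjointness adds
  up the energies.\<close>

lemma energy_of_concentrated_continuum:
  fixes g :: "'a::euclidean_space \<Rightarrow> ennreal"
  assumes [measurable]: "g \<in> borel_measurable borel"
    and S: "connected S" "a \<in> S" "b \<in> S" and s: "0 < s" "s \<le> dist a b" and \<tau>: "0 < \<tau>"
    and conc: "\<And>p. p \<in> S \<Longrightarrow> dist a p < s \<Longrightarrow>
      \<exists>r. 0 < r \<and> r \<le> B \<and> ennreal (\<tau> * r) \<le> (\<integral>\<^sup>+x\<in>ball p r. g x \<partial>lborel)"
  shows "ennreal (\<tau> * s / 20) \<le> (\<integral>\<^sup>+x. g x \<partial>lborel)"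
proof -
  have [measurable]: "ball c r \<in> sets borel" for c :: 'a and r by simp
  define P where "P = {p \<in> S. dist a p < s}"
  have "\<forall>p\<in>P. \<exists>r. 0 < r \<and> r \<le> B \<and> ennreal (\<tau> * r) \<le> (\<integral>\<^sup>+x\<in>ball p r. g x \<partial>lborel)"
    unfolding P_def using conc by simp
  then obtain r where "\<forall>p\<in>P. 0 < r p \<and> r p \<le> B \<and> ennreal (\<tau> * r p) \<le> (\<integral>\<^sup>+x\<in>ball p (r p). g x \<partial>lborel)"
    by (rule bchoice[THEN exE])
  then have r: "\<And>p. p \<in> P \<Longrightarrow> 0 < r p" "\<And>p. p \<in> P \<Longrightarrow> r p \<le> B"
    "\<And>p. p \<in> P \<Longrightarrow> ennreal (\<tau> * r p) \<le> (\<integral>\<^sup>+x\<in>ball p (r p). g x \<partial>lborel)"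
    by simp_all
  have cov: "P \<subseteq> (\<Union>p\<in>P. ball p (r p))" using centre_in_ball r(1) by blast
  obtain C where C: "countable C" "C \<subseteq> P"
     "pairwise (\<lambda>i j. disjnt (ball i (r i)) (ball j (r j))) C"
     "P \<subseteq> (\<Union>i\<in>C. ball i (5 * r i))"
    by (rule Vitali_covering_lemma_balls[OF cov, of B]) (use r(1,2) in auto)
  define J where "J = (\<lambda>p. {dist a p - 5 * r p<..<dist a p + 5 * r p})"
  \<comment> \<open>Stopping at \<open>s / 2\<close> keeps the points strictly within distance
    \<open>s\<close> of \<open>a\<close>, and compactness of the interval reduces the cover to a
    finite one.\<close>
  have "{0..s / 2} \<subseteq> (\<Union>p\<in>C. J p)"
  proof
    fix t assume t: "t \<in> {0..s / 2}"
    obtain x where x: "x \<in> S" "dist a x = t" using connected_dist_image[OF S, of t] t s by auto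
    then have "x \<in> P" using t s by (auto simp: P_def)
    then obtain p where p: "p \<in> C" "dist p x < 5 * r p" using C(4) by auto
    have "\<bar>dist a x - dist a p\<bar> \<le> dist p x"
      using dist_triangle[of a x p] dist_triangle[of a p x] by (simp add: dist_commute abs_le_iff)
    then have "t \<in> J p" using p x by (auto simp: J_def)
    then show "t \<in> (\<Union>p\<in>C. J p)" using p by blast
  qed
  then obtain F where F: "F \<subseteq> C" "finite F" "{0..s / 2} \<subseteq> (\<Union>p\<in>F. J p)"
    using compactE_image[OF compact_Icc, of C J 0 "s / 2"] by (auto simp: J_def)
  have rF: "0 < r p" "ennreal (\<tau> * r p) \<le> (\<integral>\<^sup>+x\<in>ball p (r p). g x \<partial>lborel)" if "p \<in> F" for p
    using r(1,3)[of p] that F(1) C(2) by auto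
  have "ennreal (s / 2) = emeasure lborel {0..s / 2}" using s by simp
  also have "\<dots> \<le> emeasure lborel (\<Union>p\<in>F. J p)"
    using F by (intro emeasure_mono) (auto simp: J_def)
  also have "\<dots> \<le> (\<Sum>p\<in>F. emeasure lborel (J p))"
    using F by (intro emeasure_subadditive_finite) (auto simp: J_def)
  also have "\<dots> = (\<Sum>p\<in>F. ennreal (10 * r p))"
    by (rule sum.cong) (use rF(1) in \<open>auto simp: J_def less_imp_le\<close>)
  also have "\<dots> = ennreal (\<Sum>p\<in>F. 10 * r p)" using rF(1) by (intro sum_ennreal) (simp add: less_imp_le)
  finally have "s / 2 \<le> (\<Sum>p\<in>F. 10 * r p)"
    using rF(1) by (subst (asm) ennreal_le_iff) (auto intro!: sum_nonneg simp: less_imp_le)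
  then have "s / 20 \<le> (\<Sum>p\<in>F. r p)" by (simp add: sum_distrib_left[symmetric])
  then have "\<tau> * (s / 20) \<le> \<tau> * (\<Sum>p\<in>F. r p)" using \<tau> by (intro mult_left_mono) auto
  then have "ennreal (\<tau> * s / 20) \<le> ennreal (\<Sum>p\<in>F. \<tau> * r p)"
    by (intro ennreal_leI) (simp add: sum_distrib_left)
  also have "\<dots> = (\<Sum>p\<in>F. ennreal (\<tau> * r p))"
    using rF(1) \<tau> by (intro sum_ennreal[symmetric]) (simp add: less_imp_le)
  also have "\<dots> \<le> (\<Sum>p\<in>F. \<integral>\<^sup>+x\<in>ball p (r p). g x \<partial>lborel)" by (intro sum_mono rF)
  also have "\<dots> = (\<integral>\<^sup>+x. (\<Sum>p\<in>F. g x * indicator (ball p (r p)) x) \<partial>lborel)"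
    by (rule nn_integral_sum[symmetric]) measurable
  also have "\<dots> \<le> (\<integral>\<^sup>+x. g x \<partial>lborel)"
  proof (rule nn_integral_mono)
    fix x
    show "(\<Sum>p\<in>F. g x * indicator (ball p (r p)) x) \<le> g x"
    proof (cases "\<exists>p\<in>F. x \<in> ball p (r p)")
      case True
      then obtain p where p: "p \<in> F" "x \<in> ball p (r p)" by blast
      have "x \<notin> ball i (r i)" if "i \<in> F - {p}" for i
        using C(3) F(1) p that unfolding pairwise_def disjnt_def by blast
      then have "(\<Sum>i\<in>F. g x * indicator (ball i (r i)) x) = (\<Sum>i\<in>{p}. g x * indicator (ball i (r i)) x)"
        using p F(2) by (intro sum.mono_neutral_right) (auto simp: indicator_def)
      also have "\<dots> = g x * indicator (ball p (r p)) x"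
      proof -
        have "(\<Sum>i\<in>{p}. h i) = h p" for h :: "'a \<Rightarrow> ennreal" by simp
        then show ?thesis .
      qed
      also have "\<dots> = g x" using p(2) by simp
      finally show ?thesis by simp
    next
      case False
      then have "(\<Sum>i\<in>F. g x * indicator (ball i (r i)) x) = 0"
        by (intro sum.neutral) (auto simp: indicator_def)
      then show ?thesis by simp
    qed
  qed
  finally show ?thesis .
qed

text \<open>
  The average of \<open>w\<close> over a large ball differs from one of the values 0, 1 by at least \<open>1 / 2\<close>; each
  point of the corresponding continuum is then the centre of a ball carrying energy proportional
  to its radius, and a Vitali covering sums these up to the length of the continuum.
\<close>

theorem loewner_lower_bound:
  fixes M :: real
  assumes M: "0 \<le> M"
  obtains c where "0 < c"
    "\<And>(w :: 'a::euclidean_space \<Rightarrow> real) L A B a a' b b' s.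
      L-lipschitz_on UNIV w \<Longrightarrow> connected A \<Longrightarrow> connected B \<Longrightarrow> a \<in> A \<Longrightarrow> a' \<in> A \<Longrightarrow> b \<in> B \<Longrightarrow> b' \<in> B \<Longrightarrow>
      0 < s \<Longrightarrow> s \<le> dist a a' \<Longrightarrow> s \<le> dist b b' \<Longrightarrow> dist a b \<le> M * s \<Longrightarrow>
      (\<And>x. x \<in> A \<Longrightarrow> w x = 1) \<Longrightarrow> (\<And>x. x \<in> B \<Longrightarrow> w x = 0) \<Longrightarrow>
      ennreal c \<le> (\<integral>\<^sup>+x. ennreal (norm (weak_gradient w x) ^ DIM('a)) \<partial>lborel)"
proof -
  define n where "n = DIM('a)"
  define q where "q = root n (1 / 2)"
  have n1: "n > 0" unfolding n_def by simp
  have q: "0 < q" "q < 1" unfolding q_def using n1 by auto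
  \<comment> \<open>Makes the deviation of a point value from the mean at most \<open>1 / 4\<close>,
    below the gap \<open>1 / 2\<close> present on one of the continua.\<close>
  define \<theta> where "\<theta> = (1 - q) / (8 * chain_const n)"
  have \<theta>: "\<theta> > 0" "2 * chain_const n * \<theta> / (1 - q) = 1 / 4"
    using q chain_const_pos[of n] by (auto simp: \<theta>_def field_simps)
  define c where "c = \<theta> ^ n / (120 * (M + 1))"
  have c: "c > 0" using \<theta> M by (auto simp: c_def)
  show thesis
  proof (rule that[OF c])
    fix w :: "'a \<Rightarrow> real" and L A B a a' b b' s
    assume L: "L-lipschitz_on UNIV w" and conn: "connected A" "connected B" and ab: "a \<in> A" "a' \<in> A" "b \<in> B" "b' \<in> B"
      and s: "0 < s" "s \<le> dist a a'" "s \<le> dist b b'" "dist a b \<le> M * s"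
      and w1: "\<And>x. x \<in> A \<Longrightarrow> w x = 1" and w0: "\<And>x. x \<in> B \<Longrightarrow> w x = 0"
    have cw: "continuous_on UNIV w" using lipschitz_on_continuous_on[OF L] .
    define g where "g = (\<lambda>x. ennreal (norm (weak_gradient w x) ^ n))"
    have gm: "g \<in> borel_measurable borel" unfolding g_def using weak_gradient_borel[OF cw] by measurable
    \<comment> \<open>One ball about \<open>a\<close> serves both continua: points within
      \<open>s\<close> of \<open>b\<close> are within \<open>(M + 1) * s\<close> of
      \<open>a\<close>. As \<open>R\<close> is a multiple of \<open>s\<close>, the scale cancels in
      \<open>c\<close>.\<close>
    define R where "R = (M + 1) * s"
    have R: "R > 0" using M s by (simp add: R_def)
    define m where "m = mean_value w (ball a R)"
    \<comment> \<open>If all balls about \<open>p\<close> of radius up to \<open>6 * R\<close>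
      carried too little energy, the radii \<open>6 * R / 2 ^ k\<close> would meet exactly the
      hypothesis of the dyadic chain.\<close>
    have conc: "\<exists>r. 0 < r \<and> r \<le> 6 * R \<and> ennreal (\<theta> ^ n / (6 * R) * r) \<le> (\<integral>\<^sup>+x\<in>ball p r. g x \<partial>lborel)"
      if p: "dist a p \<le> R" "1 / 2 \<le> \<bar>w p - m\<bar>" for p
    proof (rule ccontr)
      assume no: "\<not> ?thesis"
      have "(\<integral>\<^sup>+x\<in>ball p (6 * R / 2 ^ k). g x \<partial>lborel) \<le> ennreal (\<theta> ^ n / 2 ^ k)" for k
      proof -
        have "6 * R / 2 ^ k \<le> 6 * R" using R by (simp add: divide_le_eq)
        then have "\<not> ennreal (\<theta> ^ n / (6 * R) * (6 * R / 2 ^ k)) \<le> (\<integral>\<^sup>+x\<in>ball p (6 * R / 2 ^ k). g x \<partial>lborel)"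
          using no R by (metis divide_pos_pos mult_pos_pos zero_less_numeral zero_less_power)
        then show ?thesis using R by simp
      qed
      from point_value_close_to_mean[OF L R p(1) \<theta>(1) this[unfolded g_def n_def]]
      have "\<bar>w p - m\<bar> \<le> 1 / 4" using \<theta>(2) unfolding m_def n_def q_def by simp
      then show False using p(2) by simp
    qed
    have c_eq: "c = \<theta> ^ n / (6 * R) * s / 20"
    proof -
      have "T / (6 * (K * s)) * s / 20 = T / (120 * K)" for T K :: real
        using s(1) by simp
      then show ?thesis by (simp only: c_def R_def)
    qed
    have "ennreal (\<theta> ^ n / (6 * R) * s / 20) \<le> (\<integral>\<^sup>+x. g x \<partial>lborel)"
    proof (cases "m \<le> 1 / 2")
      case True
      show ?thesis
      proof (rule energy_of_concentrated_continuum[OF gm conn(1) ab(1,2) s(1,2)])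
        show "0 < \<theta> ^ n / (6 * R)" using \<theta> R by simp
        fix p assume p: "p \<in> A" "dist a p < s"
        have "s \<le> R" using s(1) M by (simp add: R_def)
        then show "\<exists>r. 0 < r \<and> r \<le> 6 * R \<and> ennreal (\<theta> ^ n / (6 * R) * r) \<le> (\<integral>\<^sup>+x\<in>ball p r. g x \<partial>lborel)"
          using p True by (intro conc) (auto simp: w1)
      qed
    next
      case False
      show ?thesis
      proof (rule energy_of_concentrated_continuum[OF gm conn(2) ab(3,4) s(1,3)])
        show "0 < \<theta> ^ n / (6 * R)" using \<theta> R by simp
        fix p assume p: "p \<in> B" "dist b p < s"
        have "dist a p \<le> R" using s(4) p(2) dist_triangle[of a p b] by (simp add: R_def algebra_simps)
        then show "\<exists>r. 0 < r \<and> r \<le> 6 * R \<and> ennreal (\<theta> ^ n / (6 * R) * r) \<le> (\<integral>\<^sup>+x\<in>ball p r. g x \<partial>lborel)"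
          using p False by (intro conc) (auto simp: w0)
      qed
    qed
    then show "ennreal c \<le> (\<integral>\<^sup>+x. ennreal (norm (weak_gradient w x) ^ DIM('a)) \<partial>lborel)"
      unfolding c_eq g_def n_def .
  qed
qed

section \<open>Capacity of rings and truncated test functions\<close>

lemma GDERIV_unique:
  assumes "GDERIV v x :> D" "GDERIV v x :> D'"
  shows "D = D'"
proof -
  have "(\<lambda>h. h \<bullet> D) = (\<lambda>h. h \<bullet> D')"
    using assms unfolding gderiv_def by (rule has_derivative_unique)
  then have "(D - D') \<bullet> D = (D - D') \<bullet> D'" by (rule fun_cong)
  then have "(D - D') \<bullet> (D - D') = 0" by (simp add: inner_diff_right)
  then show ?thesis by simp
qed

lemma gradient_eq:
  assumes "GDERIV v x :> D"
  shows "gradient v x = D"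
proof -
  have "(THE D. GDERIV v x :> D) = D"
    using assms by (rule the_equality) (erule GDERIV_unique[OF _ assms])
  then show ?thesis using assms by (auto simp: gradient_def)
qed

text \<open>Rademacher's theorem enters the capacity here: the integral is unchanged under almost
  everywhere equality, so the Borel representative can replace the pointwise gradient.\<close>

lemma gradient_energy_eq_weak:
  fixes w :: "real ^ 'n \<Rightarrow> real"
  assumes L: "L-lipschitz_on UNIV w"
  shows "(\<integral>\<^sup>+x. ennreal (norm (weak_gradient w x) ^ k) \<partial>lborel) = (\<integral>\<^sup>+x. ennreal (norm (gradient w x) ^ k) \<partial>lebesgue)"
proof -
  have gm: "weak_gradient w \<in> borel_measurable borel"
    by (rule weak_gradient_borel[OF lipschitz_on_continuous_on[OF L]])
  have "AE x in lborel. gradient w x = weak_gradient w x"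
    using rademacher[OF L] by eventually_elim (simp add: gradient_eq weak_gradient_def)
  then have "AE x in lebesgue. gradient w x = weak_gradient w x" by (rule AE_completion)
  then have "(\<integral>\<^sup>+x. ennreal (norm (gradient w x) ^ k) \<partial>lebesgue) = (\<integral>\<^sup>+x. ennreal (norm (weak_gradient w x) ^ k) \<partial>lebesgue)"
    by (intro nn_integral_cong_AE) (auto elim: eventually_mono)
  also have "\<dots> = (\<integral>\<^sup>+x. ennreal (norm (weak_gradient w x) ^ k) \<partial>lborel)"
    using gm by (intro nn_integral_completion) measurable
  finally show ?thesis ..
qed

text \<open>Where the gradient exists, a small step from \<open>x\<close> in its own direction
  realizes its norm as a slope; elsewhere it has the default value 0.\<close>

lemma norm_gradient_le:
  assumes ev: "\<forall>\<^sub>F z in nhds x. \<bar>v z - v x\<bar> \<le> K * norm (z - x)" and K: "0 \<le> K"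
  shows "norm (gradient v x) \<le> K"
proof (cases "\<exists>D. GDERIV v x :> D")
  case True
  then obtain D where D: "GDERIV v x :> D" by blast
  have "norm D \<le> K"
  proof (rule field_le_epsilon)
    fix e :: real assume e: "e > 0"
    obtain d where d: "d > 0" "\<And>y. norm (y - x) < d \<Longrightarrow> norm (v y - v x - (y - x) \<bullet> D) \<le> e * norm (y - x)"
      using D e unfolding gderiv_def has_derivative_at_alt by meson
    obtain d' where d': "d' > 0" "\<And>y. dist y x < d' \<Longrightarrow> \<bar>v y - v x\<bar> \<le> K * norm (y - x)"
      using ev unfolding eventually_nhds_metric by blast
    show "norm D \<le> K + e"
    proof (cases "D = 0")
      case False
      define t where "t = min d d' / (2 * norm D)"
      have t: "t > 0" "t * norm D < d" "t * norm D < d'"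
        using d(1) d'(1) False by (auto simp: t_def)
      define y where "y = x + t *\<^sub>R D"
      have yx: "y - x = t *\<^sub>R D" by (simp add: y_def)
      have n: "norm (y - x) = t * norm D" unfolding yx using t by simp
      have "\<bar>v y - v x - (y - x) \<bullet> D\<bar> \<le> e * (t * norm D)"
        using d(2)[of y] n t by simp
      moreover have "\<bar>v y - v x\<bar> \<le> K * (t * norm D)"
        using d'(2)[of y] n t by (simp add: dist_norm)
      ultimately have "(y - x) \<bullet> D \<le> (K + e) * (t * norm D)" by (simp add: distrib_right)
      moreover have "(y - x) \<bullet> D = norm D * (t * norm D)"
        unfolding yx by (simp add: dot_square_norm power2_eq_square)
      ultimately have "norm D * (t * norm D) \<le> (K + e) * (t * norm D)" by simp
      then show ?thesis by (rule mult_right_le_imp_le) (use t False in simp)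
    qed (use K e in simp)
  qed
  then show ?thesis using gradient_eq[OF D] by simp
qed (use K in \<open>simp add: gradient_def\<close>)

lemma gradient_cong_ev:
  fixes v w :: "real ^ 'n \<Rightarrow> real"
  assumes "\<forall>\<^sub>F z in nhds x. v z = w z"
  shows "gradient v x = gradient w x"
proof -
  have *: "GDERIV g x :> D" if "GDERIV f x :> D" "\<forall>\<^sub>F z in nhds x. f z = g z" for f g :: "real ^ 'n \<Rightarrow> real" and D
    using that(1) unfolding gderiv_def
    by (rule has_derivative_transform_eventually)
      (use that(2) eventually_nhds_x_imp_x[OF that(2)] in \<open>auto simp: eventually_nhds_conv_at\<close>)
  have "\<forall>\<^sub>F z in nhds x. w z = v z" using assms by eventually_elim simp
  then have "GDERIV v x :> D \<longleftrightarrow> GDERIV w x :> D" for D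
    using * assms by blast
  then have "gderiv v x = gderiv w x" by (intro ext)
  then show ?thesis by (simp add: gradient_def)
qed

text \<open>Fermat's rule where the function is differentiable, the default value 0 elsewhere;
  estimates built on this hold at every point, not just almost everywhere.\<close>

lemma gradient_zero_at_local_min:
  assumes "\<forall>\<^sub>F z in nhds x. v x \<le> v z"
  shows "gradient v x = 0"
proof (cases "\<exists>D. GDERIV v x :> D")
  case True
  then obtain D where D: "GDERIV v x :> D" by blast
  have "\<forall>\<^sub>F z in at x. v x \<le> v z" using assms by (simp add: eventually_nhds_conv_at)
  from has_derivative_local_min[OF D[unfolded gderiv_def] this]
  have "D \<bullet> D = 0" by (metis)
  then show ?thesis using gradient_eq[OF D] by simp
qed (simp add: gradient_def)

lemma gradient_zero_at_local_max:
  assumes "\<forall>\<^sub>F z in nhds x. v z \<le> v x"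
  shows "gradient v x = 0"
proof (cases "\<exists>D. GDERIV v x :> D")
  case True
  then obtain D where D: "GDERIV v x :> D" by blast
  have "\<forall>\<^sub>F z in at x. v z \<le> v x" using assms by (simp add: eventually_nhds_conv_at)
  from has_derivative_local_max[OF D[unfolded gderiv_def] this]
  have "D \<bullet> D = 0" by (metis)
  then show ?thesis using gradient_eq[OF D] by simp
qed (simp add: gradient_def)

text \<open>An admissible function is Lipschitz only on the closure of its domain, while the Loewner
  bound concerns functions on the whole space. The cut at 1 and the value 0 outside \<open>U\<close>
  are extreme values, which controls the gradient where the pieces meet.\<close>

definition truncated_extension :: "'a set \<Rightarrow> ('a \<Rightarrow> real) \<Rightarrow> 'a \<Rightarrow> real" where
  "truncated_extension U v x = (if x \<in> U then min (v x) 1 else 0)"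

text \<open>A segment leaving \<open>U\<close> meets the frontier, where \<open>v\<close> vanishes;
  comparison with that point preserves the Lipschitz constant.\<close>

lemma lipschitz_truncated_extension:
  fixes v :: "'a::euclidean_space \<Rightarrow> real"
  assumes L: "L-lipschitz_on (closure U) v" and nonneg: "\<And>x. x \<in> U \<Longrightarrow> 0 \<le> v x"
    and zero: "\<And>x. x \<in> frontier U \<Longrightarrow> v x = 0"
  shows "L-lipschitz_on UNIV (truncated_extension U v)"
proof (rule lipschitz_onI)
  let ?w = "truncated_extension U v"
  show L0: "L \<ge> 0" by (rule lipschitz_on_nonneg[OF L])
  have cross: "?w x \<le> L * dist x y" if x: "x \<in> U" and y: "y \<notin> U" for x y
  proof -
    have "closed_segment x y \<inter> frontier U \<noteq> {}"
      using x y by (intro connected_Int_frontier) auto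
    then obtain z where z: "z \<in> closed_segment x y" "z \<in> frontier U" by blast
    have "?w x \<le> \<bar>v x - v z\<bar>" using x zero[OF z(2)] by (auto simp: truncated_extension_def)
    also have "\<dots> \<le> L * dist x z"
      using lipschitz_onD[OF L, of x z] x z closure_subset[of U]
      by (auto simp: dist_real_def frontier_def)
    also have "dist x z \<le> dist x y" using dist_in_closed_segment[OF z(1)] by (simp add: dist_commute)
    finally show ?thesis using L0 by (simp add: mult_left_mono)
  qed
  have pos: "0 \<le> ?w x" for x using nonneg by (auto simp: truncated_extension_def)
  fix x y
  consider "x \<in> U" "y \<in> U" | "x \<in> U" "y \<notin> U" | "x \<notin> U" "y \<in> U" | "x \<notin> U" "y \<notin> U" by blast
  then show "dist (?w x) (?w y) \<le> L * dist x y"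
  proof cases
    case 1
    then have "dist (?w x) (?w y) \<le> \<bar>v x - v y\<bar>" by (auto simp: truncated_extension_def dist_real_def)
    also have "\<dots> \<le> L * dist x y"
      using lipschitz_onD[OF L, of x y] 1 closure_subset[of U] by (auto simp: dist_real_def)
    finally show ?thesis .
  next
    case 2
    then show ?thesis using cross[of x y] pos[of x] by (simp add: dist_real_def truncated_extension_def)
  next
    case 3
    then show ?thesis using cross[of y x] pos[of y] by (simp add: dist_real_def truncated_extension_def dist_commute)
  next
    case 4
    then show ?thesis using L0 by (simp add: truncated_extension_def)
  qed
qed

text \<open>True even at the seams: where the extension equals 1 it has a global maximum and outside
  \<open>U\<close> a global minimum, so its gradient vanishes; at the remaining points it agrees
  with \<open>v\<close> nearby.\<close>

lemma norm_gradient_truncated_extension_le: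
  fixes v :: "real ^ 'n \<Rightarrow> real"
  assumes U: "open U" and nonneg: "\<And>x. x \<in> U \<Longrightarrow> 0 \<le> v x" and cont: "continuous_on U v"
  shows "norm (gradient (truncated_extension U v) x) \<le> (if x \<in> U then norm (gradient v x) else 0)"
proof (cases "x \<in> U")
  case True
  have ev: "\<forall>\<^sub>F z in nhds x. z \<in> U" using U True by (rule eventually_nhds_in_open)
  show ?thesis
  proof (cases "v x < 1")
    case less: True
    have "isCont v x" using cont U True by (simp add: continuous_on_eq_continuous_at)
    then have "\<forall>\<^sub>F z in nhds x. v z < 1"
      using less by (simp add: isCont_def order_tendstoD eventually_nhds_conv_at)
    with ev have "\<forall>\<^sub>F z in nhds x. truncated_extension U v z = v z"
      by eventually_elim (simp add: truncated_extension_def)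
    from gradient_cong_ev[OF this] show ?thesis using True by simp
  next
    case False
    have "gradient (truncated_extension U v) x = 0"
      using True False by (intro gradient_zero_at_local_max always_eventually) (auto simp: truncated_extension_def)
    then show ?thesis by simp
  qed
next
  case False
  have "gradient (truncated_extension U v) x = 0"
    using False nonneg by (intro gradient_zero_at_local_min always_eventually) (auto simp: truncated_extension_def)
  then show ?thesis using False by simp
qed

section \<open>The logarithmic test function of a ring\<close>

lemma abs_ln_diff_le:
  fixes a b c :: real
  assumes "0 < c" "c \<le> a" "c \<le> b"
  shows "\<bar>ln a - ln b\<bar> \<le> \<bar>a - b\<bar> / c"
proof -
  have *: "ln s - ln t \<le> \<bar>s - t\<bar> / c" if "c \<le> s" "c \<le> t" for s t
  proof -
    have "ln s - ln t \<le> (s - t) / t" using that assms by (intro ln_diff_le) auto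
    also have "\<dots> \<le> \<bar>s - t\<bar> / t" using that assms by (intro divide_right_mono) auto
    also have "\<dots> \<le> \<bar>s - t\<bar> / c" using that assms by (intro divide_left_mono) auto
    finally show ?thesis .
  qed
  show ?thesis using *[of a b] *[of b a] assms by (simp add: abs_le_iff abs_minus_commute)
qed

lemma dyadic_scale:
  fixes r t :: real
  assumes "r / 2 ^ N \<le> t" "t \<le> r" "0 < r"
  obtains j where "j \<le> N" "t \<le> r / 2 ^ j" "r / 2 ^ Suc j \<le> t"
proof -
  define j where "j = Max {j. j \<le> N \<and> t \<le> r / 2 ^ j}"
  have fin: "finite {j. j \<le> N \<and> t \<le> r / 2 ^ j}" by simp
  have "0 \<in> {j. j \<le> N \<and> t \<le> r / 2 ^ j}" using assms by simp
  then have j: "j \<in> {j. j \<le> N \<and> t \<le> r / 2 ^ j}" unfolding j_def using fin by (metis Max_in empty_iff)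
  have "r / 2 ^ Suc j \<le> t"
  proof (cases "j = N")
    case True
    have "r / 2 ^ Suc N \<le> r / 2 ^ N" using assms by (intro divide_left_mono) auto
    then show ?thesis unfolding True by (rule order_trans[OF _ assms(1)])
  next
    case False
    have "Suc j \<notin> {j. j \<le> N \<and> t \<le> r / 2 ^ j}"
      using Max_ge[OF fin, of "Suc j"] unfolding j_def[symmetric] by auto
    then show ?thesis using False j by auto
  qed
  then show ?thesis using that j by blast
qed

text \<open>The test function is logarithmic in the distance from \<open>y\<close>.\<close>

lemma conformal_capacity_ring_le:
  fixes y :: "real ^ 'n"
  defines "n \<equiv> CARD('n)"
  assumes n2: "2 \<le> n" and N: "0 < N" and r: "0 < r"
  shows "conformal_capacity (sphere y r) (cball y (r / 2 ^ N)) \<Omega>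
    \<le> ennreal (2 * 8 ^ n * unit_ball_vol (real n) / real N)"
proof -
  define \<delta> where "\<delta> = r / 2 ^ N"
  have \<delta>: "0 < \<delta>" "\<delta> \<le> r" using r by (auto simp: \<delta>_def divide_le_eq)
  define l where "l = (\<lambda>x. ln (max (dist y x) \<delta>))"
  \<comment> \<open>\<open>real N * ln 2\<close> is \<open>ln (r / \<delta>)\<close>, so
    \<open>v\<close> falls from 1 to 0 across the ring; the two uses of \<open>max\<close> keep it
    constant on either side.\<close>
  define v where "v = (\<lambda>x. max 0 ((ln r - l x) / (real N * ln 2)))"
  have N2: "real N * ln 2 > 0" using N by simp
  have vdiff: "\<bar>v x - v z\<bar> \<le> (norm (x - z) / c) / (real N * ln 2)"
    if c: "0 < c" "c \<le> max (dist y x) \<delta>" "c \<le> max (dist y z) \<delta>" for x z c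
  proof -
    have "\<bar>v x - v z\<bar> \<le> \<bar>(ln r - l x) / (real N * ln 2) - (ln r - l z) / (real N * ln 2)\<bar>"
    proof -
      have "\<bar>max 0 a - max 0 b\<bar> \<le> \<bar>a - b\<bar>" for a b :: real by (auto simp: max_def)
      then show ?thesis by (simp only: v_def)
    qed
    also have "\<dots> = \<bar>l x - l z\<bar> / (real N * ln 2)"
      using N2 by (simp add: diff_divide_distrib[symmetric] abs_minus_commute)
    also have "\<bar>l x - l z\<bar> \<le> \<bar>max (dist y x) \<delta> - max (dist y z) \<delta>\<bar> / c"
      unfolding l_def by (rule abs_ln_diff_le[OF c])
    also have "\<bar>max (dist y x) \<delta> - max (dist y z) \<delta>\<bar> \<le> \<bar>dist y x - dist y z\<bar>" by auto
    also have "\<dots> \<le> dist x z"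
      using dist_triangle[of y x z] dist_triangle[of y z x] by (simp add: abs_le_iff dist_commute)
    also have "\<dots> = norm (x - z)" by (rule dist_norm)
    finally show ?thesis using c N2 by (simp add: divide_right_mono)
  qed
  have admissible: "v \<in> capacity_admissible (sphere y r) (cball y (r / 2 ^ N)) \<Omega>"
    unfolding capacity_admissible_def
  proof (intro CollectI conjI ballI exI)
    show "(1 / (\<delta> * (real N * ln 2)))-lipschitz_on (closure \<Omega>) v"
    proof (rule lipschitz_onI)
      show "dist (v x) (v z) \<le> 1 / (\<delta> * (real N * ln 2)) * dist x z" for x z
        using vdiff[of \<delta> x z] \<delta> by (simp add: dist_norm)
    qed (use \<delta> in simp)
    show "0 \<le> v x" for x by (simp add: v_def)
    show "v x = 0" if "x \<in> sphere y r" for x using that \<delta> by (simp add: v_def l_def)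
    show "v x = 1" if "x \<in> cball y (r / 2 ^ N)" for x
    proof -
      have "ln r - l x = real N * ln 2"
        using that r by (simp add: l_def \<delta>_def max_def ln_div ln_realpow)
      then show ?thesis using N2 N by (simp add: v_def)
    qed
  qed
  \<comment> \<open>Gradient bound on the \<open>j\<close>-th dyadic shell. The slope there is at
    most \<open>1 / (c * real N * ln 2)\<close>, with \<open>c\<close> half the distance to
    \<open>y\<close>, hence \<open>c \<ge> r / (4 * 2 ^ j)\<close>, and
    \<open>ln 2 \<ge> 1 / 2\<close>.\<close>
  define k where "k = (\<lambda>j::nat. 8 * 2 ^ j / (r * real N))"
  have k0: "k j \<ge> 0" for j using r by (simp add: k_def)
  have grad: "ennreal (norm (gradient v x) ^ n) \<le> (\<Sum>j\<le>N. ennreal (k j ^ n) * indicator (cball y (r / 2 ^ j)) x)" for x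
  proof -
    consider "dist y x < \<delta>" | "r < dist y x" | "\<delta> \<le> dist y x" "dist y x \<le> r" by linarith
    then show ?thesis
    proof cases
      case 1
      have "\<forall>\<^sub>F z in nhds x. z \<in> ball y \<delta>" using 1 by (intro eventually_nhds_in_open) auto
      then have "\<forall>\<^sub>F z in nhds x. v z \<le> v x"
        by eventually_elim (use 1 in \<open>simp add: v_def l_def max_def\<close>)
      from gradient_zero_at_local_max[OF this] show ?thesis using n2 by (simp add: power_0_left)
    next
      case 2
      have "ln r \<le> l x" unfolding l_def using 2 r by (subst ln_le_cancel_iff) auto
      then have "(ln r - l x) / (real N * ln 2) \<le> 0" using N2 by (intro divide_nonpos_pos) auto
      then have "v x \<le> v z" for z by (simp add: v_def)
      then have "\<forall>\<^sub>F z in nhds x. v x \<le> v z" by simp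
      from gradient_zero_at_local_min[OF this] show ?thesis using n2 by (simp add: power_0_left)
    next
      case 3
      obtain j where j: "j \<le> N" "dist y x \<le> r / 2 ^ j" "r / 2 ^ Suc j \<le> dist y x"
        using dyadic_scale[of r N "dist y x"] 3 r unfolding \<delta>_def by blast
      define c where "c = dist y x / 2"
      have c: "c > 0" unfolding c_def using 3 \<delta> by linarith
      have "\<forall>\<^sub>F z in nhds x. z \<in> ball x c" using c by (intro eventually_nhds_in_open) auto
      then have ev: "\<forall>\<^sub>F z in nhds x. \<bar>v z - v x\<bar> \<le> (1 / c / (real N * ln 2)) * norm (z - x)"
      proof eventually_elim
        case (elim z)
        have "c \<le> dist y z" using elim dist_triangle[of y x z] by (simp add: c_def dist_commute)
        moreover have "c \<le> dist y x" by (simp add: c_def)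
        ultimately have "c \<le> max (dist y z) \<delta>" "c \<le> max (dist y x) \<delta>" by linarith+
        from vdiff[OF c this] show ?case by simp
      qed
      have "norm (gradient v x) \<le> 1 / c / (real N * ln 2)"
        using c N2 by (intro norm_gradient_le[OF ev]) simp
      also have "\<dots> \<le> k j"
      proof -
        have "r \<le> 2 ^ Suc j * dist y x" using j(3) by (simp add: divide_le_eq mult.commute)
        then have "r \<le> 4 * 2 ^ j * c" by (simp add: c_def mult.commute)
        moreover have "ln (2::real) \<ge> 1 / 2" using ln2_ge_two_thirds by simp
        ultimately have "r * (1 / 2) \<le> (4 * 2 ^ j * c) * ln 2" using c by (intro mult_mono) auto
        then have "r * real N \<le> (8 * 2 ^ j * c * ln 2) * real N" by (intro mult_right_mono) auto
        then show ?thesis unfolding k_def using c N r by (simp add: field_simps)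
      qed
      finally have "norm (gradient v x) ^ n \<le> k j ^ n" by (intro power_mono) auto
      then have "ennreal (norm (gradient v x) ^ n) \<le> ennreal (k j ^ n) * indicator (cball y (r / 2 ^ j)) x"
        using j(2) by (simp add: ennreal_leI)
      also have "\<dots> \<le> (\<Sum>j\<le>N. ennreal (k j ^ n) * indicator (cball y (r / 2 ^ j)) x)"
        using j(1) by (intro member_le_sum) auto
      finally show ?thesis .
    qed
  qed
  have "conformal_capacity (sphere y r) (cball y (r / 2 ^ N)) \<Omega> \<le> (\<integral>\<^sup>+x\<in>\<Omega>. ennreal (norm (gradient v x) ^ n) \<partial>lebesgue)"
    unfolding conformal_capacity_def n_def using admissible by (rule INF_lower)
  also have "\<dots> \<le> (\<integral>\<^sup>+x. (\<Sum>j\<le>N. ennreal (k j ^ n) * indicator (cball y (r / 2 ^ j)) x) \<partial>lebesgue)"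
    using grad by (intro nn_integral_mono) (auto simp: indicator_def)
  also have "\<dots> = (\<Sum>j\<le>N. ennreal (k j ^ n) * emeasure lebesgue (cball y (r / 2 ^ j)))"
    by (subst nn_integral_sum)
      (auto simp: nn_integral_cmult_indicator intro!: borel_measurable_times_ennreal borel_measurable_indicator)
  \<comment> \<open>Gradient bound and radius scale oppositely, so every dyadic scale contributes
    the same amount. There are \<open>N + 1\<close> of them, each of order \<open>1 / N ^ n\<close>,
    and \<open>2 \<le> n\<close> leaves a bound of order \<open>1 / N\<close>.\<close>
  also have "\<dots> = (\<Sum>j\<le>N. ennreal (unit_ball_vol (real n) * (8 / real N) ^ n))"
  proof (rule sum.cong[OF refl])
    fix j
    have "emeasure lebesgue (cball y (r / 2 ^ j)) = ennreal (unit_ball_vol (real n) * (r / 2 ^ j) ^ n)"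
      using r emeasure_cball[of "r / 2 ^ j" y] by (simp add: n_def)
    then have "ennreal (k j ^ n) * emeasure lebesgue (cball y (r / 2 ^ j)) = ennreal (unit_ball_vol (real n) * (k j * (r / 2 ^ j)) ^ n)"
      using k0[of j] by (simp only: power_mult_distrib mult.left_commute[of "unit_ball_vol (real n)"] ennreal_mult' zero_le_power)
    also have "k j * (r / 2 ^ j) = 8 / real N" using r by (simp add: k_def)
    finally show "ennreal (k j ^ n) * emeasure lebesgue (cball y (r / 2 ^ j)) = ennreal (unit_ball_vol (real n) * (8 / real N) ^ n)" .
  qed
  also have "\<dots> = ennreal ((real N + 1) * (unit_ball_vol (real n) * (8 / real N) ^ n))"
    by (subst sum_ennreal) (auto simp: add.commute)
  also have "\<dots> \<le> ennreal (2 * 8 ^ n * unit_ball_vol (real n) / real N)"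
  proof (rule ennreal_leI)
    have "(real N + 1) * real N \<le> 2 * real N ^ n"
    proof -
      have "(real N + 1) * real N \<le> (2 * real N) * real N" using N by (intro mult_right_mono) auto
      also have "\<dots> = 2 * real N ^ 2" by (simp add: power2_eq_square)
      also have "\<dots> \<le> 2 * real N ^ n" using N n2 by (intro mult_left_mono power_increasing) auto
      finally show ?thesis .
    qed
    then have "(real N + 1) / real N ^ n \<le> 2 / real N" using N by (simp add: field_simps)
    then have "(unit_ball_vol (real n) * 8 ^ n) * ((real N + 1) / real N ^ n) \<le> (unit_ball_vol (real n) * 8 ^ n) * (2 / real N)"
      by (intro mult_left_mono) auto
    then show "(real N + 1) * (unit_ball_vol (real n) * (8 / real N) ^ n) \<le> 2 * 8 ^ n * unit_ball_vol (real n) / real N"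
      by (simp add: power_divide ac_simps)
  qed
  finally show ?thesis .
qed

section \<open>Distortion of quasiconformal maps\<close>

text \<open>The definition requires condensers on both sides and is thus symmetric in the two
  domains; multiplication by \<open>Q\<close> and \<open>inverse Q\<close> interchanges the two
  inequalities.\<close>

lemma Q_quasiconformal_inverse:
  assumes qc: "Q_quasiconformal Q \<phi> \<Omega> \<Omega>'" and hom: "homeomorphism \<Omega> \<Omega>' \<phi> \<psi>"
  shows "Q_quasiconformal Q \<psi> \<Omega>' \<Omega>"
proof -
  have Q: "1 \<le> Q" and D: "is_domain \<Omega>" "is_domain \<Omega>'"
    and cap: "\<And>F0 F1. condenser F0 F1 \<Omega> \<Longrightarrow> F0 \<subseteq> \<Omega> \<Longrightarrow> F1 \<subseteq> \<Omega> \<Longrightarrow> condenser (\<phi> ` F0) (\<phi> ` F1) \<Omega>' \<Longrightarrow>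
        ennreal (inverse Q) * conformal_capacity F0 F1 \<Omega> \<le> conformal_capacity (\<phi> ` F0) (\<phi> ` F1) \<Omega>'
      \<and> conformal_capacity (\<phi> ` F0) (\<phi> ` F1) \<Omega>' \<le> ennreal Q * conformal_capacity F0 F1 \<Omega>"
    using qc unfolding Q_quasiconformal_def by auto
  have inv: "ennreal (inverse Q) * (ennreal Q * c) = c" "ennreal Q * (ennreal (inverse Q) * c) = c" for c
    using Q by (simp_all add: mult.assoc[symmetric] ennreal_mult'[symmetric])
  have im: "\<phi> ` \<psi> ` F = F" if "F \<subseteq> \<Omega>'" for F
    using hom that by (force simp: homeomorphism_def image_image subset_iff)
  have "ennreal (inverse Q) * conformal_capacity F0 F1 \<Omega>' \<le> conformal_capacity (\<psi> ` F0) (\<psi> ` F1) \<Omega>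
      \<and> conformal_capacity (\<psi> ` F0) (\<psi> ` F1) \<Omega> \<le> ennreal Q * conformal_capacity F0 F1 \<Omega>'"
    if F: "condenser F0 F1 \<Omega>'" "F0 \<subseteq> \<Omega>'" "F1 \<subseteq> \<Omega>'" "condenser (\<psi> ` F0) (\<psi> ` F1) \<Omega>" for F0 F1
  proof -
    have "\<psi> ` F0 \<subseteq> \<Omega>" "\<psi> ` F1 \<subseteq> \<Omega>"
      using hom F unfolding homeomorphism_def by auto
    from cap[OF F(4) this] have "ennreal (inverse Q) * conformal_capacity (\<psi> ` F0) (\<psi> ` F1) \<Omega> \<le> conformal_capacity F0 F1 \<Omega>'"
      "conformal_capacity F0 F1 \<Omega>' \<le> ennreal Q * conformal_capacity (\<psi> ` F0) (\<psi> ` F1) \<Omega>"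
      using F by (simp_all add: im)
    from mult_left_mono[OF this(1), of "ennreal Q"] mult_left_mono[OF this(2), of "ennreal (inverse Q)"]
    show ?thesis by (simp add: inv)
  qed
  moreover have "\<exists>f. homeomorphism \<Omega>' \<Omega> \<psi> f" using hom homeomorphism_sym by blast
  ultimately show ?thesis unfolding Q_quasiconformal_def using Q D by blast
qed

lemma complement_infdist_pos:
  fixes D :: "'a::{heine_borel, real_normed_vector, perfect_space} set"
  assumes "open D" "bounded D" "x \<in> D"
  shows "- D \<noteq> {}" "0 < infdist x (- D)"
proof -
  have "D \<noteq> UNIV" using assms(2) not_bounded_UNIV by blast
  then show ne: "- D \<noteq> {}" by blast
  show "0 < infdist x (- D)"
    using infdist_pos_not_in_closed[of "- D" x] assms ne by auto
qed

lemma ball_infdist_subset: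
  assumes "r \<le> infdist x (- D)"
  shows "ball x r \<subseteq> D"
proof
  fix z assume "z \<in> ball x r"
  then show "z \<in> D" using infdist_le[of z "- D" x] assms by fastforce
qed

theorem quasiconformal_distortion:
  fixes f :: "real ^ 'n \<Rightarrow> real ^ 'n"
  assumes n2: "2 \<le> CARD('n)" and qc: "Q_quasiconformal Q f D D'"
    and bdd: "bounded D" "bounded D'" and \<kappa>: "0 < \<kappa>"
  obtains \<epsilon> where "0 < \<epsilon>" "\<epsilon> < 1"
    "\<And>y z. y \<in> D \<Longrightarrow> dist y z \<le> \<epsilon> * infdist y (- D) \<Longrightarrow> dist (f y) (f z) \<le> \<kappa> * infdist (f y) (- D')"
proof (rule loewner_lower_bound[of "1 / \<kappa>", where 'a = "real ^ 'n"])
  \<comment> \<open>The continua will have size \<open>s = \<kappa> * d'\<close> and base points at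
    distance \<open>d'\<close>, that is \<open>(1 / \<kappa>) * s\<close>.\<close>
  show "0 \<le> 1 / \<kappa>" using \<kappa> by simp
next
  fix c :: real
  assume c: "0 < c" and loewner:
    "\<And>(w :: real ^ 'n \<Rightarrow> real) L A B a a' b b' s.
      L-lipschitz_on UNIV w \<Longrightarrow> connected A \<Longrightarrow> connected B \<Longrightarrow> a \<in> A \<Longrightarrow> a' \<in> A \<Longrightarrow> b \<in> B \<Longrightarrow> b' \<in> B \<Longrightarrow>
      0 < s \<Longrightarrow> s \<le> dist a a' \<Longrightarrow> s \<le> dist b b' \<Longrightarrow> dist a b \<le> (1 / \<kappa>) * s \<Longrightarrow>
      (\<And>x. x \<in> A \<Longrightarrow> w x = 1) \<Longrightarrow> (\<And>x. x \<in> B \<Longrightarrow> w x = 0) \<Longrightarrow>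
      ennreal c \<le> (\<integral>\<^sup>+x. ennreal (norm (weak_gradient w x) ^ DIM(real ^ 'n)) \<partial>lborel)"
  define n where "n = CARD('n)"
  obtain g where hom: "homeomorphism D D' f g" and Q: "1 \<le> Q" and dom: "is_domain D" "is_domain D'"
    and cap: "\<And>F0 F1. condenser F0 F1 D \<Longrightarrow> F0 \<subseteq> D \<Longrightarrow> F1 \<subseteq> D \<Longrightarrow> condenser (f ` F0) (f ` F1) D' \<Longrightarrow>
        conformal_capacity (f ` F0) (f ` F1) D' \<le> ennreal Q * conformal_capacity F0 F1 D"
    using qc unfolding Q_quasiconformal_def by blast
  have opn: "open D" "open D'" using dom by (auto simp: is_domain_def)
  have cont: "continuous_on D f" and inj: "inj_on f D" and img: "f ` D = D'"
    using hom by (auto simp: homeomorphism_def inj_on_def) metis+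
  define T where "T = 2 * 8 ^ n * unit_ball_vol (real n)"
  have T: "T > 0" unfolding T_def by simp
  \<comment> \<open>Large enough that the ring with radii \<open>r\<close> and
    \<open>r / 2 ^ N\<close> has an image of capacity below the Loewner constant
    \<open>c\<close>.\<close>
  obtain N0 where N0: "Q * T / c < real N0" using reals_Archimedean2 by blast
  define N where "N = Suc N0"
  have N: "0 < N" "Q * T / c < real N" using N0 by (simp_all add: N_def)
  have small: "Q * (T / real N) < c" using N c by (simp add: field_simps)
  show thesis
  proof (rule that[of "1 / 2 ^ Suc N"])
    show "0 < 1 / (2::real) ^ Suc N" by simp
    show "1 / (2::real) ^ Suc N < 1"
      using one_less_power[of "2::real" "Suc N"] by (simp add: divide_less_eq)
    fix y z assume y: "y \<in> D" and yz: "dist y z \<le> 1 / 2 ^ Suc N * infdist y (- D)"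
    show "dist (f y) (f z) \<le> \<kappa> * infdist (f y) (- D')"
    proof (rule ccontr)
      assume "\<not> dist (f y) (f z) \<le> \<kappa> * infdist (f y) (- D')"
      then have far: "\<kappa> * infdist (f y) (- D') < dist (f y) (f z)" by simp
      \<comment> \<open>Halving the distance keeps the closed ball inside \<open>D\<close> and
        accounts for the extra factor 2 in \<open>1 / 2 ^ Suc N\<close>.\<close>
      define r where "r = infdist y (- D) / 2"
      define \<delta> where "\<delta> = r / 2 ^ N"
      have r: "r > 0" using complement_infdist_pos[OF opn(1) bdd(1) y] by (simp add: r_def)
      have \<delta>: "0 < \<delta>" "\<delta> < r" "dist y z \<le> \<delta>"
        using r N yz by (auto simp: \<delta>_def r_def field_simps)
      have cbD: "cball y r \<subseteq> D"
      proof -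
        have "cball y r \<subseteq> ball y (infdist y (- D))" using r by (auto simp: r_def)
        then show ?thesis using ball_infdist_subset[of "infdist y (- D)" y D] by blast
      qed
      have subs: "sphere y r \<subseteq> D" "cball y \<delta> \<subseteq> D" "ball y r \<subseteq> D" "cball y \<delta> \<subseteq> ball y r"
        using cbD \<delta> by force+
      define U where "U = f ` ball y r"
      have openU: "open U"
        unfolding U_def using subs inj cont
        by (intro invariance_of_domain) (auto intro: continuous_on_subset inj_on_subset)
      have compK: "compact (f ` cball y r)"
        using cbD cont by (intro compact_continuous_image compact_cball) (rule continuous_on_subset)
      have clU: "closure U \<subseteq> f ` cball y r"
        unfolding U_def using compact_imp_closed[OF compK] by (intro closure_minimal image_mono) auto
      \<comment> \<open>Invariance of domain makes \<open>U\<close> open, so its frontier avoids the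
        image of the open ball. On the image of the sphere the test function vanishes, as its
        extension by zero requires.\<close>
      have frU: "frontier U \<subseteq> f ` sphere y r"
      proof
        fix x assume x: "x \<in> frontier U"
        then have "x \<in> f ` cball y r" "x \<notin> f ` ball y r"
          using clU openU by (auto simp: frontier_def interior_open U_def)
        moreover have "cball y r \<subseteq> ball y r \<union> sphere y r" by auto
        ultimately show "x \<in> f ` sphere y r" by blast
      qed
      have KD': "f ` cball y r \<subseteq> D'" using cbD img by blast
      have clU': "closure U \<subseteq> closure D'" using clU KD' closure_subset by blast
      let ?B = "- (f ` cball y r)"
      \<comment> \<open>A compact set homeomorphic to a convex one does not separate space in
        dimension at least 2.\<close>
      have connB: "connected ?B"
      proof (rule connected_complement_homeomorphic_convex_compact)
        have "homeomorphism (cball y r) (f ` cball y r) f g"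
          by (rule homeomorphism_of_subsets[OF hom cbD KD' refl])
        then show "f ` cball y r homeomorphic cball y r"
          using homeomorphic_def homeomorphic_sym by blast
        show "2 \<le> DIM(real ^ 'n)" using n2 by simp
      qed auto
      have connA: "connected (f ` cball y \<delta>)"
        using subs(2) cont by (intro connected_continuous_image) (auto intro: continuous_on_subset)
      have fy: "f y \<in> D'" using y img by blast
      define d' where "d' = infdist (f y) (- D')"
      have d': "d' > 0" and neD': "- D' \<noteq> {}"
        using complement_infdist_pos[OF opn(2) bdd(2) fy] by (auto simp: d'_def)
      have "closed (- D')" using opn(2) by (simp add: closed_def)
      then obtain b where b: "b \<in> - D'" "d' = dist (f y) b"
        unfolding d'_def using infdist_attains_inf neD' by blast
      \<comment> \<open>Boundedness of \<open>D'\<close> places a second point of the complement far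
        from \<open>b\<close>, so the outer continuum reaches size
        \<open>\<kappa> * d'\<close>.\<close>
      obtain b' where b': "b' \<in> - D'" "\<kappa> * d' \<le> dist b b'"
      proof -
        have "bounded (D' \<union> cball b (\<kappa> * d'))" using bdd(2) by simp
        then have "D' \<union> cball b (\<kappa> * d') \<noteq> UNIV" using not_bounded_UNIV by metis
        then obtain b' where "b' \<notin> D'" "b' \<notin> cball b (\<kappa> * d')" by blast
        then show ?thesis using that[of b'] by simp
      qed
      have cond: "condenser (sphere y r) (cball y \<delta>) D"
      proof -
        have "sphere y r \<subseteq> closure D" "cball y \<delta> \<subseteq> closure D"
          using subs closure_subset[of D] by blast+
        moreover have "sphere y r \<noteq> {}" "cball y \<delta> \<noteq> {}" "D \<noteq> {}" using y r \<delta> by auto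
        ultimately show ?thesis unfolding condenser_def using opn(1) by simp
      qed
      have cond': "condenser (f ` sphere y r) (f ` cball y \<delta>) D'"
      proof -
        have "compact (f ` sphere y r)" "compact (f ` cball y \<delta>)"
          by (intro compact_continuous_image continuous_on_subset[OF cont] subs compact_sphere compact_cball)+
        moreover have "f ` sphere y r \<subseteq> closure D'" "f ` cball y \<delta> \<subseteq> closure D'"
          using subs img closure_subset[of D'] by blast+
        moreover have fne: "f ` sphere y r \<noteq> {}" "f ` cball y \<delta> \<noteq> {}" using r \<delta> by auto
        ultimately show ?thesis
          unfolding condenser_def using fne fy opn(2) compact_imp_closed by blast
      qed
      have "conformal_capacity (f ` sphere y r) (f ` cball y \<delta>) D' \<le> ennreal Q * conformal_capacity (sphere y r) (cball y \<delta>) D"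
        using cap[OF cond subs(1,2) cond'] .
      also have "\<dots> \<le> ennreal Q * ennreal (T / real N)"
        using conformal_capacity_ring_le[OF n2 N(1) r, of y D]
        by (intro mult_left_mono) (simp_all add: \<delta>_def T_def n_def)
      also have "\<dots> < ennreal c"
        using small Q T c by (simp add: ennreal_mult'[symmetric] ennreal_less_iff)
      finally obtain v where v: "v \<in> capacity_admissible (f ` sphere y r) (f ` cball y \<delta>) D'"
        and vc: "(\<integral>\<^sup>+x\<in>D'. ennreal (norm (gradient v x) ^ n) \<partial>lebesgue) < ennreal c"
        unfolding conformal_capacity_def n_def INF_less_iff by blast
      obtain L where L: "L-lipschitz_on (closure D') v"
        using v by (auto simp: capacity_admissible_def)
      have vpos: "0 \<le> v x" if "x \<in> closure D'" for x
        using v that by (simp add: capacity_admissible_def)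
      have v0: "v x = 0" if "x \<in> f ` sphere y r" for x
        using v that unfolding capacity_admissible_def by blast
      have v1: "v x = 1" if "x \<in> f ` cball y \<delta>" for x
        using v that unfolding capacity_admissible_def by blast
      define w where "w = truncated_extension U v"
      have UD': "U \<subseteq> D'" unfolding U_def using subs(3) img by blast
      have LU: "L-lipschitz_on (closure U) v" by (rule lipschitz_on_subset[OF L clU'])
      have vposU: "0 \<le> v x" if "x \<in> U" for x using that UD' vpos closure_subset[of D'] by blast
      have Lw: "L-lipschitz_on UNIV w"
        unfolding w_def using frU v0 vposU by (intro lipschitz_truncated_extension[OF LU]) auto
      have cvU: "continuous_on U v"
        using lipschitz_on_continuous_on[OF LU] closure_subset continuous_on_subset by blast
      have "ennreal c \<le> (\<integral>\<^sup>+x. ennreal (norm (weak_gradient w x) ^ DIM(real ^ 'n)) \<partial>lborel)"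
      proof (rule loewner[OF Lw connA connB, of "f y" "f z" b b' "\<kappa> * d'"])
        show "f y \<in> f ` cball y \<delta>" using \<delta> by auto
        show "f z \<in> f ` cball y \<delta>" using \<delta> by auto
        show "b \<in> ?B" "b' \<in> ?B" using b(1) b'(1) KD' by blast+
        show "0 < \<kappa> * d'" using \<kappa> d' by simp
        show "\<kappa> * d' \<le> dist (f y) (f z)" using far by (simp add: d'_def)
        show "\<kappa> * d' \<le> dist b b'" by (rule b')
        show "dist (f y) b \<le> 1 / \<kappa> * (\<kappa> * d')" using b(2) \<kappa> by simp
        show "w x = 1" if x: "x \<in> f ` cball y \<delta>" for x
        proof -
          have "x \<in> U" using x subs(4) unfolding U_def by blast
          then show ?thesis using v1[OF x] by (simp add: w_def truncated_extension_def)
        qed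
        show "w x = 0" if x: "x \<in> ?B" for x
        proof -
          have "x \<notin> U" using x ball_subset_cball[of y r] unfolding U_def by blast
          then show ?thesis by (simp add: w_def truncated_extension_def)
        qed
      qed
      also have "\<dots> = (\<integral>\<^sup>+x. ennreal (norm (gradient w x) ^ n) \<partial>lebesgue)"
        using gradient_energy_eq_weak[OF Lw] by (simp add: n_def)
      also have "\<dots> \<le> (\<integral>\<^sup>+x\<in>D'. ennreal (norm (gradient v x) ^ n) \<partial>lebesgue)"
      proof (rule nn_integral_mono)
        fix x
        have "norm (gradient w x) \<le> (if x \<in> U then norm (gradient v x) else 0)"
          unfolding w_def by (rule norm_gradient_truncated_extension_le[OF openU vposU cvU])
        then have "norm (gradient w x) ^ n \<le> (if x \<in> U then norm (gradient v x) else 0) ^ n"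
          by (intro power_mono) auto
        also have "\<dots> \<le> norm (gradient v x) ^ n * indicator D' x"
          using UD' n2 by (auto simp: n_def indicator_def power_0_left)
        finally have "ennreal (norm (gradient w x) ^ n) \<le> ennreal (norm (gradient v x) ^ n * indicator D' x)"
          by (rule ennreal_leI)
        also have "\<dots> = ennreal (norm (gradient v x) ^ n) * indicator D' x" by (auto simp: indicator_def)
        finally show "ennreal (norm (gradient w x) ^ n) \<le> ennreal (norm (gradient v x) ^ n) * indicator D' x" .
      qed
      also have "\<dots> < ennreal c" by (rule vc)
      finally show False by simp
    qed
  qed
qed

section \<open>Whitney families\<close>

text \<open>Invariance of domain for the map and for its inverse gives one inclusion each.\<close>

lemma homeomorphism_interior_image:
  fixes f :: "'a::euclidean_space \<Rightarrow> 'a"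
  assumes hom: "homeomorphism D D' f g" and E: "E \<subseteq> D"
  shows "interior (f ` E) = f ` interior E"
proof
  have contf: "continuous_on D f" and contg: "continuous_on D' g"
    and gf: "\<And>x. x \<in> D \<Longrightarrow> g (f x) = x" and fg: "\<And>y. y \<in> D' \<Longrightarrow> f (g y) = y" and img: "f ` D = D'"
    using hom by (auto simp: homeomorphism_def)
  have sub: "interior E \<subseteq> D" using E interior_subset by blast
  have "open (f ` interior E)"
    using sub gf by (intro invariance_of_domain open_interior continuous_on_subset[OF contf]) (auto intro: inj_on_inverseI)
  then show "f ` interior E \<subseteq> interior (f ` E)"
    using interior_subset by (intro interior_maximal image_mono)
  define V where "V = interior (f ` E)"
  have "V \<subseteq> f ` E" unfolding V_def by (rule interior_subset)
  moreover from this have "V \<subseteq> D'" using E img by blast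
  ultimately have V: "V \<subseteq> f ` E" "V \<subseteq> D'" .
  have "open (g ` V)"
    using V fg unfolding V_def
    by (intro invariance_of_domain open_interior continuous_on_subset[OF contg]) (auto intro: inj_on_inverseI)
  moreover have "g ` V \<subseteq> E"
  proof clarify
    fix y assume "y \<in> V"
    then obtain x where "x \<in> E" "y = f x" using V(1) by blast
    then show "g y \<in> E" using gf E by auto
  qed
  ultimately have "g ` V \<subseteq> interior E" by (rule interior_maximal[rotated])
  then have "f ` g ` V \<subseteq> f ` interior E" by (rule image_mono)
  moreover have "f ` g ` V = V" using V(2) fg by (force simp: image_image)
  ultimately show "interior (f ` E) \<subseteq> f ` interior E" by (simp add: V_def)
qed

section \<open>Radii, diameters and dilatation\<close>

lemma interior_radius_ge:
  assumes A: "bounded A" and r: "0 < r" "cball x r \<subseteq> A"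
  shows "r \<le> interior_radius A"
  unfolding interior_radius_def
proof (rule cSup_upper)
  show "bdd_above {r. 0 < r \<and> (\<exists>x. cball x r \<subseteq> A)}"
  proof (rule bdd_aboveI)
    fix s assume "s \<in> {r. 0 < r \<and> (\<exists>x. cball x r \<subseteq> A)}"
    then obtain z where s: "0 < s" "cball z s \<subseteq> A" by blast
    have "2 * s = diameter (cball z s)" using s(1) by simp
    also have "\<dots> \<le> diameter A" by (rule diameter_subset[OF s(2) A])
    finally show "s \<le> diameter A" using s(1) by linarith
  qed
qed (use r in blast)

lemma exterior_radius_le:
  assumes "0 < r" "A \<subseteq> cball x r"
  shows "exterior_radius A \<le> r"
  unfolding exterior_radius_def using assms by (intro cInf_lower bdd_belowI[of _ 0]) auto

lemma diameter_le_exterior_radius: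
  assumes A: "bounded A" "A \<noteq> {}"
  shows "diameter A \<le> 2 * exterior_radius A"
proof -
  obtain b where b: "0 < b" "A \<subseteq> cball 0 b"
    using bounded_subset_ballD[OF A(1), of 0] ball_subset_cball by blast
  have "diameter A / 2 \<le> exterior_radius A"
    unfolding exterior_radius_def
  proof (rule cInf_greatest)
    show "{r. 0 < r \<and> (\<exists>x. A \<subseteq> cball x r)} \<noteq> {}" using b by blast
    fix r assume "r \<in> {r. 0 < r \<and> (\<exists>x. A \<subseteq> cball x r)}"
    then obtain x where "0 < r" "A \<subseteq> cball x r" by blast
    then have "diameter A \<le> 2 * r" using diameter_subset[of A "cball x r"] by simp
    then show "diameter A / 2 \<le> r" by simp
  qed
  then show ?thesis by simp
qed

lemma contains_large_cball:
  assumes A: "bounded A" "interior A \<noteq> {}" and K: "dilatation A \<le> K" "0 < K"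
  obtains x r where "0 < r" "cball x r \<subseteq> A" "diameter A \<le> 4 * K * r"
proof -
  obtain x0 r0 where r0: "0 < r0" "cball x0 r0 \<subseteq> A"
    using A(2) by (meson all_not_in_conv mem_interior_cball)
  have ir: "0 < interior_radius A" using interior_radius_ge[OF A(1) r0] r0(1) by linarith
  have "A \<noteq> {}" using r0 by force
  then have "diameter A \<le> 2 * exterior_radius A" by (rule diameter_le_exterior_radius[OF A(1)])
  also have "exterior_radius A \<le> K * interior_radius A"
    using K ir unfolding dilatation_def by (simp add: divide_le_eq)
  finally have d: "diameter A \<le> 2 * K * interior_radius A" by simp
  \<comment> \<open>A radius above half the supremum costs a factor 2; the other factor 2 in
    \<open>4 * K\<close> comes from passing from the diameter to the exterior radius.\<close>
  have "\<exists>r\<in>{r. 0 < r \<and> (\<exists>x. cball x r \<subseteq> A)}. interior_radius A / 2 < r"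
    using ir r0 unfolding interior_radius_def by (intro less_cSupD) auto
  then obtain x r where r: "0 < r" "cball x r \<subseteq> A" "interior_radius A / 2 < r" by blast
  have "2 * K * interior_radius A \<le> 2 * K * (2 * r)" using r K by (intro mult_left_mono) auto
  then show thesis using that[OF r(1,2)] d by simp
qed

text \<open>A segment in \<open>E\<close> splits into \<open>N\<close> steps short enough for
  \<open>step\<close>. Since \<open>h\<close> is 1-Lipschitz, an image step of length at most
  \<open>h\<close> can at most double it, so the images drift by at most the geometric sum
  \<open>(2 ^ N - 1) * h (f x)\<close>. The last factor 2 passes from distances to
  \<open>f x\<close> to the diameter.\<close>

lemma image_diameter_le:
  fixes f :: "'a::euclidean_space \<Rightarrow> 'b::euclidean_space"
  assumes E: "convex E" "bounded E" and \<epsilon>: "0 < \<epsilon>" and N: "0 < N" "diameter E \<le> \<epsilon> * real N * \<delta>"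
    and \<delta>: "\<And>x. x \<in> E \<Longrightarrow> \<delta> \<le> d x"
    and step: "\<And>x y. x \<in> E \<Longrightarrow> y \<in> E \<Longrightarrow> dist x y \<le> \<epsilon> * d x \<Longrightarrow> dist (f x) (f y) \<le> h (f x)"
    and h: "\<And>x y. h x \<le> h y + dist x y" "\<And>x. 0 \<le> h x"
    and xE: "x \<in> E"
  shows "diameter (f ` E) \<le> 2 * 2 ^ N * h (f x)"
proof -
  have dst: "dist (f x) (f y) \<le> 2 ^ N * h (f x)" if y: "y \<in> E" for y
  proof -
    define p where "p = (\<lambda>k. x + (real k / real N) *\<^sub>R (y - x))"
    have pE: "p k \<in> E" if "k \<le> N" for k
    proof -
      have "p k = (1 - real k / real N) *\<^sub>R x + (real k / real N) *\<^sub>R y"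
        by (simp add: p_def algebra_simps)
      then show ?thesis using that N xE y by (auto intro!: convexD_alt[OF E(1)])
    qed
    have near: "dist (p k) (p (Suc k)) \<le> \<epsilon> * d (p k)" if k: "k < N" for k
    proof -
      have "p (Suc k) - p k = (1 / real N) *\<^sub>R (y - x)"
        by (simp add: p_def scaleR_left_diff_distrib[symmetric] diff_divide_distrib[symmetric])
      then have "dist (p k) (p (Suc k)) = dist x y / real N"
        by (simp add: dist_norm norm_minus_commute[of "p k"] norm_minus_commute[of x])
      also have "\<dots> \<le> diameter E / real N"
        using diameter_bounded_bound[OF E(2) xE y] by (intro divide_right_mono) auto
      also have "\<dots> \<le> \<epsilon> * \<delta>" using N by (simp add: divide_le_eq ac_simps)
      also have "\<dots> \<le> \<epsilon> * d (p k)" using \<delta>[OF pE[of k]] k \<epsilon> by (intro mult_left_mono) auto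
      finally show ?thesis .
    qed
    have "h (f (p k)) \<le> 2 ^ k * h (f x) \<and> dist (f x) (f (p k)) \<le> (2 ^ k - 1) * h (f x)" if "k \<le> N" for k
      using that
    proof (induction k)
      case 0
      then show ?case by (simp add: p_def)
    next
      case (Suc k)
      have s: "dist (f (p k)) (f (p (Suc k))) \<le> h (f (p k))"
        using step[OF pE pE near, of k] Suc.prems by simp
      have "h (f (p (Suc k))) \<le> 2 * h (f (p k))"
        using h(1)[of "f (p (Suc k))" "f (p k)"] s by (simp add: dist_commute)
      moreover have "dist (f x) (f (p (Suc k))) \<le> dist (f x) (f (p k)) + h (f (p k))"
        using s dist_triangle[of "f x" "f (p (Suc k))" "f (p k)"] by linarith
      ultimately show ?case using Suc.IH Suc.prems by (auto simp: algebra_simps)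
    qed
    from this[of N] have "dist (f x) (f y) \<le> (2 ^ N - 1) * h (f x)" using N by (simp add: p_def)
    also have "\<dots> \<le> 2 ^ N * h (f x)" using h(2) by (intro mult_right_mono) auto
    finally show ?thesis .
  qed
  show ?thesis
  proof (rule diameter_le)
    show "f ` E \<noteq> {} \<or> 0 \<le> 2 * 2 ^ N * h (f x)" using xE by blast
    fix u v assume "u \<in> f ` E" "v \<in> f ` E"
    then have "dist (f x) u \<le> 2 ^ N * h (f x)" "dist (f x) v \<le> 2 ^ N * h (f x)" using dst by auto
    then show "norm (u - v) \<le> 2 * 2 ^ N * h (f x)"
      using dist_triangle3[of u v "f x"] by (simp add: dist_norm)
  qed
qed

theorem mainTheorem1:
  fixes \<Omega> \<Omega>' :: "(real ^ 'n) set"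
    and \<phi> :: "real ^ 'n \<Rightarrow> real ^ 'n"
    and I :: "'i set"
    and E :: "'i \<Rightarrow> (real ^ 'n) set"
  assumes "2 \<le> CARD('n)"
    and "simple_domain \<Omega>" and "bounded \<Omega>"
    and "is_domain \<Omega>'" and "bounded \<Omega>'"
    and "quasiconformal \<phi> \<Omega> \<Omega>'"
    and "whitney_family \<Omega> I E"
  shows "rough_whitney_family \<Omega>' I (\<lambda>i. \<phi> ` E i)"
proof -
  obtain Q where qc: "Q_quasiconformal Q \<phi> \<Omega> \<Omega>'"
    using assms(6) unfolding quasiconformal_def by blast
  obtain \<psi> where hom: "homeomorphism \<Omega> \<Omega>' \<phi> \<psi>" and dom: "is_domain \<Omega>" "is_domain \<Omega>'"
    using qc unfolding Q_quasiconformal_def by blast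
  have opn: "open \<Omega>" "open \<Omega>'" using dom by (auto simp: is_domain_def)
  have cont: "continuous_on \<Omega> \<phi>" and \<psi>\<phi>: "\<And>x. x \<in> \<Omega> \<Longrightarrow> \<psi> (\<phi> x) = x"
    and \<phi>\<psi>: "\<And>y. y \<in> \<Omega>' \<Longrightarrow> \<phi> (\<psi> y) = y" and img: "\<phi> ` \<Omega> = \<Omega>'" and img': "\<psi> ` \<Omega>' = \<Omega>"
    using hom by (auto simp: homeomorphism_def)
  have poly: "\<And>i. i \<in> I \<Longrightarrow> polyhedron (E i)" "\<And>i. i \<in> I \<Longrightarrow> aff_dim (E i) = int CARD('n)"
    and sub: "\<And>i. i \<in> I \<Longrightarrow> E i \<subseteq> \<Omega>"
    and cover: "\<Omega> \<subseteq> (\<Union>i\<in>I. E i)"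
    and disj: "disjoint_family_on (\<lambda>i. interior (E i)) I"
    and dil: "bdd_above ((\<lambda>i. dilatation (E i)) ` I)"
    and comp: "diameter_comparable_to_dist \<Omega> I E"
    using assms(7) unfolding whitney_family_def by auto
  obtain C where C: "C > 0" "\<And>i. i \<in> I \<Longrightarrow> C * setdist (E i) (- \<Omega>) \<le> diameter (E i)"
    "\<And>i. i \<in> I \<Longrightarrow> diameter (E i) \<le> inverse C * setdist (E i) (- \<Omega>)"
    using comp unfolding diameter_comparable_to_dist_def by auto
  obtain K0 where K0: "\<And>i. i \<in> I \<Longrightarrow> dilatation (E i) \<le> K0"
    using dil unfolding bdd_above_def by auto
  define K where "K = max K0 1"
  have K: "0 < K" "\<And>i. i \<in> I \<Longrightarrow> dilatation (E i) \<le> K"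
    using K0 by (auto simp: K_def le_max_iff_disj)
  have conv: "convex (E i)" and clo: "closed (E i)" and bdd: "bounded (E i)" and int: "interior (E i) \<noteq> {}"
    if i: "i \<in> I" for i
  proof -
    show "convex (E i)" "closed (E i)" using poly(1)[OF i] by (auto intro: polyhedron_imp_convex polyhedron_imp_closed)
    show "bounded (E i)" using sub[OF i] assms(3) bounded_subset by blast
    have "E i \<noteq> {}" using poly(2)[OF i] by auto
    then show "interior (E i) \<noteq> {}"
      using poly(2)[OF i] \<open>convex (E i)\<close> by (simp add: interior_rel_interior_gen rel_interior_eq_empty)
  qed
  define d where "d = (\<lambda>x. infdist x (- \<Omega>))"
  define d' where "d' = (\<lambda>x. infdist x (- \<Omega>'))"
  have dpos: "d x > 0" if "x \<in> \<Omega>" for x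
    using complement_infdist_pos[OF opn(1) assms(3) that] by (simp add: d_def)
  have d'pos: "d' x > 0" if "x \<in> \<Omega>'" for x
    using complement_infdist_pos[OF opn(2) assms(5) that] by (simp add: d'_def)
  have dge: "setdist (E i) (- \<Omega>) \<le> d x" if "x \<in> E i" for i x
    unfolding d_def infdist_eq_setdist using that by (rule setdist_le_sing)
  \<comment> \<open>Together with \<open>dge\<close> this makes \<open>d\<close> comparable to the
    diameter throughout the polyhedron.\<close>
  have dle: "d x \<le> (1 + 1 / C) * diameter (E i)" if i: "i \<in> I" and x: "x \<in> E i" for i x
  proof -
    have "d x \<le> setdist (E i) (- \<Omega>) + diameter (E i)"
    proof -
      have "d x - diameter (E i) \<le> setdist (E i) (- \<Omega>)"
      proof (rule le_setdistI)
        show "E i \<noteq> {}" using x by blast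
        show "- \<Omega> \<noteq> {}" using complement_infdist_pos[OF opn(1) assms(3)] sub[OF i] x by blast
        fix y z assume "y \<in> E i" "z \<in> - \<Omega>"
        have "d x \<le> dist x z" unfolding d_def by (rule infdist_le) fact
        also have "\<dots> \<le> dist x y + dist y z" by (rule dist_triangle)
        also have "dist x y \<le> diameter (E i)"
          by (rule diameter_bounded_bound[OF bdd[OF i] x \<open>y \<in> E i\<close>])
        finally show "d x - diameter (E i) \<le> dist y z" by simp
      qed
      then show ?thesis by simp
    qed
    also have "setdist (E i) (- \<Omega>) \<le> diameter (E i) / C"
      using C(2)[OF i] C(1) by (simp add: le_divide_eq mult.commute)
    finally show ?thesis by (simp add: algebra_simps)
  qed
  \<comment> \<open>The polyhedron contains a ball of radius \<open>r\<close> at least its diameter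
    over \<open>4 * K\<close>, while \<open>d\<close> is at most \<open>1 + 1 / C\<close> diameters;
    this \<open>\<kappa>\<close> yields \<open>\<kappa> * d x \<le> r\<close>.\<close>
  define \<kappa> where "\<kappa> = 1 / (4 * K * (1 + 1 / C))"
  have C1: "1 + 1 / C > 0" using C(1) by (intro add_pos_pos) auto
  have \<kappa>: "\<kappa> > 0" using K(1) C1 by (simp add: \<kappa>_def)
  \<comment> \<open>The distortion parameter is 1 here: the chain argument only asks that one step
    move the image by at most \<open>d'\<close>.\<close>
  obtain \<epsilon>1 where \<epsilon>1: "0 < \<epsilon>1" "\<epsilon>1 < 1" and dist1:
    "\<And>y z. y \<in> \<Omega> \<Longrightarrow> dist y z \<le> \<epsilon>1 * d y \<Longrightarrow> dist (\<phi> y) (\<phi> z) \<le> d' (\<phi> y)"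
    using quasiconformal_distortion[OF assms(1) qc assms(3,5), of 1] unfolding d_def d'_def by auto
  obtain \<epsilon>2 where \<epsilon>2: "0 < \<epsilon>2" "\<epsilon>2 < 1" and dist2:
    "\<And>y z. y \<in> \<Omega>' \<Longrightarrow> dist y z \<le> \<epsilon>2 * d' y \<Longrightarrow> dist (\<psi> y) (\<psi> z) \<le> \<kappa> * d (\<psi> y)"
    using quasiconformal_distortion[OF assms(1) Q_quasiconformal_inverse[OF qc hom] assms(5,3) \<kappa>]
    unfolding d_def d'_def by auto
  \<comment> \<open>The number of steps is uniform in \<open>i\<close>, because each diameter is at
    most \<open>inverse C\<close> times the distance to the complement.\<close>
  obtain N0 where N0: "1 / (C * \<epsilon>1) < real N0" using reals_Archimedean2 by blast
  define N where "N = Suc N0"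
  have N: "0 < N" "inverse C \<le> \<epsilon>1 * real N"
  proof -
    have "1 / (C * \<epsilon>1) \<le> real N" using N0 by (simp add: N_def)
    then show "inverse C \<le> \<epsilon>1 * real N" using C(1) \<epsilon>1 by (simp add: field_simps)
  qed (simp add: N_def)
  define H where "H = (2 * 2 ^ N :: real)"
  have H: "H > 0" by (simp add: H_def)
  have upper: "diameter (\<phi> ` E i) \<le> H * d' (\<phi> x)" if i: "i \<in> I" and x: "x \<in> E i" for i x
  proof -
    have "diameter (\<phi> ` E i) \<le> 2 * 2 ^ N * d' (\<phi> x)"
    proof (rule image_diameter_le[OF conv[OF i] bdd[OF i] \<epsilon>1(1) N(1), where d = d and \<delta> = "setdist (E i) (- \<Omega>)" and h = d'])
      have "diameter (E i) \<le> inverse C * setdist (E i) (- \<Omega>)" by (rule C(3)[OF i])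
      also have "\<dots> \<le> \<epsilon>1 * real N * setdist (E i) (- \<Omega>)" using N(2) by (intro mult_right_mono) auto
      finally show "diameter (E i) \<le> \<epsilon>1 * real N * setdist (E i) (- \<Omega>)" .
      show "dist (\<phi> y) (\<phi> z) \<le> d' (\<phi> y)" if "y \<in> E i" "z \<in> E i" "dist y z \<le> \<epsilon>1 * d y" for y z
        using dist1[of y z] that sub[OF i] by blast
      show "d' y \<le> d' z + dist y z" for y z unfolding d'_def by (rule infdist_triangle)
      show "0 \<le> d' y" for y unfolding d'_def by (rule infdist_nonneg)
    qed (use dge x in auto)
    then show ?thesis by (simp add: H_def)
  qed
  have inner: "\<exists>x\<in>E i. cball (\<phi> x) (\<epsilon>2 * d' (\<phi> x)) \<subseteq> \<phi> ` E i" if i: "i \<in> I" for i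
  proof -
    obtain x r where r: "0 < r" "cball x r \<subseteq> E i" "diameter (E i) \<le> 4 * K * r"
      by (rule contains_large_cball[OF bdd[OF i] int[OF i] K(2)[OF i] K(1)])
    have x: "x \<in> E i" using r by auto
    then have xO: "x \<in> \<Omega>" "\<phi> x \<in> \<Omega>'" using sub[OF i] img by auto
    have "\<kappa> * d x \<le> \<kappa> * ((1 + 1 / C) * diameter (E i))"
      using dle[OF i x] \<kappa> by (intro mult_left_mono) auto
    also have "\<dots> = diameter (E i) / (4 * K)" using C1 K(1) by (simp add: \<kappa>_def)
    also have "\<dots> \<le> r" using r(3) K(1) by (simp add: divide_le_eq ac_simps)
    finally have \<kappa>r: "\<kappa> * d x \<le> r" .
    have "cball (\<phi> x) (\<epsilon>2 * d' (\<phi> x)) \<subseteq> \<phi> ` E i"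
    proof
      fix q assume q: "q \<in> cball (\<phi> x) (\<epsilon>2 * d' (\<phi> x))"
      \<comment> \<open>\<open>\<epsilon>2 < 1\<close> keeps \<open>q\<close> inside
        \<open>\<Omega>'\<close>, where \<open>\<phi>\<close> inverts \<open>\<psi>\<close>.\<close>
      have "\<epsilon>2 * d' (\<phi> x) < d' (\<phi> x)" using d'pos[OF xO(2)] \<epsilon>2 by simp
      then have "q \<in> ball (\<phi> x) (d' (\<phi> x))" using q by auto
      then have qO: "q \<in> \<Omega>'" using ball_infdist_subset[of "d' (\<phi> x)" "\<phi> x" \<Omega>'] unfolding d'_def by auto
      have "dist x (\<psi> q) \<le> \<kappa> * d x" using dist2[OF xO(2), of q] q \<psi>\<phi>[OF xO(1)] by simp
      then have "\<psi> q \<in> cball x r" using \<kappa>r by simp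
      then have "\<psi> q \<in> E i" using r(2) by blast
      then show "q \<in> \<phi> ` E i" using \<phi>\<psi>[OF qO] by (metis imageI)
    qed
    then show ?thesis using x by blast
  qed
  \<comment> \<open>Continuity on the open set \<open>\<Omega>\<close> does not by itself make
    images of closed sets closed in the whole space; compactness of the polyhedra does.\<close>
  have compact': "compact (\<phi> ` E i)" if i: "i \<in> I" for i
    using clo[OF i] bdd[OF i] sub[OF i] by (intro compact_continuous_image continuous_on_subset[OF cont]) (auto simp: compact_eq_bounded_closed)
  have intim: "interior (\<phi> ` E i) = \<phi> ` interior (E i)" if i: "i \<in> I" for i
    by (rule homeomorphism_interior_image[OF hom sub[OF i]])
  have closure: "closure (interior (\<phi> ` E i)) = \<phi> ` E i" if i: "i \<in> I" for i
  proof
    show "closure (interior (\<phi> ` E i)) \<subseteq> \<phi> ` E i"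
      using compact'[OF i] interior_subset by (intro closure_minimal compact_imp_closed)
    have cl: "closure (interior (E i)) = E i"
      using convex_closure_interior[OF conv[OF i] int[OF i]] clo[OF i] by simp
    have "\<phi> ` closure (interior (E i)) \<subseteq> closure (\<phi> ` interior (E i))"
      by (rule continuous_image_closure_subset[OF cont]) (simp add: cl sub[OF i])
    then show "\<phi> ` E i \<subseteq> closure (interior (\<phi> ` E i))" by (simp add: cl intim[OF i])
  qed
  have disj': "disjoint_family_on (\<lambda>i. interior (\<phi> ` E i)) I"
    unfolding disjoint_family_on_def
  proof (intro ballI impI)
    fix i j assume ij: "i \<in> I" "j \<in> I" "i \<noteq> j"
    have "interior (E i) \<inter> interior (E j) = {}" using disj ij unfolding disjoint_family_on_def by blast
    moreover have "interior (E i) \<subseteq> \<Omega>" "interior (E j) \<subseteq> \<Omega>" using sub ij interior_subset by blast+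
    moreover have "inj_on \<phi> \<Omega>" using \<psi>\<phi> by (rule inj_on_inverseI)
    ultimately have "\<phi> ` interior (E i) \<inter> \<phi> ` interior (E j) = {}"
      by (simp flip: inj_on_image_Int)
    then show "interior (\<phi> ` E i) \<inter> interior (\<phi> ` E j) = {}" using intim ij by simp
  qed
  \<comment> \<open>The image lies between two balls about the same point \<open>\<phi> x\<close>,
    with radii \<open>\<epsilon>2\<close> and \<open>H\<close> times
    \<open>d' (\<phi> x)\<close>.\<close>
  have dil': "dilatation (\<phi> ` E i) \<le> H / \<epsilon>2" if i: "i \<in> I" for i
  proof -
    obtain x where x: "x \<in> E i" "cball (\<phi> x) (\<epsilon>2 * d' (\<phi> x)) \<subseteq> \<phi> ` E i" using inner[OF i] by blast
    have p: "d' (\<phi> x) > 0" using d'pos x sub[OF i] img by blast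
    have b: "bounded (\<phi> ` E i)" using compact'[OF i] by (rule compact_imp_bounded)
    have ir: "\<epsilon>2 * d' (\<phi> x) \<le> interior_radius (\<phi> ` E i)"
      using p \<epsilon>2 x by (intro interior_radius_ge[OF b]) auto
    have "\<phi> ` E i \<subseteq> cball (\<phi> x) (H * d' (\<phi> x))"
    proof
      fix q assume "q \<in> \<phi> ` E i"
      then have "dist (\<phi> x) q \<le> diameter (\<phi> ` E i)"
        using x(1) by (intro diameter_bounded_bound[OF b]) auto
      then show "q \<in> cball (\<phi> x) (H * d' (\<phi> x))" using upper[OF i x(1)] by simp
    qed
    then have er: "exterior_radius (\<phi> ` E i) \<le> H * d' (\<phi> x)"
      using p H by (intro exterior_radius_le) auto
    have "dilatation (\<phi> ` E i) \<le> (H * d' (\<phi> x)) / (\<epsilon>2 * d' (\<phi> x))"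
      unfolding dilatation_def using er ir p \<epsilon>2 H by (intro frac_le) auto
    then show ?thesis using p by simp
  qed
  have comp': "diameter_comparable_to_dist \<Omega>' I (\<lambda>i. \<phi> ` E i)"
    unfolding diameter_comparable_to_dist_def
  proof (intro exI conjI ballI)
    \<comment> \<open>\<open>\<epsilon>2\<close> comes from the inscribed ball and
      \<open>1 / H\<close> from the chain bound; the minimum serves both inequalities.\<close>
    define C' where "C' = min \<epsilon>2 (1 / H)"
    have C': "C' > 0" "C' \<le> \<epsilon>2" "H \<le> inverse C'"
      using \<epsilon>2 H unfolding C'_def by (auto simp: min_def field_simps)
    show "C' > 0" by (rule C')
    fix i assume i: "i \<in> I"
    let ?s = "setdist (\<phi> ` E i) (- \<Omega>')"
    obtain x where x: "x \<in> E i" "cball (\<phi> x) (\<epsilon>2 * d' (\<phi> x)) \<subseteq> \<phi> ` E i" using inner[OF i] by blast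
    have xO: "\<phi> x \<in> \<Omega>'" using x sub[OF i] img by blast
    have p: "d' (\<phi> x) > 0" by (rule d'pos[OF xO])
    have b: "bounded (\<phi> ` E i)" using compact'[OF i] by (rule compact_imp_bounded)
    have "C' * ?s \<le> \<epsilon>2 * d' (\<phi> x)"
      unfolding d'_def infdist_eq_setdist using C' x(1) by (intro mult_mono setdist_le_sing) auto
    also have "\<dots> \<le> 2 * (\<epsilon>2 * d' (\<phi> x))" using p \<epsilon>2 by simp
    also have "\<dots> = diameter (cball (\<phi> x) (\<epsilon>2 * d' (\<phi> x)))"
      using mult_pos_pos[OF \<epsilon>2(1) p] by simp
    also have "\<dots> \<le> diameter (\<phi> ` E i)" by (rule diameter_subset[OF x(2) b])
    finally show "C' * ?s \<le> diameter (\<phi> ` E i)" .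
    \<comment> \<open>The chain bound holds from every base point in \<open>E i\<close>, so it
      survives the infimum over the image and becomes a bound by the set distance.\<close>
    have "diameter (\<phi> ` E i) / H \<le> ?s"
    proof (rule le_setdistI)
      show "\<phi> ` E i \<noteq> {}" using x by blast
      show "- \<Omega>' \<noteq> {}" using complement_infdist_pos[OF opn(2) assms(5) xO] by blast
      fix y z assume "y \<in> \<phi> ` E i" and z: "z \<in> - \<Omega>'"
      then obtain u where u: "u \<in> E i" "y = \<phi> u" by blast
      have "diameter (\<phi> ` E i) \<le> H * d' y" using upper[OF i u(1)] u by simp
      also have "\<dots> \<le> H * dist y z" using H z unfolding d'_def by (intro mult_left_mono infdist_le) auto
      finally show "diameter (\<phi> ` E i) / H \<le> dist y z" using H by (simp add: divide_le_eq mult.commute)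
    qed
    then have "diameter (\<phi> ` E i) \<le> H * ?s" using H by (simp add: divide_le_eq mult.commute)
    also have "\<dots> \<le> inverse C' * ?s" using C' by (intro mult_right_mono) auto
    finally show "diameter (\<phi> ` E i) \<le> inverse C' * ?s" .
  qed
  show ?thesis
    unfolding rough_whitney_family_def
  proof (intro conjI ballI)
    show "bounded \<Omega>'" by fact
    show "closed (\<phi> ` E i)" if "i \<in> I" for i using compact'[OF that] by (rule compact_imp_closed)
    show "interior (\<phi> ` E i) \<noteq> {}" if "i \<in> I" for i using intim[OF that] int[OF that] by simp
    show "closure (interior (\<phi> ` E i)) = \<phi> ` E i" if "i \<in> I" for i by (rule closure[OF that])
    show "\<phi> ` E i \<inter> - \<Omega>' = {}" if "i \<in> I" for i using sub[OF that] img by blast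
    show "\<Omega>' \<subseteq> (\<Union>i\<in>I. \<phi> ` E i)" using cover img by blast
    show "disjoint_family_on (\<lambda>i. interior (\<phi> ` E i)) I" by (rule disj')
    show "bdd_above ((\<lambda>i. dilatation (\<phi> ` E i)) ` I)"
      using dil' by (intro bdd_aboveI[of _ "H / \<epsilon>2"]) auto
    show "diameter_comparable_to_dist \<Omega>' I (\<lambda>i. \<phi> ` E i)" by (rule comp')
  qed
qed

end
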